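(* Assume the Undirected $k$-pairs Conjecture (stated in the context) holds. Then any randomized external memory algorithm that sorts $n$ integers of $w=\Omega(\lg n)$ bits each, with error probability at most $1/3$ on every input, must make an expected $$\Omega\Big(\min\Big\{n,\ \frac{n}{B}\cdot \lg_{2M/B}\frac{n}{B}\Big\}\Big)$$ I/Os (on its worst-case input).
   Context: External memory model: the machine has an internal memory holding $M$ words of $w$ bits ($m=Mw$ bits) and an unbounded disk partitioned into blocks of $B$ consecutive $w$-bit words ($b=Bw$ bits per block). The input is initially stored on disk, packed into blocks. An I/O reads one disk block into memory or writes one disk block from memory; computation on memory contents is free and may manipulate bits arbitrarily (no comparison-based or indivisibility restriction). The cost of an algorithm is the number of I/Os. In the sorting problem the $n$ input integers are stored in an array on disk ($B$ per block) and the algorithm must produce the sorted sequence on disk. Undirected $k$-pairs Conjecture (Li and Li). An instance is a directed acyclic graph $G=(V,E)$ with capacities $c(e)>0$ and $k$ source–sink pairs $(s_i,t_i)$, each with demand $1$. Each source $s_i$ receives a message $A_i$ drawn uniformly and independently from a finite set $A(i)$ (think of it as arriving on an extra in-edge of infinite capacity). A network coding solution assigns to every edge $e=(u,v)$ an alphabet and a function giving the message on $e$ from the messages on the in-edges of $u$, and to every sink $t_i$ a decoding function of the messages on its in-edges, which must output $A_i$ for all inputs. It achieves rate $r$ if $H(A_i)\ge r$ for all $i$ and $H(A_e)\le c(e)$ for every edge $e$, where $A_e$ is the random message on $e$ and $H$ is binary Shannon entropy. A multicommodity flow in the undirected graph $G'$ obtained by undirecting $G$ (same capacities and pairs) consists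 of fractional flows $f_i(u,v)\in[0,1]$, supported on edges, with at most one direction nonzero per pair and commodity, satisfying flow conservation and sending one unit from $s_i$ to $t_i$; it achieves rate $r$ if $r\sum_i (f_i(u,v)+f_i(v,u))\le c(e)$ for every edge $e=\{u,v\}$. The conjecture states: for every such instance, the network coding rate achievable in $G$ is at most the multicommodity flow rate achievable in $G'$.
   Formalization: "w = Ω(lg n)" is taken as w ≥ C lg n for an arbitrary constant C > 1; for hidden constants at most 1 the claim fails (e.g. counting sort with w = (lg n)/2, M = 4√n, B = √n/4 uses only O(n/B) I/Os). *)

theory Defs
  imports "HOL-Probability.Probability"
begin

section \<open>The undirected k-pairs conjecture\<close>

text \<open>
  Vertices are natural numbers; as all graphs are finite this is no restriction. The commodities
  are numbered by \<open>{..<npairs I}\<close>. Distinct commodities may share sources or sinks, but the source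
  and the sink of one commodity differ, so that sending one unit from the one to the other is
  meaningful.
\<close>

record kpairs =
  verts :: "nat set"
  edges :: "(nat \<times> nat) set"
  cap :: "nat \<times> nat \<Rightarrow> real"
  npairs :: nat
  src :: "nat \<Rightarrow> nat"
  snk :: "nat \<Rightarrow> nat"

definition kpairs_instance :: "kpairs \<Rightarrow> bool" where
  "kpairs_instance I \<longleftrightarrow>
     finite (verts I) \<and> edges I \<subseteq> verts I \<times> verts I \<and> acyclic (edges I) \<and>
     (\<forall>e\<in>edges I. cap I e > 0) \<and>
     (\<forall>i<npairs I. src I i \<in> verts I \<and> snk I i \<in> verts I \<and> src I i \<noteq> snk I i)"

subsection \<open>Network coding\<close>

definition shannon_entropy :: "'a measure \<Rightarrow> ('a \<Rightarrow> 'b) \<Rightarrow> real" where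
  "shannon_entropy M X = prob_space.entropy M 2 (count_space (X ` space M)) X"

definition source_space :: "kpairs \<Rightarrow> (nat \<Rightarrow> nat set) \<Rightarrow> (nat \<Rightarrow> nat) measure" where
  "source_space I A = uniform_count_measure (PiE {..<npairs I} A)"

text \<open>
  What is available at vertex \<open>u\<close>, given the source messages \<open>a\<close> and the edge messages \<open>m\<close>: the
  messages of the commodities whose source is \<open>u\<close> (arriving on the extra in-edges of \<open>u\<close>) and the
  messages on the in-edges of \<open>u\<close>.
\<close>

definition in_messages ::
  "kpairs \<Rightarrow> nat \<Rightarrow> (nat \<Rightarrow> nat) \<Rightarrow> (nat \<times> nat \<Rightarrow> nat) \<Rightarrow> (nat \<Rightarrow> nat) \<times> (nat \<times> nat \<Rightarrow> nat)" where
  "in_messages I u a m =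
     (restrict a {i. i < npairs I \<and> src I i = u}, restrict m {e \<in> edges I. snd e = u})"

text \<open>
  Message alphabets are encoded as sets of naturals: \<open>A i\<close> for commodity \<open>i\<close>, and \<open>\<nat>\<close> itself for
  every edge (finitely many symbols are used, and the entropy depends on these only). The function
  \<open>m a\<close> gives the messages that the local functions \<open>enc\<close> induce on the edges when the sources
  receive \<open>a\<close>; by acyclicity it is determined on the edges by the equations.
\<close>

definition nc_solution ::
  "kpairs \<Rightarrow> (nat \<Rightarrow> nat set) \<Rightarrow>
   (nat \<times> nat \<Rightarrow> (nat \<Rightarrow> nat) \<times> (nat \<times> nat \<Rightarrow> nat) \<Rightarrow> nat) \<Rightarrow>
   (nat \<Rightarrow> (nat \<Rightarrow> nat) \<times> (nat \<times> nat \<Rightarrow> nat) \<Rightarrow> nat) \<Rightarrow>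
   ((nat \<Rightarrow> nat) \<Rightarrow> nat \<times> nat \<Rightarrow> nat) \<Rightarrow> bool" where
  "nc_solution I A enc dec m \<longleftrightarrow>
     (\<forall>i<npairs I. finite (A i) \<and> A i \<noteq> {}) \<and>
     (\<forall>a\<in>PiE {..<npairs I} A.
        (\<forall>e\<in>edges I. m a e = enc e (in_messages I (fst e) a (m a))) \<and>
        (\<forall>i<npairs I. dec i (in_messages I (snk I i) a (m a)) = a i))"

definition nc_achieves :: "kpairs \<Rightarrow> real \<Rightarrow> bool" where
  "nc_achieves I r \<longleftrightarrow>
     (\<exists>A enc dec m. nc_solution I A enc dec m \<and>
        (\<forall>i<npairs I. shannon_entropy (source_space I A) (\<lambda>a. a i) \<ge> r) \<and>
        (\<forall>e\<in>edges I. shannon_entropy (source_space I A) (\<lambda>a. m a e) \<le> cap I e))"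

subsection \<open>Undirected multicommodity flow\<close>

definition multiflow :: "kpairs \<Rightarrow> (nat \<Rightarrow> nat \<Rightarrow> nat \<Rightarrow> real) \<Rightarrow> bool" where
  "multiflow I f \<longleftrightarrow>
     (\<forall>i<npairs I.
        (\<forall>u v. f i u v \<in> {0..1}) \<and>
        (\<forall>u v. (u, v) \<notin> edges I \<union> (edges I)\<inverse> \<longrightarrow> f i u v = 0) \<and>
        (\<forall>u v. f i u v = 0 \<or> f i v u = 0) \<and>
        (\<forall>u\<in>verts I. (\<Sum>v\<in>verts I. f i u v) - (\<Sum>v\<in>verts I. f i v u) =
           (if u = src I i then 1 else if u = snk I i then -1 else 0)))"

definition flow_achieves :: "kpairs \<Rightarrow> real \<Rightarrow> bool" where
  "flow_achieves I r \<longleftrightarrow>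
     (\<exists>f. multiflow I f \<and>
        (\<forall>(u, v)\<in>edges I. r * (\<Sum>i<npairs I. f i u v + f i v u) \<le> cap I (u, v)))"

subsection \<open>The conjecture\<close>

text \<open>
  Taking the suprema in \<^typ>\<open>ennreal\<close> makes the rate \<open>0\<close> when there is no flow at all, that is, when
  some commodity has its source and its sink in different components of the undirected graph.
\<close>

definition nc_rate :: "kpairs \<Rightarrow> ennreal" where
  "nc_rate I = (SUP r\<in>{r. nc_achieves I r}. ennreal r)"

definition flow_rate :: "kpairs \<Rightarrow> ennreal" where
  "flow_rate I = (SUP r\<in>{r. flow_achieves I r}. ennreal r)"

definition undirected_k_pairs_conjecture :: bool where
  "undirected_k_pairs_conjecture \<longleftrightarrow> (\<forall>I. kpairs_instance I \<longrightarrow> nc_rate I \<le> flow_rate I)"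


section \<open>External memory algorithms\<close>

text \<open>
  A \<open>w\<close>-bit word is a natural number below \<open>2 ^ w\<close>. The memory is a list of \<open>M\<close> words. The disk maps
  block addresses to blocks, which are lists of \<open>B\<close> words. \<open>Read a p\<close> copies block \<open>a\<close> to the memory
  words \<open>p, \<dots>, p + B - 1\<close>, and \<open>Write a p\<close> copies these memory words to block \<open>a\<close>. \<open>Halt a\<close> stops
  and declares that the output array starts at block \<open>a\<close>.
\<close>

datatype action = Read nat nat | Write nat nat | Halt nat

type_synonym memory = "nat list"
type_synonym disk = "nat \<Rightarrow> nat list"

text \<open>
  Once its coins are fixed, an algorithm determines, from the number of I/Os made so far and the
  memory contents only, the result of its (free, arbitrary) computation in memory and its next
  action.
\<close>

type_synonym det_alg = "nat \<Rightarrow> memory \<Rightarrow> memory \<times> action"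

definition memories :: "nat \<Rightarrow> nat \<Rightarrow> memory set" where
  "memories w M = {x. length x = M \<and> set x \<subseteq> {..<2 ^ w}}"

definition inputs :: "nat \<Rightarrow> nat \<Rightarrow> nat list set" where
  "inputs n w = {xs. length xs = n \<and> set xs \<subseteq> {..<2 ^ w}}"

text \<open>The input is stored from block \<open>0\<close> on; the remainder of the disk is filled with zeros.\<close>

definition init_disk :: "nat \<Rightarrow> nat list \<Rightarrow> disk" where
  "init_disk B xs j =
     map (\<lambda>p. if j * B + p < length xs then xs ! (j * B + p) else 0) [0..<B]"

fun perform :: "nat \<Rightarrow> memory \<times> action \<Rightarrow> disk \<Rightarrow> memory \<times> disk" where
  "perform B (x, Read a p) d = (take p x @ d a @ drop (p + B) x, d)"
| "perform B (x, Write a p) d = (x, d(a := take B (drop p x)))"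
| "perform B (x, Halt a) d = (x, d)"

primrec state_after :: "nat \<Rightarrow> nat \<Rightarrow> det_alg \<Rightarrow> nat list \<Rightarrow> nat \<Rightarrow> memory \<times> disk" where
  "state_after M B D xs 0 = (replicate M 0, init_disk B xs)"
| "state_after M B D xs (Suc t) =
     (let (x, d) = state_after M B D xs t in perform B (D t x) d)"

definition action_at :: "nat \<Rightarrow> nat \<Rightarrow> det_alg \<Rightarrow> nat list \<Rightarrow> nat \<Rightarrow> action" where
  "action_at M B D xs t = snd (D t (fst (state_after M B D xs t)))"

definition halts_after :: "nat \<Rightarrow> nat \<Rightarrow> det_alg \<Rightarrow> nat list \<Rightarrow> nat \<Rightarrow> nat \<Rightarrow> bool" where
  "halts_after M B D xs t a \<longleftrightarrow>
     action_at M B D xs t = Halt a \<and> (\<forall>s<t. \<forall>a'. action_at M B D xs s \<noteq> Halt a')"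

text \<open>Every action before halting is one I/O; a run that does not halt costs \<open>\<infinity>\<close>.\<close>

definition io_count :: "nat \<Rightarrow> nat \<Rightarrow> det_alg \<Rightarrow> nat list \<Rightarrow> ennreal" where
  "io_count M B D xs = (INF t\<in>{t. \<exists>a. halts_after M B D xs t a}. of_nat t)"

definition sorts_input :: "nat \<Rightarrow> nat \<Rightarrow> det_alg \<Rightarrow> nat list \<Rightarrow> bool" where
  "sorts_input M B D xs \<longleftrightarrow>
     (\<exists>t a. halts_after M B D xs t a \<and>
        (\<forall>i<length xs.
           snd (state_after M B D xs t) (a + i div B) ! (i mod B) = sort xs ! i))"

subsection \<open>Randomized algorithms\<close>

text \<open>
  A randomized algorithm has free and repeated access to an infinite sequence of fair coin tosses,
  that is, it is a random deterministic algorithm.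
\<close>

definition coins :: "(nat \<Rightarrow> bool) measure" where
  "coins = (\<Pi>\<^sub>M i\<in>UNIV. measure_pmf (bernoulli_pmf (1 / 2)))"

type_synonym rand_alg = "(nat \<Rightarrow> bool) \<Rightarrow> det_alg"

fun legal_action :: "nat \<Rightarrow> nat \<Rightarrow> action \<Rightarrow> bool" where
  "legal_action M B (Read a p) \<longleftrightarrow> p + B \<le> M"
| "legal_action M B (Write a p) \<longleftrightarrow> p + B \<le> M"
| "legal_action M B (Halt a) \<longleftrightarrow> True"

definition em_algorithm :: "nat \<Rightarrow> nat \<Rightarrow> nat \<Rightarrow> rand_alg \<Rightarrow> bool" where
  "em_algorithm w M B R \<longleftrightarrow>
     (\<forall>t. \<forall>x\<in>memories w M.
        (\<lambda>\<omega>. R \<omega> t x) \<in> measurable coins (count_space UNIV) \<and>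
        (\<forall>\<omega>. fst (R \<omega> t x) \<in> memories w M \<and> legal_action M B (snd (R \<omega> t x))))"

definition expected_ios :: "nat \<Rightarrow> nat \<Rightarrow> rand_alg \<Rightarrow> nat list \<Rightarrow> ennreal" where
  "expected_ios M B R xs = (\<integral>\<^sup>+\<omega>. io_count M B (R \<omega>) xs \<partial>coins)"

definition error_prob :: "nat \<Rightarrow> nat \<Rightarrow> rand_alg \<Rightarrow> nat list \<Rightarrow> real" where
  "error_prob M B R xs = measure coins {\<omega> \<in> space coins. \<not> sorts_input M B (R \<omega>) xs}"

end

theory Submission
  imports Defs "HOL-Combinatorics.Multiset_Permutations" "HOL-Real_Asymp.Real_Asymp"
begin

text \<open>
  Most settings of the coins give a deterministic algorithm \<open>D\<close> that sorts at least half of the inputs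
  \<open>x i = p i * 2 ^ l + y i\<close>, for \<open>p\<close> a permutation and \<open>y i < 2 ^ l\<close>, with \<open>\<tau>\<close> I/Os. Up to renaming
  of the block addresses there are only \<open>n\<close> to the power \<open>O(\<tau>)\<close> access patterns, so for a popular one and
  some \<open>p\<close> that moves most items far within it, the pattern occurs for a set \<open>S\<close> of words \<open>y\<close> of
  density at least \<open>2 powr (- \<delta> * n * l)\<close>.

  The pattern is a fixed network through which \<open>y i\<close> travels from its input block to its output block,
  for all \<open>y\<close> in \<open>S\<close>. To send independent uniform messages \<open>a i\<close>, one uses \<open>L\<close> copies of the
  network. An additional hub learns all messages, chooses \<open>y\<close> in the \<open>L\<close>-th power of \<open>S\<close> with
  \<open>y i = a i + d i\<close>, and sends the corrections \<open>d i\<close> to input blocks and sinks. As \<open>S\<close> is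
  dense, they can be chosen from sets so small that they need only a small fraction of the rate.

  By the conjecture there is a flow of almost the same rate. A flow through the hub uses the edges at
  the hub twice, and their capacity suffices for only about one direction, so about half of the flow
  travels far in the network of blocks and memory states. Grouping \<open>M div B\<close> steps gives this
  network degree \<open>O(M / B)\<close> and total capacity \<open>O(\<tau> * B * w)\<close>, which bounds \<open>\<tau>\<close> from below.
\<close>

section \<open>Covering a product of cyclic groups by shifts of a dense set\<close>

text \<open>The conjecture concerns one fixed graph and independent uniform messages. The accesses
  of a sorting algorithm depend on the data, and once pigeonhole has fixed them, the words in
  \<open>S\<close> are independent no longer: all that is known of \<open>S\<close> is its density.
  This is why messages are corrected before they are fed in: a power of a set of density
  \<open>2 powr (- \<delta> * n * l)\<close> meets every translate of a suitable product of sets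
  \<open>V i\<close> holding only a fraction \<open>3 * \<epsilon>\<close> of the bits, for \<delta>
  = \<epsilon>^2 / 2. The correction is needed at both ends, to form \<open>y i\<close> from
  \<open>a i\<close> and to get \<open>a i\<close> back. The rank \<open>p i\<close> is put in front
  so that the destination of an item does not depend on \<open>y\<close>. It takes about log n bits;
  as w exceeds log n by a constant factor, l is a constant fraction of w. The term n in the minimum
  comes from pigeonhole: the number of patterns, n to the power O(\<tau>), has to stay below
  \<open>2 powr (\<delta> * n * l)\<close>, where l is only known to be at least of order log n, so
  \<tau> must be a small fraction of n.\<close>

definition strings :: "nat \<Rightarrow> nat \<Rightarrow> nat list set" where
  "strings n q = {xs. set xs \<subseteq> {..<q} \<and> length xs = n}"

lemma finite_strings [simp]: "finite (strings n q)"
  unfolding strings_def by (rule finite_lists_length_eq) simp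

lemma card_strings: "card (strings n q) = q ^ n"
  unfolding strings_def by (subst card_lists_length_eq) auto

lemma length_strings: "y \<in> strings n q \<Longrightarrow> length y = n"
  by (simp add: strings_def)

lemma strings_nth: "y \<in> strings n q \<Longrightarrow> i < n \<Longrightarrow> y ! i < q"
  using nth_mem[of i y] by (auto simp: strings_def simp del: nth_mem)

lemma stringsI: "length y = n \<Longrightarrow> (\<And>i. i < n \<Longrightarrow> y ! i < q) \<Longrightarrow> y \<in> strings n q"
  by (auto simp: strings_def in_set_conv_nth)

section \<open>Dense sets of strings as trees with many large sets of children\<close>

definition tails :: "nat \<Rightarrow> nat list set \<Rightarrow> nat list set" where
  "tails x S = {ys. x # ys \<in> S}"

text \<open>
  View \<open>S\<close> as a tree of depth \<open>length bs\<close>. It is rich if it has a subtree reaching all levels in which the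
  nodes at the levels marked \<open>True\<close> have at least \<open>\<theta>\<close> children. As in the Sauer-Shelah lemma,
  the number of rich \<open>bs\<close>, suitably weighted, bounds the size of \<open>S\<close>.
\<close>

primrec rich :: "nat \<Rightarrow> nat \<Rightarrow> bool list \<Rightarrow> nat list set \<Rightarrow> bool" where
  "rich Q \<theta> [] S \<longleftrightarrow> [] \<in> S"
| "rich Q \<theta> (b # bs) S \<longleftrightarrow>
     (if b then \<theta> \<le> card {x. x < Q \<and> rich Q \<theta> bs (tails x S)}
      else \<exists>x<Q. rich Q \<theta> bs (tails x S))"

text \<open>One set for every node of the tree, made up of the children that are rich for the
  remaining marks. A family of shifts that hits all the large ones lets one descend from any target
  word.\<close>

primrec rich_sets :: "nat \<Rightarrow> nat \<Rightarrow> bool list \<Rightarrow> nat list set \<Rightarrow> nat set set" where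
  "rich_sets Q \<theta> [] S = {}"
| "rich_sets Q \<theta> (b # bs) S =
     insert {x. x < Q \<and> rich Q \<theta> bs (tails x S)} (\<Union>x<Q. rich_sets Q \<theta> bs (tails x S))"

lemma finite_bool_lists [simp]: "finite {bs :: bool list. length bs = n}"
  using finite_lists_length_eq[of "UNIV :: bool set" n] by simp

lemma sum_bool_lists_Suc:
  fixes f :: "bool list \<Rightarrow> nat"
  shows "(\<Sum>bs | length bs = Suc n. f bs) = (\<Sum>bs | length bs = n. f (True # bs) + f (False # bs))"
proof -
  have eq: "{bs. length bs = Suc n} =
      (#) True ` {bs. length bs = n} \<union> (#) False ` {bs. length bs = n}"
  proof (intro set_eqI iffI)
    fix bs :: "bool list" assume "bs \<in> {bs. length bs = Suc n}"
    then obtain b cs where "bs = b # cs" "length cs = n" by (auto simp: length_Suc_conv)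
    then show "bs \<in> (#) True ` {bs. length bs = n} \<union> (#) False ` {bs. length bs = n}"
      by (cases b) auto
  qed auto
  show ?thesis unfolding eq
    by (subst sum.union_disjoint) (auto simp: sum.reindex sum.distrib)
qed

text \<open>Let \<open>c\<close> children of the root be rich for \<open>bs\<close>. If \<theta>
  \<le> c, then \<open>True # bs\<close> is rich and its additional factor Q is at least c. If 0 < c
  < \<theta>, then \<open>False # bs\<close> is rich and its factor \<theta> is at least c.\<close>

lemma card_le_sum_rich:
  assumes "S \<subseteq> strings n Q"
  shows "card S \<le> (\<Sum>bs | length bs = n.
           if rich Q \<theta> bs S then Q ^ count_list bs True * \<theta> ^ count_list bs False else 0)"
  using assms
proof (induction n arbitrary: S)
  case 0
  then have "S \<subseteq> {[]}" by (auto simp: strings_def)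
  then have "S = {} \<or> S = {[]}" by auto
  then show ?case by auto
next
  case (Suc n)
  let ?w = "\<lambda>bs. Q ^ count_list bs True * \<theta> ^ count_list bs False"
  have fin: "finite S" using Suc.prems finite_strings finite_subset by blast
  have sub: "tails x S \<subseteq> strings n Q" for x
    using Suc.prems by (fastforce simp: tails_def strings_def)
  have finT: "finite (tails x S)" for x using sub finite_strings finite_subset by blast
  have S: "S = (\<Union>x<Q. (#) x ` tails x S)"
  proof (intro set_eqI iffI)
    fix s assume s: "s \<in> S"
    then have "s \<in> strings (Suc n) Q" using Suc.prems by auto
    then obtain x ys where "s = x # ys" "x < Q" by (auto simp: strings_def length_Suc_conv)
    then show "s \<in> (\<Union>x<Q. (#) x ` tails x S)" using s by (auto simp: tails_def)
  qed (auto simp: tails_def)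
  have "card S \<le> (\<Sum>x<Q. card ((#) x ` tails x S))"
    by (subst S) (rule card_UN_le, simp)
  also have "\<dots> = (\<Sum>x<Q. card (tails x S))"
    by (intro sum.cong refl card_image) auto
  also have "\<dots> \<le> (\<Sum>x<Q. \<Sum>bs | length bs = n. if rich Q \<theta> bs (tails x S) then ?w bs else 0)"
    by (intro sum_mono Suc.IH sub)
  also have "\<dots> = (\<Sum>bs | length bs = n. \<Sum>x<Q. if rich Q \<theta> bs (tails x S) then ?w bs else 0)"
    by (rule sum.swap)
  also have "\<dots> = (\<Sum>bs | length bs = n. card {x. x < Q \<and> rich Q \<theta> bs (tails x S)} * ?w bs)"
  proof (intro sum.cong refl)
    fix bs :: "bool list"
    have "(\<Sum>x<Q. if rich Q \<theta> bs (tails x S) then ?w bs else 0) =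
        (\<Sum>x | x < Q \<and> rich Q \<theta> bs (tails x S). ?w bs)"
      by (subst sum.inter_filter[symmetric]) (auto simp: lessThan_def)
    then show "(\<Sum>x<Q. if rich Q \<theta> bs (tails x S) then ?w bs else 0) =
        card {x. x < Q \<and> rich Q \<theta> bs (tails x S)} * ?w bs" by simp
  qed
  also have "\<dots> \<le> (\<Sum>bs | length bs = n.
      (if rich Q \<theta> (True # bs) S then ?w (True # bs) else 0) +
      (if rich Q \<theta> (False # bs) S then ?w (False # bs) else 0))"
  proof (intro sum_mono)
    fix bs :: "bool list"
    define c where "c = card {x. x < Q \<and> rich Q \<theta> bs (tails x S)}"
    have c: "c \<le> Q"
      unfolding c_def using card_mono[of "{..<Q}" "{x. x < Q \<and> rich Q \<theta> bs (tails x S)}"] by auto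
    have nz: "\<exists>x<Q. rich Q \<theta> bs (tails x S)" if "c > 0"
      using that unfolding c_def by (metis (mono_tags, lifting) Collect_empty_eq card.empty less_irrefl)
    have "c * ?w bs \<le> (if \<theta> \<le> c then Q * ?w bs else 0) + (if c > 0 then \<theta> * ?w bs else 0)"
    proof (cases "\<theta> \<le> c")
      case True
      have "c * ?w bs \<le> Q * ?w bs" by (rule mult_right_mono[OF c]) simp
      then show ?thesis using True by (auto intro: trans_le_add1)
    next
      case False
      have "c * ?w bs \<le> \<theta> * ?w bs" by (rule mult_right_mono) (use False in auto)
      then show ?thesis using False by (cases "c = 0") simp_all
    qed
    also have "\<dots> \<le> (if rich Q \<theta> (True # bs) S then ?w (True # bs) else 0) +
      (if rich Q \<theta> (False # bs) S then ?w (False # bs) else 0)"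
      using nz by (auto simp: c_def)
    finally show "c * ?w bs \<le> \<dots>" .
  qed
  finally show ?case by (subst sum_bool_lists_Suc)
qed

lemma count_list_True_False: "count_list bs True + count_list bs False = length bs"
  by (induction bs) auto

text \<open>If every rich \<open>bs\<close> had s or more marks \<open>False\<close>, each of the at
  most 2^n terms of the weighted sum would be bounded by \<open>Q ^ (n - s) * \<theta> ^ s\<close>,
  because \<theta> \<le> Q.\<close>

lemma exists_rich:
  assumes S: "S \<subseteq> strings n Q" and \<theta>: "\<theta> \<le> Q" and s: "s \<le> n"
    and big: "2 ^ n * (Q ^ (n - s) * \<theta> ^ s) < card S"
  shows "\<exists>bs. length bs = n \<and> rich Q \<theta> bs S \<and> count_list bs False < s"
proof (rule ccontr)
  assume "\<nexists>bs. length bs = n \<and> rich Q \<theta> bs S \<and> count_list bs False < s"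
  then have *: "s \<le> count_list bs False" if "length bs = n" "rich Q \<theta> bs S" for bs
    using that not_le by auto
  have "card S \<le> (\<Sum>bs | length bs = n.
           if rich Q \<theta> bs S then Q ^ count_list bs True * \<theta> ^ count_list bs False else 0)"
    by (rule card_le_sum_rich[OF S])
  also have "\<dots> \<le> (\<Sum>bs :: bool list | length bs = n. Q ^ (n - s) * \<theta> ^ s)"
  proof (rule sum_mono)
    fix bs :: "bool list" assume "bs \<in> {bs. length bs = n}"
    then have len: "length bs = n" by simp
    show "(if rich Q \<theta> bs S then Q ^ count_list bs True * \<theta> ^ count_list bs False else 0)
          \<le> Q ^ (n - s) * \<theta> ^ s"
    proof (cases "rich Q \<theta> bs S")
      case True
      define f where "f = count_list bs False"
      have f: "s \<le> f" "count_list bs True = n - f" "f \<le> n"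
        using *[OF len True] count_list_True_False[of bs] len by (auto simp: f_def)
      have "Q ^ (n - f) * \<theta> ^ f = Q ^ (n - f) * \<theta> ^ (f - s) * \<theta> ^ s"
        using f by (simp add: mult.assoc flip: power_add)
      also have "\<dots> \<le> Q ^ (n - f) * Q ^ (f - s) * \<theta> ^ s"
        using \<theta> by (intro mult_right_mono mult_left_mono power_mono) auto
      also have "\<dots> = Q ^ (n - s) * \<theta> ^ s" using f by (simp flip: power_add)
      finally show ?thesis using True f by (simp add: f_def)
    qed simp
  qed
  also have "\<dots> = card {bs :: bool list. length bs = n} * (Q ^ (n - s) * \<theta> ^ s)" by simp
  also have "card {bs :: bool list. length bs = n} = 2 ^ n"
    using card_lists_length_eq[of "UNIV :: bool set" n] by simp
  finally show False using big by simp
qed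

lemma card_rich_sets:
  assumes "Q \<ge> 1"
  shows "finite (rich_sets Q \<theta> bs S) \<and> card (rich_sets Q \<theta> bs S) \<le> length bs * Q ^ length bs"
proof (induction bs arbitrary: S)
  case (Cons b bs)
  let ?U = "\<Union>x<Q. rich_sets Q \<theta> bs (tails x S)"
  have "card ?U \<le> (\<Sum>x<Q. card (rich_sets Q \<theta> bs (tails x S)))" by (rule card_UN_le) simp
  also have "\<dots> \<le> (\<Sum>x<Q. length bs * Q ^ length bs)" by (intro sum_mono) (use Cons.IH in auto)
  also have "\<dots> = length bs * Q ^ length (b # bs)" by simp
  finally have "card ?U \<le> length bs * Q ^ length (b # bs)" .
  moreover have "card (rich_sets Q \<theta> (b # bs) S) \<le> Suc (card ?U)"
    using Cons.IH by (simp add: card_insert_if)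
  moreover have "1 \<le> Q ^ length (b # bs)" using assms by simp
  moreover have "finite (rich_sets Q \<theta> (b # bs) S)" using Cons.IH by simp
  moreover have "length (b # bs) * Q ^ length (b # bs) =
      Q ^ length (b # bs) + length bs * Q ^ length (b # bs)" by simp
  ultimately show ?case by linarith
qed simp

section \<open>Shifts modulo Q that hit many large sets at once\<close>

lemma mod_add_left_cancel_nat:
  fixes a u v Q :: nat
  assumes "(a + u) mod Q = (a + v) mod Q"
  shows "u mod Q = v mod Q"
proof -
  have "(int a + int u) mod int Q = (int a + int v) mod int Q"
    using assms by (metis of_nat_add zmod_int)
  then have "int Q dvd int u - int v" by (simp add: mod_eq_dvd_iff)
  then show ?thesis by (metis mod_eq_dvd_iff of_nat_eq_iff zmod_int)
qed

lemma bij_betw_shift_mod: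
  fixes a Q :: nat
  assumes "Q > 0"
  shows "bij_betw (\<lambda>v. (a + v) mod Q) {..<Q} {..<Q}"
proof -
  have "inj_on (\<lambda>v. (a + v) mod Q) {..<Q}"
  proof (rule inj_onI)
    fix u v assume "u \<in> {..<Q}" "v \<in> {..<Q}" "(a + u) mod Q = (a + v) mod Q"
    then have "u mod Q = v mod Q" by (metis mod_add_left_cancel_nat)
    then show "u = v" using \<open>u \<in> _\<close> \<open>v \<in> _\<close> by simp
  qed
  moreover have "(\<lambda>v. (a + v) mod Q) ` {..<Q} \<subseteq> {..<Q}" using assms by auto
  moreover have "(\<lambda>v. (a + v) mod Q) ` {..<Q} = {..<Q}"
    by (rule endo_inj_surj) (use calculation in auto)
  ultimately show ?thesis by (simp add: bij_betw_def)
qed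

text \<open>Union bound over the pairs (T, a): a uniform shift carries \<open>a\<close> outside T
  with probability at most 1 - \<theta> / Q, and all K independent shifts do so with the K-th power
  of this. Probabilities are replaced by counting functions \<open>v\<close>.\<close>

lemma exists_hitting_shifts:
  assumes Q: "Q > 0" and F: "finite F" "\<And>T. T \<in> F \<Longrightarrow> T \<subseteq> {..<Q} \<and> \<theta> \<le> card T"
    and small: "card F * Q * (Q - \<theta>) ^ K < Q ^ K"
  shows "\<exists>v. (\<forall>h<K. v h < Q) \<and> (\<forall>T\<in>F. \<forall>a<Q. \<exists>h<K. (a + v h) mod Q \<in> T)"
proof (rule ccontr)
  assume nt: "\<nexists>v. (\<forall>h<K. v h < Q) \<and> (\<forall>T\<in>F. \<forall>a<Q. \<exists>h<K. (a + v h) mod Q \<in> T)"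
  define bad where "bad = (\<lambda>(T, a). {..<K} \<rightarrow>\<^sub>E {v. v < Q \<and> (a + v) mod Q \<notin> T})"
  have "({..<K} \<rightarrow>\<^sub>E {..<Q}) \<subseteq> \<Union> (bad ` (F \<times> {..<Q}))"
  proof
    fix v assume v: "v \<in> {..<K} \<rightarrow>\<^sub>E {..<Q}"
    show "v \<in> \<Union> (bad ` (F \<times> {..<Q}))"
    proof (rule ccontr)
      assume *: "v \<notin> \<Union> (bad ` (F \<times> {..<Q}))"
      have "\<exists>h<K. (a + v h) mod Q \<in> T" if "T \<in> F" "a < Q" for T a
      proof (rule ccontr)
        assume "\<not> (\<exists>h<K. (a + v h) mod Q \<in> T)"
        then have "v \<in> bad (T, a)" using v by (auto simp: bad_def PiE_def Pi_def)
        then show False using * that by auto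
      qed
      moreover have "v h < Q" if "h < K" for h using v that by auto
      ultimately show False using nt by blast
    qed
  qed
  then have "card ({..<K} \<rightarrow>\<^sub>E {..<Q}) \<le> card (\<Union> (bad ` (F \<times> {..<Q})))"
    by (rule card_mono[rotated]) (auto simp: bad_def F(1) intro!: finite_PiE)
  also have "\<dots> \<le> (\<Sum>p\<in>F \<times> {..<Q}. card (bad p))" by (rule card_UN_le) (simp add: F(1))
  also have "\<dots> \<le> (\<Sum>p\<in>F \<times> {..<Q}. (Q - \<theta>) ^ K)"
  proof (rule sum_mono, clarify)
    fix T a assume T: "T \<in> F" and a: "a < Q"
    have b: "bij_betw (\<lambda>v. (a + v) mod Q) {..<Q} {..<Q}" by (rule bij_betw_shift_mod[OF Q])
    have "card {v. v < Q \<and> (a + v) mod Q \<notin> T} =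
        card ((\<lambda>v. (a + v) mod Q) ` {v. v < Q \<and> (a + v) mod Q \<notin> T})"
      by (rule card_image[symmetric])
        (rule inj_on_subset[OF bij_betw_imp_inj_on[OF b]], auto)
    also have "\<dots> \<le> card ({..<Q} - T)" using Q by (intro card_mono) auto
    also have "\<dots> = Q - card T"
      using F(2)[OF T] by (subst card_Diff_subset) (auto intro: finite_subset)
    also have "\<dots> \<le> Q - \<theta>" using F(2)[OF T] by (intro diff_le_mono2) auto
    finally show "card (bad (T, a)) \<le> (Q - \<theta>) ^ K"
      by (auto simp: bad_def card_PiE intro: power_mono)
  qed
  also have "\<dots> = card F * Q * (Q - \<theta>) ^ K" by (simp add: card_cartesian_product)
  finally show False using small by (simp add: card_PiE)
qed

text \<open>The word \<open>y\<close> is built by descending the tree: at a marked level the rich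
  children form a large set, which some shift of the target letter hits; at an unmarked level any
  rich child will do.\<close>

lemma rich_cover:
  assumes "rich Q \<theta> bs S" "\<theta> > 0"
    and "\<And>T a. T \<in> rich_sets Q \<theta> bs S \<Longrightarrow> \<theta> \<le> card T \<Longrightarrow> a < Q \<Longrightarrow> \<exists>h<K. (a + v h) mod Q \<in> T"
    and "length as = length bs" "set as \<subseteq> {..<Q}"
  shows "\<exists>y\<in>S. length y = length bs \<and>
    (\<forall>i<length bs. y ! i < Q \<and> (bs ! i \<longrightarrow> (\<exists>h<K. y ! i = (as ! i + v h) mod Q)))"
  using assms
proof (induction bs arbitrary: S as)
  case Nil
  then show ?case by auto
next
  case (Cons b bs)
  obtain a as' where as: "as = a # as'" "a < Q" "length as' = length bs" "set as' \<subseteq> {..<Q}"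
    using Cons.prems(4,5) by (cases as) auto
  have "\<exists>x<Q. rich Q \<theta> bs (tails x S) \<and> (b \<longrightarrow> (\<exists>h<K. x = (a + v h) mod Q))"
  proof (cases b)
    case True
    then have "\<theta> \<le> card {x. x < Q \<and> rich Q \<theta> bs (tails x S)}" using Cons.prems(1) by simp
    from Cons.prems(3)[OF _ this as(2)] obtain h where
      "h < K" "(a + v h) mod Q \<in> {x. x < Q \<and> rich Q \<theta> bs (tails x S)}" by auto
    then show ?thesis using True by auto
  qed (use Cons.prems(1) in auto)
  then obtain x where x: "x < Q" "rich Q \<theta> bs (tails x S)" "b \<longrightarrow> (\<exists>h<K. x = (a + v h) mod Q)"
    by auto
  have "\<exists>y\<in>tails x S. length y = length bs \<and>
    (\<forall>i<length bs. y ! i < Q \<and> (bs ! i \<longrightarrow> (\<exists>h<K. y ! i = (as' ! i + v h) mod Q)))"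
    by (rule Cons.IH[OF x(2) Cons.prems(2) _ as(3,4)]) (rule Cons.prems(3), use x in auto)
  then obtain y where y: "x # y \<in> S" "length y = length bs"
    "\<forall>i<length bs. y ! i < Q \<and> (bs ! i \<longrightarrow> (\<exists>h<K. y ! i = (as' ! i + v h) mod Q))"
    by (auto simp: tails_def)
  show ?case
  proof (rule bexI[OF _ y(1)], intro conjI allI impI)
    fix i assume "i < length (b # bs)"
    then show "(x # y) ! i < Q" using x y by (cases i) auto
  next
    fix i assume "i < length (b # bs)" "(b # bs) ! i"
    then show "\<exists>h<K. (x # y) ! i = (as ! i + v h) mod Q" using x y as by (cases i) auto
  qed (use y in simp)
qed

section \<open>Powers of a set of strings, by digits in base q\<close>

definition digit :: "nat \<Rightarrow> nat \<Rightarrow> nat \<Rightarrow> nat" where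
  "digit q l x = x div q ^ l mod q"

lemma digit_less: "q > 0 \<Longrightarrow> digit q l x < q"
  by (simp add: digit_def)

lemma digits_eq_imp_eq:
  assumes "x < q ^ L" "y < q ^ L" "\<And>l. l < L \<Longrightarrow> digit q l x = digit q l y"
  shows "x = y"
  using assms
proof (induction L arbitrary: x y)
  case (Suc L)
  have dd: "digit q l (x div q) = digit q (Suc l) x" for l x
    by (simp add: digit_def div_mult2_eq)
  have q: "q > 0" using Suc.prems(1) by (cases q) auto
  have "x div q = y div q"
  proof (rule Suc.IH)
    show "x div q < q ^ L" "y div q < q ^ L"
      using Suc.prems q by (auto simp: less_mult_imp_div_less mult.commute)
  qed (use Suc.prems(3) in \<open>auto simp: dd\<close>)
  moreover have "x mod q = y mod q" using Suc.prems(3)[of 0] by (simp add: digit_def)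
  ultimately show ?case by (metis div_mult_mod_eq)
qed simp

text \<open>Its elements encode the L-tuples of elements of \<open>S\<close>: a letter below
  \<open>q ^ L\<close> packs the L letters that the members of the tuple have at that
  position.\<close>

definition string_power :: "nat \<Rightarrow> nat \<Rightarrow> nat \<Rightarrow> nat list set \<Rightarrow> nat list set" where
  "string_power q L n S = {y \<in> strings n (q ^ L). \<forall>l<L. map (digit q l) y \<in> S}"

lemma card_string_power:
  assumes S: "S \<subseteq> strings n q" and q: "q > 0"
  shows "card S ^ L \<le> card (string_power q L n S)"
proof (induction L)
  case 0
  have "replicate n 0 \<in> string_power q 0 n S" by (auto simp: string_power_def strings_def)
  moreover have "finite (string_power q 0 n S)" by (auto simp: string_power_def)
  ultimately show ?case by (auto simp: Suc_le_eq card_gt_0_iff)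
next
  case (Suc L)
  define g where "g = (\<lambda>(y :: nat list, z). map2 (\<lambda>a b. a + q ^ L * b) y z)"
  have low: "digit q l (a + q ^ L * b) = digit q l a" if "l < L" for l a b
  proof -
    have "q ^ L = q ^ l * (q * q ^ (L - Suc l))"
      using that by (metis Suc_diff_Suc le_add_diff_inverse less_imp_le_nat power_Suc power_add)
    then show ?thesis using q by (simp add: digit_def mult.assoc)
  qed
  have high: "digit q L (a + q ^ L * b) = b" if "a < q ^ L" "b < q" for a b
    using that q by (simp add: digit_def)
  have lmap: "map (digit q l) (g (y, z)) = map (digit q l) y" if "l < L" "length y = length z" for l y z
    using that by (auto simp: g_def low intro!: nth_equalityI)
  have hmap: "map (digit q L) (g (y, z)) = z" if "y \<in> strings n (q ^ L)" "z \<in> strings n q" for y z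
    using that strings_nth[OF that(1)] strings_nth[OF that(2)]
    by (auto simp: g_def length_strings intro!: nth_equalityI high)
  have mmap: "map (\<lambda>a. a mod q ^ L) (g (y, z)) = y" if "y \<in> strings n (q ^ L)" "z \<in> strings n q" for y z
    using that strings_nth[OF that(1)] by (auto simp: g_def length_strings intro!: nth_equalityI)
  have sp: "y \<in> strings n (q ^ L)" if "y \<in> string_power q L n S" for y
    using that by (auto simp: string_power_def)
  have gs: "g (y, z) \<in> strings n (q ^ Suc L)" if "y \<in> strings n (q ^ L)" "z \<in> strings n q" for y z
  proof -
    have "a + q ^ L * b < q ^ Suc L" if "a < q ^ L" "b < q" for a b
    proof -
      have "a + q ^ L * b < q ^ L * Suc b" using that by simp
      also have "\<dots> \<le> q ^ L * q" using that by (intro mult_left_mono) auto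
      finally show ?thesis by (simp add: mult.commute)
    qed
    then show ?thesis using that strings_nth[OF that(1)] strings_nth[OF that(2)]
      by (auto simp: g_def length_strings intro!: stringsI)
  qed
  have "card (string_power q L n S \<times> S) = card (g ` (string_power q L n S \<times> S))"
  proof (rule card_image[symmetric], rule inj_onI, clarify)
    fix y z y' z' assume "y \<in> string_power q L n S" "z \<in> S" "y' \<in> string_power q L n S" "z' \<in> S"
      "g (y, z) = g (y', z')"
    then show "y = y' \<and> z = z'" using hmap[of y z] hmap[of y' z'] mmap[of y z] mmap[of y' z'] sp S
      by (auto dest: sp)
  qed
  also have "\<dots> \<le> card (string_power q (Suc L) n S)"
  proof (rule card_mono)
    show "finite (string_power q (Suc L) n S)" by (auto simp: string_power_def)
    show "g ` (string_power q L n S \<times> S) \<subseteq> string_power q (Suc L) n S"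
    proof clarify
      fix y z assume y: "y \<in> string_power q L n S" and z: "z \<in> S"
      have ys: "y \<in> strings n (q ^ L)" and zs: "z \<in> strings n q" using sp[OF y] S z by auto
      have len: "length y = length z" using ys zs by (auto simp: strings_def)
      show "g (y, z) \<in> string_power q (Suc L) n S"
        unfolding string_power_def
      proof (intro CollectI conjI allI impI)
        show "g (y, z) \<in> strings n (q ^ Suc L)" by (rule gs[OF ys zs])
        fix l assume "l < Suc L"
        then consider "l < L" | "l = L" by linarith
        then show "map (digit q l) (g (y, z)) \<in> S"
        proof cases
          case 1
          then show ?thesis using y lmap[OF 1 len] by (simp add: string_power_def)
        next
          case 2
          then show ?thesis using hmap[OF ys zs] z by simp
        qed
      qed
    qed
  qed
  finally have "card (string_power q L n S) * card S \<le> card (string_power q (Suc L) n S)"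
    by (simp add: card_cartesian_product)
  moreover have "card S ^ Suc L \<le> card (string_power q L n S) * card S" using Suc.IH by simp
  ultimately show ?case by linarith
qed

text \<open>
  Random shifts hit all large sets of children at once, by a union bound over the nodes of the tree.
  Passing to a power \<open>q ^ L\<close> makes room for this bound, since \<open>q\<close> may be smaller than \<open>n\<close>.
\<close>

lemma exists_covering:
  fixes \<epsilon> :: real
  assumes n: "n \<ge> 1" and q: "q \<ge> 2" and \<epsilon>: "0 < \<epsilon>" "\<epsilon> < 1"
    and S: "S \<subseteq> strings n q"
    and dense: "real q powr (real n * (1 - \<epsilon>\<^sup>2 / 2)) \<le> real (card S)"
  shows "\<exists>L>0. \<exists>V c. (\<forall>i<n. V i \<subseteq> {..<q ^ L} \<and> 0 < c i \<and> real (card (V i)) \<le> 2 powr c i) \<and>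
    (\<Sum>i<n. c i) \<le> 3 * \<epsilon> * real n * log 2 (real (q ^ L)) \<and>
    (\<forall>as. length as = n \<and> set as \<subseteq> {..<q ^ L} \<longrightarrow>
      (\<exists>y d. y \<in> string_power q L n S \<and> (\<forall>i<n. d i \<in> V i \<and> y ! i = (as ! i + d i) mod q ^ L)))"
proof -
  \<comment> \<open>The first condition absorbs the 2^n mark lists and the factor 2 lost at up to n
    levels by rounding \<theta> up. The second is the union bound for at most
    \<open>n * X ^ n\<close> sets and X targets: about \<open>X powr (2 * \<epsilon>)\<close> shifts
    and sets of density \<open>X powr (- \<epsilon>)\<close> leave a failure probability of about
    \<open>exp (- (X powr \<epsilon>))\<close>.\<close>
  have "eventually (\<lambda>X. 4 < X powr (\<epsilon>\<^sup>2 / 2) \<and>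
      real n * X ^ Suc n * exp (- ((X powr (2 * \<epsilon>) - 1) * X powr (- \<epsilon>))) < 1) at_top"
  proof (rule eventually_conj)
    show "eventually (\<lambda>X. 4 < X powr (\<epsilon>\<^sup>2 / 2)) at_top"
      using \<epsilon> by real_asymp
    show "eventually (\<lambda>X. real n * X ^ Suc n * exp (- ((X powr (2 * \<epsilon>) - 1) * X powr (- \<epsilon>))) < 1) at_top"
    proof -
      have "eventually (\<lambda>X. real n * X powr real (Suc n) * exp (- ((X powr (2 * \<epsilon>) - 1) * X powr (- \<epsilon>))) < 1) at_top"
        using \<epsilon>(1) by real_asymp
      then show ?thesis
        using eventually_gt_at_top[of 0] by eventually_elim (simp add: powr_realpow del: of_nat_Suc power_Suc)
    qed
  qed
  then obtain X0 where X0: "\<And>X. X \<ge> X0 \<Longrightarrow> 4 < X powr (\<epsilon>\<^sup>2 / 2) \<and>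
      real n * X ^ Suc n * exp (- ((X powr (2 * \<epsilon>) - 1) * X powr (- \<epsilon>))) < 1"
    unfolding eventually_at_top_linorder by blast
  obtain L0 where L0: "X0 < real q ^ L0" using real_arch_pow[of "real q" X0] q by auto
  define L where "L = Suc L0"
  define Q where "Q = q ^ L"
  define X where "X = real Q"
  have X: "X \<ge> X0"
  proof -
    have "real q ^ L0 \<le> real q ^ L" using q by (intro power_increasing) (auto simp: L_def)
    then show ?thesis using L0 by (simp add: X_def Q_def)
  qed
  have Q2: "Q \<ge> 2"
  proof -
    have "q ^ 1 \<le> q ^ L" using q by (intro power_increasing) (auto simp: L_def)
    then show ?thesis using q by (simp add: Q_def)
  qed
  have X2: "X \<ge> 2" using Q2 by (simp add: X_def)
  \<comment> \<open>With s about \<epsilon> * n, having s or more unmarked levels would cost a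
    factor \<open>X powr (- \<epsilon>)\<close> at each of them, in all
    \<open>X powr (- \<epsilon>\<^sup>2 * n)\<close>, which is less than the density of the power of
    \<open>S\<close>.\<close>
  define \<theta> where "\<theta> = nat \<lceil>X powr (1 - \<epsilon>)\<rceil>"
  have \<theta>_ge: "X powr (1 - \<epsilon>) \<le> real \<theta>" by (simp add: \<theta>_def)
  have X1: "1 \<le> X powr (1 - \<epsilon>)" using X2 \<epsilon> by (simp add: ge_one_powr_ge_zero)
  have \<theta>_pos: "\<theta> > 0" using \<theta>_ge X1 by (cases \<theta>) auto
  have \<theta>_le2: "real \<theta> \<le> 2 * X powr (1 - \<epsilon>)"
    using X1 ceiling_correct[of "X powr (1 - \<epsilon>)"] by (simp add: \<theta>_def)
  have \<theta>_Q: "\<theta> \<le> Q"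
  proof -
    have "X powr (1 - \<epsilon>) \<le> X powr 1" using X2 \<epsilon> by (intro powr_mono) auto
    then have "\<lceil>X powr (1 - \<epsilon>)\<rceil> \<le> int Q" using X2 by (simp add: X_def ceiling_le_iff)
    then show ?thesis unfolding \<theta>_def by (simp only: nat_le_iff)
  qed
  define s where "s = nat \<lceil>\<epsilon> * real n\<rceil>"
  have s_ge: "\<epsilon> * real n \<le> real s" unfolding s_def by (rule real_nat_ceiling_ge)
  have s_n: "s \<le> n"
  proof -
    have "\<epsilon> * real n \<le> 1 * real n" using \<epsilon> by (intro mult_right_mono) auto
    then show ?thesis by (simp add: s_def ceiling_le_iff)
  qed
  define SL where "SL = string_power q L n S"
  have SL: "SL \<subseteq> strings n Q" by (auto simp: SL_def string_power_def Q_def)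
  have "2 ^ n * (Q ^ (n - s) * \<theta> ^ s) < card SL"
  proof -
    have "real (2 ^ n * (Q ^ (n - s) * \<theta> ^ s)) = 2 ^ n * (X powr real (n - s) * real \<theta> ^ s)"
      using X2 by (simp add: powr_realpow X_def)
    also have "\<dots> \<le> 2 ^ n * (X powr real (n - s) * (2 * X powr (1 - \<epsilon>)) ^ s)"
      by (intro mult_left_mono power_mono \<theta>_le2) auto
    also have "\<dots> = 2 ^ n * 2 ^ s * X powr (real n - \<epsilon> * real s)"
      using X2 s_n by (simp add: power_mult_distrib powr_power flip: powr_add) (simp add: algebra_simps)
    also have "\<dots> \<le> 2 ^ n * 2 ^ n * X powr (real n * (1 - \<epsilon>\<^sup>2))"
    proof (intro mult_mono power_increasing powr_mono)
      have "\<epsilon> * (\<epsilon> * real n) \<le> \<epsilon> * real s" using s_ge \<epsilon> by (intro mult_left_mono) auto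
      then show "real n - \<epsilon> * real s \<le> real n * (1 - \<epsilon>\<^sup>2)"
        by (simp add: algebra_simps power2_eq_square)
    qed (use X2 s_n in auto)
    also have "\<dots> = 4 ^ n * X powr (real n * (1 - \<epsilon>\<^sup>2))"
      by (simp flip: power_mult_distrib)
    also have "\<dots> < (X powr (\<epsilon>\<^sup>2 / 2)) ^ n * X powr (real n * (1 - \<epsilon>\<^sup>2))"
      using X0[OF X] n X2 by (intro mult_strict_right_mono power_strict_mono) auto
    also have "\<dots> = X powr (real n * (1 - \<epsilon>\<^sup>2 / 2))"
      using X2 by (simp add: powr_power flip: powr_add) (simp add: algebra_simps)
    also have "\<dots> = (real q powr (real n * (1 - \<epsilon>\<^sup>2 / 2))) ^ L"
      using q by (simp add: X_def Q_def powr_power flip: powr_realpow) (simp add: powr_powr mult.commute)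
    also have "\<dots> \<le> real (card S) ^ L" using dense by (intro power_mono) auto
    also have "\<dots> \<le> real (card SL)"
      using card_string_power[OF S, of L] q unfolding SL_def
      by (metis le_zero_eq not_numeral_le_zero not_gr_zero of_nat_le_iff of_nat_power)
    finally show ?thesis by linarith
  qed
  from exists_rich[OF SL \<theta>_Q s_n this] obtain bs where
    bs: "length bs = n" "rich Q \<theta> bs SL" "count_list bs False < s" by auto
  \<comment> \<open>A set of density \<open>X powr (- \<epsilon>)\<close> is expected to be hit
    after \<open>X powr \<epsilon>\<close> shifts; another factor \<open>X powr \<epsilon>\<close>
    pays for the union bound.\<close>
  define K where "K = nat \<lfloor>X powr (2 * \<epsilon>)\<rfloor>"
  have K_le: "real K \<le> X powr (2 * \<epsilon>)" by (simp add: K_def)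
  have K_ge: "X powr (2 * \<epsilon>) - 1 \<le> real K" using floor_correct[of "X powr (2 * \<epsilon>)"] by (simp add: K_def)
  define F where "F = {T \<in> rich_sets Q \<theta> bs SL. \<theta> \<le> card T}"
  have Q1: "Q \<ge> 1" using Q2 by simp
  have fin: "finite (rich_sets Q \<theta> bs SL)" and cardR: "card (rich_sets Q \<theta> bs SL) \<le> n * Q ^ n"
    using card_rich_sets[OF Q1, of \<theta> bs SL] bs by auto
  have rs: "T \<subseteq> {..<Q}" if "T \<in> rich_sets Q \<theta> bs' S'" for T bs' S'
    using that by (induction bs' arbitrary: S') auto
  have "card F * Q * (Q - \<theta>) ^ K < Q ^ K"
  proof -
    have F: "card F \<le> n * Q ^ n"
      using card_mono[OF fin, of F] cardR by (auto simp: F_def)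
    define E where "E = exp (- ((X powr (2 * \<epsilon>) - 1) * X powr (- \<epsilon>)))"
    have "real ((Q - \<theta>) ^ K) = X ^ K * (1 - real \<theta> / X) ^ K"
      using \<theta>_Q X2 by (simp add: X_def of_nat_diff field_simps flip: power_mult_distrib)
    also have "\<dots> \<le> X ^ K * exp (- (real \<theta> / X)) ^ K"
      using \<theta>_Q X2 exp_ge_add_one_self[of "- (real \<theta> / X)"]
      by (intro mult_left_mono power_mono) (auto simp: X_def)
    also have "\<dots> = X ^ K * exp (- (real K * (real \<theta> / X)))"
      by (simp flip: exp_of_nat_mult)
    also have "\<dots> \<le> X ^ K * E"
    proof -
      have "X powr (- \<epsilon>) = X powr (1 - \<epsilon>) / X"
        using X2 by (simp add: powr_diff powr_minus divide_simps)
      also have "\<dots> \<le> real \<theta> / X" using \<theta>_ge X2 by (intro divide_right_mono) auto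
      finally have "(X powr (2 * \<epsilon>) - 1) * X powr (- \<epsilon>) \<le> real K * (real \<theta> / X)"
        using K_ge by (intro mult_mono) auto
      then show ?thesis using X2 by (auto simp: E_def intro: mult_left_mono)
    qed
    finally have 1: "real ((Q - \<theta>) ^ K) \<le> X ^ K * E" .
    have "real (card F * Q * (Q - \<theta>) ^ K) \<le> real (n * Q ^ n * Q) * real ((Q - \<theta>) ^ K)"
      using F by (simp only: of_nat_mult[symmetric] of_nat_le_iff) (intro mult_mono; simp)
    also have "\<dots> \<le> real n * X ^ Suc n * (X ^ K * E)"
      using 1 by (intro mult_mono) (auto simp: X_def)
    also have "\<dots> = X ^ K * (real n * X ^ Suc n * E)"
      by (simp only: mult_ac)
    also have "\<dots> < X ^ K * 1"
      using X0[OF X] X2 by (intro mult_strict_left_mono) (auto simp: E_def)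
    finally have "real (card F * Q * (Q - \<theta>) ^ K) < real (Q ^ K)" by (simp add: X_def)
    then show ?thesis by linarith
  qed
  note small = this
  have FF: "finite F" and FT: "\<And>T. T \<in> F \<Longrightarrow> T \<subseteq> {..<Q} \<and> \<theta> \<le> card T"
    using fin rs by (auto simp: F_def)
  have Q0: "Q > 0" using Q1 by simp
  obtain v where v: "\<And>h. h < K \<Longrightarrow> v h < Q"
    "\<And>T a. T \<in> F \<Longrightarrow> a < Q \<Longrightarrow> \<exists>h<K. (a + v h) mod Q \<in> T"
    using exists_hitting_shifts[OF Q0 FF FT small] by blast
  \<comment> \<open>At an unmarked position the correction is arbitrary and costs the full
    \<open>log 2 X\<close> bits; there are at most \<epsilon> * n such positions. Together with 2 *
    \<epsilon> for every marked one this gives 3 * \<epsilon>.\<close>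
  define V where "V = (\<lambda>i. if bs ! i then v ` {..<K} else {..<Q})"
  define c where "c = (\<lambda>i. if bs ! i then 2 * \<epsilon> * log 2 X else log 2 X)"
  have lX: "log 2 X > 0" using X2 by simp
  have "(\<Sum>i<n. c i) \<le> 3 * \<epsilon> * real n * log 2 X"
  proof -
    have "(\<Sum>i<n. c i) \<le> (\<Sum>i<n. 2 * \<epsilon> * log 2 X + (if bs ! i then 0 else log 2 X))"
      using lX \<epsilon> by (intro sum_mono) (auto simp: c_def)
    also have "\<dots> = 2 * \<epsilon> * log 2 X * real n + (\<Sum>i<n. if bs ! i then 0 else log 2 X)"
      by (simp add: sum.distrib)
    also have "(\<Sum>i<n. if bs ! i then 0 else log 2 X) = real (count_list bs False) * log 2 X"
      using bs(1)
    proof (induction bs arbitrary: n)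
      case (Cons b bs)
      then show ?case by (cases n) (auto simp: sum.lessThan_Suc_shift algebra_simps simp del: sum.lessThan_Suc)
    qed simp
    also have "\<dots> \<le> \<epsilon> * real n * log 2 X"
    proof (intro mult_right_mono)
      have "int (count_list bs False) < \<lceil>\<epsilon> * real n\<rceil>" using bs(3) by (simp add: s_def)
      then show "real (count_list bs False) \<le> \<epsilon> * real n" by (simp add: less_ceiling_iff)
    qed (use lX in auto)
    finally show ?thesis by (simp add: algebra_simps)
  qed
  moreover have "V i \<subseteq> {..<Q} \<and> 0 < c i \<and> real (card (V i)) \<le> 2 powr c i" if "i < n" for i
  proof (cases "bs ! i")
    case True
    have "card (v ` {..<K}) \<le> K" using card_image_le[of "{..<K}" v] by simp
    then have "real (card (v ` {..<K})) \<le> X powr (2 * \<epsilon>)" using K_le by linarith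
    also have "X powr (2 * \<epsilon>) = 2 powr c i"
    proof -
      have "2 powr c i = (2 powr log 2 X) powr (2 * \<epsilon>)" using True by (simp add: c_def powr_powr mult.commute)
      then show ?thesis using X2 by simp
    qed
    finally show ?thesis using True v(1) lX \<epsilon> by (auto simp: V_def c_def)
  next
    case False
    then show ?thesis using lX X2 by (auto simp: V_def c_def X_def)
  qed
  moreover have "\<exists>y d. y \<in> SL \<and> (\<forall>i<n. d i \<in> V i \<and> y ! i = (as ! i + d i) mod Q)"
    if as: "length as = n" "set as \<subseteq> {..<Q}" for as
  proof -
    from rich_cover[OF bs(2) \<theta>_pos, of K v as] v(2) as bs(1) obtain y where
      y: "y \<in> SL" "length y = n" and
      yi: "\<And>i. i < n \<Longrightarrow> y ! i < Q \<and> (bs ! i \<longrightarrow> (\<exists>h<K. y ! i = (as ! i + v h) mod Q))"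
      by (auto simp: F_def)
    have "\<exists>di. di \<in> V i \<and> y ! i = (as ! i + di) mod Q" if i: "i < n" for i
    proof (cases "bs ! i")
      case True
      then show ?thesis using yi[OF i] by (auto simp: V_def)
    next
      case False
      have ai: "as ! i < Q" using as i by (auto simp: subset_iff)
      have "(as ! i + (y ! i + (Q - as ! i)) mod Q) mod Q = (as ! i + (y ! i + (Q - as ! i))) mod Q"
        by (simp add: mod_add_right_eq)
      also have "as ! i + (y ! i + (Q - as ! i)) = y ! i + Q" using ai by simp
      also have "(y ! i + Q) mod Q = y ! i" using yi[OF i] by simp
      finally show ?thesis using False Q1 by (intro exI[of _ "(y ! i + (Q - as ! i)) mod Q"]) (auto simp: V_def)
    qed
    then obtain d where "\<forall>i<n. d i \<in> V i \<and> y ! i = (as ! i + d i) mod Q" by metis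
    then show ?thesis using y(1) by blast
  qed
  ultimately show ?thesis
    unfolding SL_def X_def Q_def
    by (intro exI[of _ L] conjI exI[of _ V] exI[of _ c]) (auto simp: L_def)
qed

section \<open>Permutations hitting prescribed small sets\<close>

definition hits :: "'a set list \<Rightarrow> 'a list \<Rightarrow> nat" where
  "hits Ns p = card {j. j < length Ns \<and> p ! j \<in> Ns ! j}"

lemma hits_Nil [simp]: "hits [] p = 0"
  by (simp add: hits_def)

lemma hits_Cons [simp]: "hits (N # Ns) (x # p) = (if x \<in> N then 1 else 0) + hits Ns p"
proof -
  have "{j. j < length (N # Ns) \<and> (x # p) ! j \<in> (N # Ns) ! j} =
      (if x \<in> N then {0} else {}) \<union> Suc ` {j. j < length Ns \<and> p ! j \<in> Ns ! j}"
  proof (intro set_eqI)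
    fix j show "j \<in> {j. j < length (N # Ns) \<and> (x # p) ! j \<in> (N # Ns) ! j} \<longleftrightarrow>
      j \<in> (if x \<in> N then {0} else {}) \<union> Suc ` {j. j < length Ns \<and> p ! j \<in> Ns ! j}"
      by (cases j) auto
  qed
  moreover have "card (Suc ` {j. j < length Ns \<and> p ! j \<in> Ns ! j}) = hits Ns p"
    unfolding hits_def by (rule card_image) simp
  moreover have "finite (Suc ` {j. j < length Ns \<and> p ! j \<in> Ns ! j})" by simp
  ultimately show ?thesis unfolding hits_def[of "N # Ns"]
    by (simp only:) (cases "x \<in> N"; simp)
qed

text \<open>An exponential moment, computed by drawing the entries one after the other. When entry j
  is drawn, \<open>card A - j\<close> elements remain, of which at most r carry the weight z instead
  of 1, whatever was drawn before.\<close>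

lemma sum_permutations_weight_le:
  fixes z r :: real
  assumes "finite A" "length Ns \<le> card A" "z \<ge> 0"
    "\<And>N. N \<in> set Ns \<Longrightarrow> finite N \<and> real (card N) \<le> r"
  shows "(\<Sum>p\<in>permutations_of_set A. z ^ hits Ns p)
    \<le> fact (card A - length Ns) * (\<Prod>j<length Ns. real (card A - j) + z * r)"
  using assms
proof (induction Ns arbitrary: A)
  case Nil
  then show ?case by simp
next
  case (Cons N Ns)
  have ne: "A \<noteq> {}" using Cons.prems(2) by auto
  have N: "finite N" "real (card N) \<le> r" using Cons.prems(4) by auto
  define b where "b = fact (card A - 1 - length Ns) * (\<Prod>j<length Ns. real (card A - 1 - j) + z * r)"
  have r0: "r \<ge> 0" using N(2) by (meson of_nat_0_le_iff order_trans)
  have b0: "b \<ge> 0" unfolding b_def using Cons.prems(3) r0 by (intro mult_nonneg_nonneg prod_nonneg) auto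
  have "(\<Sum>p\<in>permutations_of_set A. z ^ hits (N # Ns) p) =
      (\<Sum>x\<in>A. \<Sum>p\<in>(#) x ` permutations_of_set (A - {x}). z ^ hits (N # Ns) p)"
    by (subst permutations_of_set_nonempty[OF ne], subst sum.UNION_disjoint) (use Cons.prems(1) in auto)
  also have "\<dots> = (\<Sum>x\<in>A. z ^ (if x \<in> N then 1 else 0) * (\<Sum>p\<in>permutations_of_set (A - {x}). z ^ hits Ns p))"
    by (intro sum.cong refl, subst sum.reindex) (auto simp: power_add sum_distrib_left)
  also have "\<dots> \<le> (\<Sum>x\<in>A. z ^ (if x \<in> N then 1 else 0) * b)"
  proof (intro sum_mono mult_left_mono)
    fix x assume x: "x \<in> A"
    have c: "card (A - {x}) = card A - 1" using x Cons.prems(1) by simp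
    show "(\<Sum>p\<in>permutations_of_set (A - {x}). z ^ hits Ns p) \<le> b"
      using Cons.IH[of "A - {x}"] Cons.prems c by (simp add: b_def)
  qed (use Cons.prems(3) in auto)
  also have "\<dots> = (\<Sum>x\<in>A. z ^ (if x \<in> N then 1 else 0)) * b" by (simp add: sum_distrib_right)
  also have "\<dots> \<le> (real (card A) + z * r) * b"
  proof (rule mult_right_mono[OF _ b0])
    have "(\<Sum>x\<in>A. z ^ (if x \<in> N then 1 else 0)) \<le> (\<Sum>x\<in>A. 1 + (if x \<in> N then z else 0))"
      using Cons.prems(3) by (intro sum_mono) auto
    also have "\<dots> = real (card A) + z * real (card (A \<inter> N))"
      using Cons.prems(1) by (simp add: sum.distrib sum.If_cases Int_def mult.commute)
    also have "\<dots> \<le> real (card A) + z * r"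
    proof -
      have "card (A \<inter> N) \<le> card N" using N(1) by (intro card_mono) auto
      then have "real (card (A \<inter> N)) \<le> r" using N(2) by linarith
      then show ?thesis using Cons.prems(3) by (intro add_left_mono mult_left_mono) auto
    qed
    finally show "(\<Sum>x\<in>A. z ^ (if x \<in> N then 1 else 0)) \<le> real (card A) + z * r" .
  qed
  also have "\<dots> = fact (card A - length (N # Ns)) * (\<Prod>j<length (N # Ns). real (card A - j) + z * r)"
    by (simp add: b_def prod.lessThan_Suc_shift del: prod.lessThan_Suc)
  finally show ?case .
qed

lemma fact_eq_fact_mult_prod:
  assumes "k \<le> n"
  shows "(fact n :: real) = fact (n - k) * (\<Prod>j<k. real (n - j))"
  using assms
proof (induction k)
  case (Suc k)
  have "(fact (n - k) :: real) = real (n - k) * fact (n - Suc k)"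
    using Suc.prems by (metis Suc_diff_Suc Suc_le_lessD fact_Suc)
  then show ?case using Suc by simp
qed simp

text \<open>Markov's inequality for z to the number of hits. Only the first k positions are tested,
  so n - k or more elements remain at each draw, and z * r at most doubles each factor n -
  j.\<close>

lemma card_permutations_hitting:
  fixes z r :: real
  assumes k: "k \<le> n" and z: "z \<ge> 1" "z * r \<le> real (n - k)"
    and near: "\<And>i. i < k \<Longrightarrow> finite (near i) \<and> real (card (near i)) \<le> r"
  shows "real (card {p \<in> permutations_of_set {..<n}. s \<le> card {i. i < k \<and> p ! i \<in> near i}}) * z ^ s
    \<le> fact n * 2 ^ k"
proof -
  define Ns where "Ns = map near [0..<k]"
  have h: "hits Ns p = card {i. i < k \<and> p ! i \<in> near i}" for p
    unfolding hits_def Ns_def by (rule arg_cong[of _ _ card]) auto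
  have "real (card {p \<in> permutations_of_set {..<n}. s \<le> hits Ns p}) * z ^ s =
      (\<Sum>p | p \<in> permutations_of_set {..<n} \<and> s \<le> hits Ns p. z ^ s)" by simp
  also have "\<dots> \<le> (\<Sum>p | p \<in> permutations_of_set {..<n} \<and> s \<le> hits Ns p. z ^ hits Ns p)"
    using z by (intro sum_mono power_increasing) auto
  also have "\<dots> \<le> (\<Sum>p\<in>permutations_of_set {..<n}. z ^ hits Ns p)"
    using z by (intro sum_mono2) auto
  also have "\<dots> \<le> fact (n - k) * (\<Prod>j<k. real (n - j) + z * r)"
  proof -
    have "finite N \<and> real (card N) \<le> r" if "N \<in> set Ns" for N
      using that near by (auto simp: Ns_def)
    from sum_permutations_weight_le[where A = "{..<n}" and z = z and Ns = Ns, OF _ _ _ this] k z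
    show ?thesis by (simp add: Ns_def)
  qed
  also have "\<dots> \<le> fact (n - k) * (\<Prod>j<k. 2 * real (n - j))"
  proof (intro mult_left_mono prod_mono conjI)
    fix j assume j: "j \<in> {..<k}"
    have r0: "r \<ge> 0" using near[of j] j by (meson lessThan_iff of_nat_0_le_iff order_trans)
    then show "0 \<le> real (n - j) + z * r" using z by auto
    have "real (n - k) \<le> real (n - j)" using j by (simp add: diff_le_mono2)
    then show "real (n - j) + z * r \<le> 2 * real (n - j)" using z by linarith
  qed auto
  also have "\<dots> = fact n * 2 ^ k"
    by (simp add: fact_eq_fact_mult_prod[OF k] prod.distrib)
  finally show ?thesis by (simp add: h)
qed

section \<open>Consequences of the conjecture\<close>

lemma shannon_entropy_le_log_card:
  assumes "finite \<Omega>" "\<Omega> \<noteq> {}"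
  shows "shannon_entropy (uniform_count_measure \<Omega>) X \<le> log 2 (real (card (X ` \<Omega>)))"
proof -
  interpret prob_space "uniform_count_measure \<Omega>"
    by (rule prob_space_uniform_count_measure[OF assms])
  interpret information_space "uniform_count_measure \<Omega>" 2 by standard simp
  have sf: "simple_function (uniform_count_measure \<Omega>) X"
    using assms by (auto simp: simple_function_def space_uniform_count_measure sets_uniform_count_measure)
  from entropy_le_card[OF simple_distributedI[OF sf _ refl]] show ?thesis
    by (simp add: shannon_entropy_def space_uniform_count_measure)
qed

lemma shannon_entropy_component:
  fixes n Q :: nat
  assumes i: "i < n" and Q: "Q > 0"
  shows "shannon_entropy (uniform_count_measure ({..<n} \<rightarrow>\<^sub>E {..<Q})) (\<lambda>a. a i) = log 2 (real Q)"
proof -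
  let ?\<Omega> = "{..<n} \<rightarrow>\<^sub>E {..<Q}"
  have fin: "finite ?\<Omega>" by (rule finite_PiE) auto
  have ne: "?\<Omega> \<noteq> {}" using Q by (auto simp: PiE_eq_empty_iff)
  interpret prob_space "uniform_count_measure ?\<Omega>"
    by (rule prob_space_uniform_count_measure[OF fin ne])
  interpret information_space "uniform_count_measure ?\<Omega>" 2 by standard simp
  have sf: "simple_function (uniform_count_measure ?\<Omega>) (\<lambda>a. a i)"
    using fin by (auto simp: simple_function_def space_uniform_count_measure sets_uniform_count_measure)
  have im: "(\<lambda>a. a i) ` ?\<Omega> = {..<Q}"
  proof
    show "{..<Q} \<subseteq> (\<lambda>a. a i) ` ?\<Omega>"
    proof
      fix x assume "x \<in> {..<Q}"
      then show "x \<in> (\<lambda>a. a i) ` ?\<Omega>"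
        using i by (intro image_eqI[of _ _ "\<lambda>j\<in>{..<n}. x"]) auto
    qed
  qed (use i in auto)
  have pr: "measure (uniform_count_measure ?\<Omega>) ((\<lambda>a. a i) -` {x} \<inter> ?\<Omega>) = 1 / real Q" if x: "x < Q" for x
  proof -
    have "(\<lambda>a. a i) -` {x} \<inter> ?\<Omega> = (\<Pi>\<^sub>E j\<in>{..<n}. if j = i then {x} else {..<Q})"
    proof (intro equalityI subsetI)
      fix a assume a: "a \<in> (\<Pi>\<^sub>E j\<in>{..<n}. if j = i then {x} else {..<Q})"
      have mem: "a j \<in> (if j = i then {x} else {..<Q})" if "j < n" for j using PiE_mem[OF a] that by auto
      have "a i = x" using mem[OF i] by simp
      moreover have "a j \<in> {..<Q}" if "j < n" for j using mem[OF that] x by (cases "j = i") auto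
      moreover have "a \<in> extensional {..<n}" using a by (simp add: PiE_iff)
      ultimately show "a \<in> (\<lambda>a. a i) -` {x} \<inter> ?\<Omega>" using i by (auto simp: PiE_iff)
    qed (auto simp: PiE_iff)
    moreover have "card (\<Pi>\<^sub>E j\<in>{..<n}. if j = i then {x} else {..<Q}) = Q ^ (n - 1)"
      using i by (subst card_PiE, simp, subst prod.remove[of _ i]) (auto simp: prod.If_cases)
    ultimately have "card ((\<lambda>a. a i) -` {x} \<inter> ?\<Omega>) = Q ^ (n - 1)" by simp
    moreover have "card ?\<Omega> = Q * Q ^ (n - 1)"
      using i by (simp add: card_PiE power_eq_if)
    ultimately show ?thesis using fin Q
      by (subst measure_uniform_count_measure) auto
  qed
  have "entropy 2 (count_space ((\<lambda>a. a i) ` space (uniform_count_measure ?\<Omega>))) (\<lambda>a. a i) =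
      - (\<Sum>x\<in>{..<Q}. 1 / real Q * log 2 (1 / real Q))"
    by (subst entropy_simple_distributed[OF simple_distributedI[OF sf _ refl]])
      (simp_all add: space_uniform_count_measure im pr)
  also have "\<dots> = log 2 (real Q)" using Q by (simp add: log_divide)
  finally show ?thesis by (simp add: shannon_entropy_def)
qed

text \<open>Local functions can be recovered from global messages: a vertex chooses any source
  messages consistent with what it sees and acts as it would for these. So it suffices that what a
  vertex sees determines what it sends or decodes.\<close>

lemma exists_nc_solution:
  assumes "\<And>i. i < npairs I \<Longrightarrow> finite (A i) \<and> A i \<noteq> {}"
    and edge: "\<And>a a' e. a \<in> PiE {..<npairs I} A \<Longrightarrow> a' \<in> PiE {..<npairs I} A \<Longrightarrow> e \<in> edges I \<Longrightarrow>
      in_messages I (fst e) a (m a) = in_messages I (fst e) a' (m a') \<Longrightarrow> m a e = m a' e"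
    and sink: "\<And>a a' i. a \<in> PiE {..<npairs I} A \<Longrightarrow> a' \<in> PiE {..<npairs I} A \<Longrightarrow> i < npairs I \<Longrightarrow>
      in_messages I (snk I i) a (m a) = in_messages I (snk I i) a' (m a') \<Longrightarrow> a i = a' i"
  shows "\<exists>enc dec. nc_solution I A enc dec m"
proof -
  define pre where "pre = (\<lambda>u z. SOME a. a \<in> PiE {..<npairs I} A \<and> in_messages I u a (m a) = z)"
  have pre: "pre u (in_messages I u a (m a)) \<in> PiE {..<npairs I} A \<and>
      in_messages I u (pre u (in_messages I u a (m a))) (m (pre u (in_messages I u a (m a)))) =
      in_messages I u a (m a)" if "a \<in> PiE {..<npairs I} A" for u a
    unfolding pre_def by (rule someI[of _ a]) (use that in simp)
  have "nc_solution I A (\<lambda>e z. m (pre (fst e) z) e) (\<lambda>i z. pre (snk I i) z i) m"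
    unfolding nc_solution_def
  proof (intro conjI ballI allI impI)
    fix a e assume "a \<in> PiE {..<npairs I} A" "e \<in> edges I"
    then show "m a e = m (pre (fst e) (in_messages I (fst e) a (m a))) e"
      using edge[of a "pre (fst e) (in_messages I (fst e) a (m a))" e] pre[of a "fst e"] by auto
  next
    fix a i assume "a \<in> PiE {..<npairs I} A" "i < npairs I"
    then show "pre (snk I i) (in_messages I (snk I i) a (m a)) i = a i"
      using sink[of "pre (snk I i) (in_messages I (snk I i) a (m a))" a i] pre[of a "snk I i"] by auto
  qed (use assms(1) in auto)
  then show ?thesis by blast
qed

text \<open>
  A potential \<open>\<phi>\<close> drops from source to sink by at most the amount it changes along the edges,
  weighted by the flow. This replaces the decomposition of a flow into paths.
\<close>

lemma multiflow_potential:
  fixes \<phi> :: "nat \<Rightarrow> real"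
  assumes I: "kpairs_instance I" and f: "multiflow I f" and i: "i < npairs I"
  shows "\<bar>\<phi> (src I i) - \<phi> (snk I i)\<bar>
    \<le> (\<Sum>(u, v)\<in>edges I. (f i u v + f i v u) * \<bar>\<phi> u - \<phi> v\<bar>)"
proof -
  let ?V = "verts I" and ?E = "edges I"
  have V: "finite ?V" and E: "?E \<subseteq> ?V \<times> ?V" "acyclic ?E"
    and st: "src I i \<in> ?V" "snk I i \<in> ?V" "src I i \<noteq> snk I i"
    using I i by (auto simp: kpairs_instance_def)
  have finE: "finite ?E" using E V finite_subset by blast
  \<comment> \<open>Acyclicity excludes loops and opposite edges, so each direction of an undirected
    edge is counted once in the sums over \<open>?E\<close> and its converse.\<close>
  have dis: "?E \<inter> ?E\<inverse> = {}"
  proof (intro equalityI subsetI)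
    fix e assume "e \<in> ?E \<inter> ?E\<inverse>"
    then obtain u v where "(u, v) \<in> ?E" "(v, u) \<in> ?E" by auto
    then have "(u, u) \<in> ?E\<^sup>+" by auto
    then show "e \<in> {}" using E(2) by (auto simp: acyclic_def)
  qed auto
  have nn: "f i u v \<ge> 0" and supp: "(u, v) \<notin> ?E \<union> ?E\<inverse> \<Longrightarrow> f i u v = 0" for u v
    using f i by (auto simp: multiflow_def)
  have supp': "(u, v) \<in> ?E \<or> (v, u) \<in> ?E" if "f i u v \<noteq> 0" for u v
    using supp[of u v] that by auto
  have cons: "(\<Sum>v\<in>?V. f i u v) - (\<Sum>v\<in>?V. f i v u) =
      (if u = src I i then 1 else if u = snk I i then -1 else 0)" if "u \<in> ?V" for u
    using f i that by (auto simp: multiflow_def)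
  have "\<phi> (src I i) - \<phi> (snk I i) =
      (\<Sum>u\<in>?V. \<phi> u * (if u = src I i then 1 else if u = snk I i then -1 else 0))"
  proof -
    have "(\<Sum>u\<in>?V. \<phi> u * (if u = src I i then 1 else if u = snk I i then -1 else 0)) =
        (\<Sum>u\<in>?V. (if u = src I i then \<phi> u else 0) - (if u = snk I i then \<phi> u else 0))"
      using st by (intro sum.cong) auto
    then show ?thesis using st V by (simp add: sum_subtractf)
  qed
  also have "\<dots> = (\<Sum>u\<in>?V. \<phi> u * ((\<Sum>v\<in>?V. f i u v) - (\<Sum>v\<in>?V. f i v u)))"
    by (intro sum.cong refl) (simp add: cons)
  also have "\<dots> = (\<Sum>u\<in>?V. \<Sum>v\<in>?V. \<phi> u * f i u v) - (\<Sum>u\<in>?V. \<Sum>v\<in>?V. \<phi> u * f i v u)"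
    by (simp add: right_diff_distrib sum_distrib_left sum_subtractf)
  also have "(\<Sum>u\<in>?V. \<Sum>v\<in>?V. \<phi> u * f i v u) = (\<Sum>u\<in>?V. \<Sum>v\<in>?V. \<phi> v * f i u v)"
    by (rule sum.swap)
  also have "(\<Sum>u\<in>?V. \<Sum>v\<in>?V. \<phi> u * f i u v) - (\<Sum>u\<in>?V. \<Sum>v\<in>?V. \<phi> v * f i u v) =
      (\<Sum>(u, v)\<in>?V \<times> ?V. (\<phi> u - \<phi> v) * f i u v)"
    by (simp add: left_diff_distrib sum_subtractf flip: sum.cartesian_product)
  also have "\<dots> = (\<Sum>(u, v)\<in>?E \<union> ?E\<inverse>. (\<phi> u - \<phi> v) * f i u v)"
    using V E(1) by (intro sum.mono_neutral_right) (auto dest: supp')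
  also have "\<dots> = (\<Sum>(u, v)\<in>?E. (\<phi> u - \<phi> v) * f i u v) + (\<Sum>(u, v)\<in>?E\<inverse>. (\<phi> u - \<phi> v) * f i u v)"
    using finE dis by (intro sum.union_disjoint) auto
  also have "(\<Sum>(u, v)\<in>?E\<inverse>. (\<phi> u - \<phi> v) * f i u v) = (\<Sum>(u, v)\<in>?E. (\<phi> v - \<phi> u) * f i v u)"
    by (rule sum.reindex_bij_witness[of _ prod.swap prod.swap]) auto
  finally have eq: "\<phi> (src I i) - \<phi> (snk I i) =
      (\<Sum>(u, v)\<in>?E. (\<phi> u - \<phi> v) * (f i u v - f i v u))"
    by (simp add: case_prod_unfold algebra_simps flip: sum.distrib)
  have "\<bar>\<phi> (src I i) - \<phi> (snk I i)\<bar> \<le> (\<Sum>e\<in>?E. \<bar>case e of (u, v) \<Rightarrow> (\<phi> u - \<phi> v) * (f i u v - f i v u)\<bar>)"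
    unfolding eq by (rule sum_abs)
  also have "\<dots> \<le> (\<Sum>(u, v)\<in>?E. (f i u v + f i v u) * \<bar>\<phi> u - \<phi> v\<bar>)"
  proof (rule sum_mono, clarify)
    fix u v
    have "\<bar>f i u v - f i v u\<bar> \<le> f i u v + f i v u" using nn[of u v] nn[of v u] by linarith
    then show "\<bar>(\<phi> u - \<phi> v) * (f i u v - f i v u)\<bar> \<le> (f i u v + f i v u) * \<bar>\<phi> u - \<phi> v\<bar>"
      by (simp add: abs_mult mult.commute mult_left_mono)
  qed
  finally show ?thesis .
qed

text \<open>Duality between flows and lengths: each commodity uses a volume of at least the rate
  times its distance, bounded below by a potential that is Lipschitz for \<open>len\<close>, and the
  total volume is at most capacity times length. The gap between r' and r is there because the
  conjecture compares suprema.\<close>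

lemma nc_achieves_length_bound:
  assumes conj: "undirected_k_pairs_conjecture" and I: "kpairs_instance I"
    and nc: "nc_achieves I r" and r': "0 \<le> r'" "r' < r"
    and len: "\<And>i u v. i < npairs I \<Longrightarrow> (u, v) \<in> edges I \<Longrightarrow> \<bar>\<phi> i u - \<phi> i v\<bar> \<le> len (u, v)"
    and len0: "\<And>e. e \<in> edges I \<Longrightarrow> 0 \<le> len e"
  shows "r' * (\<Sum>i<npairs I. \<bar>\<phi> i (src I i) - \<phi> i (snk I i)\<bar>) \<le> (\<Sum>e\<in>edges I. cap I e * len e)"
proof -
  have "ennreal r' < ennreal r" using r' by (simp add: ennreal_lessI)
  also have "\<dots> \<le> nc_rate I" unfolding nc_rate_def using nc by (intro SUP_upper) simp
  also have "\<dots> \<le> flow_rate I" using conj I by (auto simp: undirected_k_pairs_conjecture_def)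
  finally obtain s where s: "flow_achieves I s" "ennreal r' < ennreal s"
    unfolding flow_rate_def less_SUP_iff by auto
  have s': "r' \<le> s" "0 \<le> s" using s(2) r' by (auto simp: ennreal_less_iff)
  from s(1) obtain f where f: "multiflow I f" and
    cap: "\<And>u v. (u, v) \<in> edges I \<Longrightarrow> s * (\<Sum>i<npairs I. f i u v + f i v u) \<le> cap I (u, v)"
    by (auto simp: flow_achieves_def)
  have nn: "f i u v \<ge> 0" if "i < npairs I" for i u v
    using f that by (auto simp: multiflow_def)
  have "r' * (\<Sum>i<npairs I. \<bar>\<phi> i (src I i) - \<phi> i (snk I i)\<bar>)
      \<le> s * (\<Sum>i<npairs I. \<bar>\<phi> i (src I i) - \<phi> i (snk I i)\<bar>)"
    using s' by (intro mult_right_mono sum_nonneg) auto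
  also have "\<dots> \<le> s * (\<Sum>i<npairs I. \<Sum>(u, v)\<in>edges I. (f i u v + f i v u) * \<bar>\<phi> i u - \<phi> i v\<bar>)"
    using s' by (intro mult_left_mono sum_mono multiflow_potential[OF I f]) auto
  also have "\<dots> \<le> s * (\<Sum>i<npairs I. \<Sum>(u, v)\<in>edges I. (f i u v + f i v u) * len (u, v))"
  proof (rule mult_left_mono[OF _ s'(2)], intro sum_mono)
    fix i e assume "i \<in> {..<npairs I}" "e \<in> edges I"
    then show "(case e of (u, v) \<Rightarrow> (f i u v + f i v u) * \<bar>\<phi> i u - \<phi> i v\<bar>) \<le>
        (case e of (u, v) \<Rightarrow> (f i u v + f i v u) * len (u, v))"
      using nn[of i] len[of i] by (cases e) (auto intro!: mult_left_mono)
  qed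
  also have "\<dots> = (\<Sum>(u, v)\<in>edges I. s * (\<Sum>i<npairs I. f i u v + f i v u) * len (u, v))"
    by (subst sum.swap) (simp add: sum_distrib_left sum_distrib_right case_prod_unfold mult.assoc)
  also have "\<dots> \<le> (\<Sum>(u, v)\<in>edges I. cap I (u, v) * len (u, v))"
  proof (rule sum_mono, clarify)
    fix u v assume e: "(u, v) \<in> edges I"
    show "s * (\<Sum>i<npairs I. f i u v + f i v u) * len (u, v) \<le> cap I (u, v) * len (u, v)"
      using cap[OF e] len0[OF e] by (rule mult_right_mono)
  qed
  finally show ?thesis by (simp add: case_prod_unfold)
qed

section \<open>Simulation with canonical block addresses\<close>

text \<open>Listing the entries by the inverse of \<open>p\<close> gives a sorted list with the same
  multiset. Ties are harmless, since values and not items are compared.\<close>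

lemma sort_nth_permutation:
  fixes xs :: "'a :: linorder list"
  assumes p: "p \<in> permutations_of_set {..<n}" and len: "length xs = n"
    and mono: "\<And>i j. i < n \<Longrightarrow> j < n \<Longrightarrow> p ! i < p ! j \<Longrightarrow> xs ! i \<le> xs ! j"
    and i: "i < n"
  shows "sort xs ! (p ! i) = xs ! i"
proof -
  have p': "set p = {..<n}" "distinct p" "length p = n"
    using p length_finite_permutations_of_set[OF p] by (auto simp: permutations_of_set_def)
  have bij: "bij_betw ((!) p) {..<n} {..<n}"
    using p' by (auto simp: bij_betw_def inj_on_def nth_eq_iff_index_eq set_conv_nth image_def lessThan_def)
  define q where "q = the_inv_into {..<n} ((!) p)"
  have bq: "bij_betw q {..<n} {..<n}" unfolding q_def by (rule bij_betw_the_inv_into[OF bij])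
  have qp: "q (p ! i) = i" if "i < n" for i
    unfolding q_def using that bij by (intro the_inv_into_f_f) (auto simp: bij_betw_def)
  have pq: "p ! (q k) = k" if "k < n" for k
    unfolding q_def using that bij by (intro f_the_inv_into_f) (auto simp: bij_betw_def)
  have qn: "q k < n" if "k < n" for k using bq that by (auto simp: bij_betw_def)
  define z where "z = map (\<lambda>k. xs ! q k) [0..<n]"
  have "mset z = image_mset ((!) xs) (image_mset q (mset_set {..<n}))"
    by (simp add: z_def image_mset.compositionality o_def lessThan_atLeast0)
  also have "image_mset q (mset_set {..<n}) = mset_set {..<n}"
    using bq by (subst image_mset_mset_set) (auto simp: bij_betw_def)
  also have "image_mset ((!) xs) (mset_set {..<n}) = mset (map ((!) xs) [0..<n])"
    by (simp add: lessThan_atLeast0)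
  also have "map ((!) xs) [0..<n] = xs" using len map_nth by auto
  finally have ms: "mset z = mset xs" .
  have "sorted z"
    unfolding sorted_iff_nth_mono_less
  proof (intro allI impI)
    fix i j assume ij: "i < j" "j < length z"
    then have "i < n" "j < n" by (auto simp: z_def)
    then show "z ! i \<le> z ! j"
      using mono[of "q i" "q j"] qn pq ij by (simp add: z_def)
  qed
  from properties_for_sort[OF ms this] have "sort xs = z" .
  moreover have "p ! i < n" using p' i nth_mem[of i p] by auto
  ultimately show ?thesis by (simp add: z_def qp[OF i])
qed

fun address :: "action \<Rightarrow> nat" where
  "address (Read a p) = a"
| "address (Write a p) = a"
| "address (Halt a) = a"

fun with_address :: "nat \<Rightarrow> action \<Rightarrow> action" where
  "with_address b (Read a p) = Read b p"
| "with_address b (Write a p) = Write b p"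
| "with_address b (Halt a) = Halt b"

text \<open>
  The run of \<open>D\<close> in which the addresses chosen by \<open>D\<close> are overridden by those in the list \<open>cs\<close>.
\<close>

primrec sim :: "nat \<Rightarrow> nat \<Rightarrow> det_alg \<Rightarrow> nat list \<Rightarrow> nat list \<Rightarrow> nat \<Rightarrow> memory \<times> disk" where
  "sim M B D cs xs 0 = (replicate M 0, init_disk B xs)"
| "sim M B D cs xs (Suc t) =
     (let (x, d) = sim M B D cs xs t; (x', act) = D t x in perform B (x', with_address (cs ! t) act) d)"

lemma init_disk_beyond: "length xs \<le> j * B \<Longrightarrow> init_disk B xs j = replicate B 0"
  by (rule nth_equalityI) (auto simp: init_disk_def)

text \<open>The algorithm sees only its memory, never the addresses, so an injective renaming of the
  blocks that respects the initial disk commutes with every step.\<close>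

lemma sim_eq_state_after:
  assumes \<kappa>: "inj \<kappa>" and init: "\<And>x. init_disk B xs (\<kappa> x) = init_disk B xs x"
    and cs: "length cs = t" "\<And>s. s < t \<Longrightarrow> cs ! s = \<kappa> (address (action_at M B D xs s))"
    and s: "s \<le> t"
  shows "fst (sim M B D cs xs s) = fst (state_after M B D xs s) \<and>
    (\<forall>x. snd (sim M B D cs xs s) (\<kappa> x) = snd (state_after M B D xs s) x)"
  using s
proof (induction s)
  case 0
  then show ?case by (simp add: init)
next
  case (Suc s)
  obtain x d where xd: "state_after M B D xs s = (x, d)" by (cases "state_after M B D xs s")
  obtain x1 d' where xd': "sim M B D cs xs s = (x1, d')" by (cases "sim M B D cs xs s")
  have x1: "x1 = x" and d: "\<And>y. d' (\<kappa> y) = d y" using Suc xd xd' by auto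
  obtain x' act where act: "D s x = (x', act)" by (cases "D s x")
  have aa: "cs ! s = \<kappa> (address act)"
    using Suc.prems cs(2)[of s] by (simp add: action_at_def xd act)
  show ?case
    using inj_eq[OF \<kappa>] by (cases act) (auto simp: xd xd' act x1 d aa)
qed

text \<open>The output range may overlap the input blocks, which keep their own numbers; output
  block k is called \<open>N + k\<close> only if it lies outside of them.\<close>

definition out_addr :: "nat \<Rightarrow> nat \<Rightarrow> nat \<Rightarrow> nat" where
  "out_addr N b k = (if b + k < N then b + k else N + k)"

definition sim_sorts :: "nat \<Rightarrow> nat \<Rightarrow> det_alg \<Rightarrow> nat \<Rightarrow> nat \<Rightarrow> nat list \<Rightarrow> nat list \<Rightarrow> bool" where
  "sim_sorts M B D N b cs xs \<longleftrightarrow> (\<forall>i<length xs.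
     snd (sim M B D cs xs (length cs)) (out_addr N b (i div B)) ! (i mod B) = sort xs ! i)"

text \<open>
  Input blocks keep their addresses, the blocks of the output range are numbered from \<open>N\<close> on, and
  every other block that is accessed gets a number from \<open>2 * N\<close> on by its first access time. Hence
  the output range is described by \<open>b \<le> N\<close> alone, although addresses are unbounded.
\<close>

lemma exists_sim_sorts:
  assumes B: "B \<ge> 1" and N: "length xs < N * B"
    and halt: "t \<le> \<tau>"
    and out: "\<And>i. i < length xs \<Longrightarrow>
      snd (state_after M B D xs t) (a + i div B) ! (i mod B) = sort xs ! i"
  shows "\<exists>b cs. b \<le> N \<and> length cs \<le> \<tau> \<and> set cs \<subseteq> {..<2 * N + \<tau>} \<and> sim_sorts M B D N b cs xs"
proof -
  define ad where "ad = (\<lambda>s. address (action_at M B D xs s))"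
  define E where "E = (\<lambda>x. \<exists>s<t. ad s = x)"
  define first where "first = (\<lambda>x. LEAST s. s < t \<and> ad s = x)"
  \<comment> \<open>The last case is for blocks that are neither in the input or output range nor
    accessed; their numbers only have to keep \<kappa> injective.\<close>
  define \<kappa> where "\<kappa> = (\<lambda>x. if x < N then x else if a \<le> x \<and> x < a + N then N + (x - a)
    else if E x then 2 * N + first x else 2 * N + t + x)"
  define cs where "cs = map (\<lambda>s. \<kappa> (ad s)) [0..<t]"
  define b where "b = min a N"
  have least: "first x < t" "ad (first x) = x" if "E x" for x
    using LeastI_ex[of "\<lambda>s. s < t \<and> ad s = x"] that by (auto simp: E_def first_def)
  have inj: "inj \<kappa>"
  proof (rule injI)
    fix x y assume eq: "\<kappa> x = \<kappa> y"
    show "x = y"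
    proof (cases "E x \<and> E y \<and> first x = first y")
      case True
      then show ?thesis using least(2) by metis
    next
      case False
      then show ?thesis using eq least(1)[of x] least(1)[of y] unfolding \<kappa>_def
        by (auto split: if_splits)
    qed
  qed
  have ge: "\<kappa> x \<ge> N" if "x \<ge> N" for x using that by (auto simp: \<kappa>_def)
  have lt: "\<kappa> x = x" if "x < N" for x using that by (auto simp: \<kappa>_def)
  have init: "init_disk B xs (\<kappa> x) = init_disk B xs x" for x
  proof (cases "x < N")
    case False
    have "length xs \<le> y * B" if "y \<ge> N" for y
      using N mult_le_mono1[OF that, of B] by linarith
    then show ?thesis using False ge[of x] by (simp add: init_disk_beyond)
  qed (simp add: lt)
  have sim: "snd (sim M B D cs xs t) (\<kappa> x) = snd (state_after M B D xs t) x" for x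
    using sim_eq_state_after[OF inj init, of cs t M D t] by (simp add: cs_def ad_def)
  have outk: "out_addr N b k = \<kappa> (a + k)" if "k < N" for k
    using that by (auto simp: out_addr_def b_def \<kappa>_def)
  have "set cs \<subseteq> {..<2 * N + \<tau>}"
  proof
    fix c assume "c \<in> set cs"
    then obtain s where s: "s < t" "c = \<kappa> (ad s)" by (auto simp: cs_def)
    have "E (ad s)" using s by (auto simp: E_def)
    then show "c \<in> {..<2 * N + \<tau>}"
      using least(1)[of "ad s"] halt s by (auto simp: \<kappa>_def)
  qed
  moreover have "sim_sorts M B D N b cs xs"
    unfolding sim_sorts_def
  proof (intro allI impI)
    fix i assume i: "i < length xs"
    then have "i div B < N" using N B by (auto simp: less_mult_imp_div_less)
    then show "snd (sim M B D cs xs (length cs)) (out_addr N b (i div B)) ! (i mod B) = sort xs ! i"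
      using out[OF i] by (simp add: outk sim) (simp add: cs_def sim[unfolded cs_def])
  qed
  ultimately show ?thesis
    using halt by (intro exI[of _ b] exI[of _ cs]) (auto simp: b_def cs_def)
qed

section \<open>Runs of legal algorithms: word bounds and dependence on accessed blocks only\<close>

definition det_em_algorithm :: "nat \<Rightarrow> nat \<Rightarrow> nat \<Rightarrow> det_alg \<Rightarrow> bool" where
  "det_em_algorithm w M B D \<longleftrightarrow>
     (\<forall>t. \<forall>x\<in>memories w M. fst (D t x) \<in> memories w M \<and> legal_action M B (snd (D t x)))"

lemma finite_memories [simp]: "finite (memories w M)"
  and card_memories: "card (memories w M) = (2 ^ w) ^ M"
proof -
  have "memories w M = {x. set x \<subseteq> {..<2 ^ w} \<and> length x = M}"
    by (auto simp: memories_def)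
  then show "finite (memories w M)" "card (memories w M) = (2 ^ w) ^ M"
    using finite_lists_length_eq[of "{..<2 ^ w :: nat}" M] card_lists_length_eq[of "{..<2 ^ w :: nat}" M]
    by auto
qed

lemma init_disk_memories:
  assumes "xs \<in> inputs n w"
  shows "init_disk B xs a \<in> memories w B"
proof -
  have "xs ! i < 2 ^ w" if "i < length xs" for i
    using assms nth_mem[OF that] by (auto simp: inputs_def)
  then show ?thesis by (auto simp: init_disk_def memories_def)
qed

lemma perform_memories:
  assumes "x \<in> memories w M" "\<And>a. d a \<in> memories w B" "legal_action M B act"
  shows "fst (perform B (x, act) d) \<in> memories w M" "snd (perform B (x, act) d) a \<in> memories w B"
proof -
  have "take p x @ d a @ drop (p + B) x \<in> memories w M" if "act = Read a p" for a p
    using assms(1) assms(2)[of a] assms(3) that set_take_subset[of p x] set_drop_subset[of "p + B" x]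
    by (auto simp: memories_def)
  then show "fst (perform B (x, act) d) \<in> memories w M" using assms(1) by (cases act) auto
  have "take B (drop p x) \<in> memories w B" if "act = Write a p" for a p
    using assms(1,3) that set_take_subset[of B "drop p x"] set_drop_subset[of p x]
    by (auto simp: memories_def)
  then show "snd (perform B (x, act) d) a \<in> memories w B" using assms(2) by (cases act) auto
qed

lemma legal_with_address [simp]: "legal_action M B (with_address b act) = legal_action M B act"
  by (cases act) auto

lemma sim_memories:
  assumes D: "det_em_algorithm w M B D" and xs: "xs \<in> inputs n w"
  shows "fst (sim M B D cs xs t) \<in> memories w M \<and> snd (sim M B D cs xs t) a \<in> memories w B"
proof -
  have "fst (sim M B D cs xs t) \<in> memories w M \<and> (\<forall>a. snd (sim M B D cs xs t) a \<in> memories w B)"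
  proof (induction t)
    case 0
    then show ?case using init_disk_memories[OF xs] by (auto simp: memories_def)
  next
    case (Suc t)
    obtain x d where xd: "sim M B D cs xs t = (x, d)" by (cases "sim M B D cs xs t")
    obtain x' act where act: "D t x = (x', act)" by (cases "D t x")
    have x: "x \<in> memories w M" "\<And>a. d a \<in> memories w B" using Suc xd by auto
    have "x' \<in> memories w M" "legal_action M B (with_address (cs ! t) act)"
      using D x(1) act unfolding det_em_algorithm_def by (metis fst_conv, metis snd_conv legal_with_address)
    then show ?case using perform_memories[of x' w M d B "with_address (cs ! t) act"] x
      by (simp add: xd act)
  qed
  then show ?thesis by simp
qed

lemma sim_Suc_unaccessed:
  assumes "cs ! t \<noteq> a"
  shows "snd (sim M B D cs xs (Suc t)) a = snd (sim M B D cs xs t) a"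
proof -
  obtain x d where xd: "sim M B D cs xs t = (x, d)" by (cases "sim M B D cs xs t")
  obtain x' act where act: "D t x = (x', act)" by (cases "D t x")
  show ?thesis using assms by (cases act) (auto simp: xd act)
qed

lemma sim_unaccessed:
  assumes "t1 \<le> t2" "\<And>t. t1 \<le> t \<Longrightarrow> t < t2 \<Longrightarrow> cs ! t \<noteq> a"
  shows "snd (sim M B D cs xs t2) a = snd (sim M B D cs xs t1) a"
  using assms
proof (induction t2 rule: dec_induct)
  case (step t)
  then show ?case using sim_Suc_unaccessed[of cs t a] by simp
qed simp

lemma sim_cong:
  assumes "t1 \<le> t2" "\<And>t. t1 \<le> t \<Longrightarrow> t < t2 \<Longrightarrow> cs ! t \<in> A"
    and "fst (sim M B D cs xs t1) = fst (sim M B D cs ys t1)"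
    and "\<And>a. a \<in> A \<Longrightarrow> snd (sim M B D cs xs t1) a = snd (sim M B D cs ys t1) a"
  shows "fst (sim M B D cs xs t2) = fst (sim M B D cs ys t2) \<and>
    (\<forall>a\<in>A. snd (sim M B D cs xs t2) a = snd (sim M B D cs ys t2) a)"
  using assms(1,2)
proof (induction t2 rule: dec_induct)
  case base
  then show ?case using assms by auto
next
  case (step t)
  obtain x d where xd: "sim M B D cs xs t = (x, d)" by (cases "sim M B D cs xs t")
  obtain x1 d' where xd': "sim M B D cs ys t = (x1, d')" by (cases "sim M B D cs ys t")
  have *: "x1 = x" "\<And>a. a \<in> A \<Longrightarrow> d' a = d a" using step.IH step.prems xd xd' by auto
  obtain x' act where act: "D t x = (x', act)" by (cases "D t x")
  have "cs ! t \<in> A" using step by auto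
  then show ?case using * by (cases act) (auto simp: xd xd' act)
qed

section \<open>The block transfer graph of a sequence of accesses\<close>

text \<open>
  The node \<open>j < N\<close> stands for the input block \<open>j\<close>, and the node \<open>N + c\<close> for the \<open>c\<close>-th group of \<open>m\<close>
  consecutive steps. An edge leads from a node to the next one that accesses the same block, and
  from each group to the next one, along which the memory contents pass.
\<close>

locale accesses =
  fixes N m :: nat and cs :: "nat list"
  assumes m_pos: "m > 0"
begin

definition accs :: "nat \<Rightarrow> nat set" where
  "accs v = (if v < N then {v} else {cs ! t |t. t < length cs \<and> t div m = v - N})"

definition num_nodes :: nat where
  "num_nodes = N + (length cs + m - 1) div m"

definition passes :: "nat \<Rightarrow> nat \<Rightarrow> nat \<Rightarrow> bool" where
  "passes a x v \<longleftrightarrow> x < v \<and> a \<in> accs x \<and> (\<forall>y. x < y \<and> y < v \<longrightarrow> a \<notin> accs y)"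

definition passed :: "nat \<Rightarrow> nat \<Rightarrow> nat set" where
  "passed x v = {a \<in> accs v. passes a x v}"

definition core_edges :: "(nat \<times> nat) set" where
  "core_edges = {(x, v). N \<le> v \<and> v < num_nodes \<and> x < v \<and> (passed x v \<noteq> {} \<or> N \<le> x \<and> v = Suc x)}"

text \<open>Truncated subtraction makes this 0 for the input nodes; the minimum makes
  \<open>start num_nodes\<close> the end of the run although the last group may be
  incomplete.\<close>

definition start :: "nat \<Rightarrow> nat" where
  "start v = min ((v - N) * m) (length cs)"

lemma start_le: "start v \<le> length cs"
  by (simp add: start_def)

lemma start_mono: "x \<le> v \<Longrightarrow> start x \<le> start v"
  unfolding start_def by (intro min.mono mult_le_mono1 diff_le_mono) auto

lemma start_input: "v \<le> N \<Longrightarrow> start v = 0"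
  by (simp add: start_def)

lemma start_num_nodes: "start num_nodes = length cs"
proof -
  have "length cs \<le> (length cs + m - 1) div m * m"
    using m_pos dividend_less_div_times[of m "length cs + m - 1"] by linarith
  then show ?thesis by (simp add: start_def num_nodes_def)
qed

lemma step_accessed:
  assumes "start x \<le> t" "t < start v" "N \<le> x"
  shows "\<exists>y. x \<le> y \<and> y < v \<and> cs ! t \<in> accs y"
proof -
  have t: "t < length cs" using assms(2) start_le[of v] by linarith
  have "(x - N) * m \<le> t" using assms(1) t by (auto simp: start_def)
  then have 1: "x - N \<le> t div m" using m_pos by (simp add: less_eq_div_iff_mult_less_eq)
  have "t < (v - N) * m" using assms(2) by (simp add: start_def)
  then have 2: "t div m < v - N" by (simp add: less_mult_imp_div_less)
  have "cs ! t \<in> accs (N + t div m)" using t by (auto simp: accs_def)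
  then show ?thesis using 1 2 assms(3) by (intro exI[of _ "N + t div m"]) auto
qed

lemma step_accs:
  assumes "start v \<le> t" "t < start (Suc v)" "N \<le> v"
  shows "cs ! t \<in> accs v"
  using step_accessed[OF assms(1,2,3)] le_less_Suc_eq by blast

lemma card_steps_le: "card {t. t < length cs \<and> t div m = c} \<le> m"
proof -
  have "{t. t < length cs \<and> t div m = c} \<subseteq> {c * m..<c * m + m}"
  proof
    fix t assume "t \<in> {t. t < length cs \<and> t div m = c}"
    then show "t \<in> {c * m..<c * m + m}"
      using m_pos div_times_less_eq_dividend[of t m] dividend_less_div_times[of m t] by auto
  qed
  from card_mono[OF _ this] show ?thesis by simp
qed

lemma accs_eq_image: "N \<le> v \<Longrightarrow> accs v = (\<lambda>t. cs ! t) ` {t. t < length cs \<and> t div m = v - N}"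
  by (auto simp: accs_def)

lemma finite_accs [simp]: "finite (accs v)"
  by (cases "v < N") (auto simp: accs_def)

lemma card_accs_le: "card (accs v) \<le> m"
proof (cases "v < N")
  case True
  then show ?thesis using m_pos by (simp add: accs_def)
next
  case False
  then show ?thesis
    using card_image_le[of "{t. t < length cs \<and> t div m = v - N}" "\<lambda>t. cs ! t"] card_steps_le[of "v - N"]
    by (simp add: accs_eq_image)
qed

lemma sum_card_accs_le: "(\<Sum>v\<in>{N..<num_nodes}. card (accs v)) \<le> length cs"
proof -
  let ?T = "\<lambda>v. {t. t < length cs \<and> t div m = v - N}"
  have "(\<Sum>v\<in>{N..<num_nodes}. card (accs v)) \<le> (\<Sum>v\<in>{N..<num_nodes}. card (?T v))"
    by (intro sum_mono) (auto simp: accs_eq_image intro: card_image_le)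
  also have "\<dots> = card (\<Union>v\<in>{N..<num_nodes}. ?T v)"
    by (rule card_UN_disjoint[symmetric]) auto
  also have "\<dots> \<le> card {..<length cs}" by (rule card_mono) auto
  finally show ?thesis by simp
qed

section \<open>Degrees, balls and truncated distances in the block transfer graph\<close>

lemma passes_unique_left: "passes a x v \<Longrightarrow> passes a x' v \<Longrightarrow> x = x'"
  unfolding passes_def by (metis linorder_neqE_nat)

lemma passes_unique_right: "passes a x v \<Longrightarrow> passes a x v' \<Longrightarrow> a \<in> accs v \<Longrightarrow> a \<in> accs v' \<Longrightarrow> v = v'"
  unfolding passes_def by (metis linorder_neqE_nat)

lemma exists_passes:
  assumes "y < v" "a \<in> accs y"
  shows "\<exists>x. passes a x v"
proof -
  define x where "x = Max {x. x < v \<and> a \<in> accs x}"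
  have fin: "finite {x. x < v \<and> a \<in> accs x}" by simp
  have "x \<in> {x. x < v \<and> a \<in> accs x}" unfolding x_def using assms by (intro Max_in) auto
  moreover have "z \<le> x" if "z < v" "a \<in> accs z" for z
    unfolding x_def using fin that by (intro Max_ge) auto
  ultimately show ?thesis by (intro exI[of _ x]) (fastforce simp: passes_def)
qed

lemma passed_subset: "passed x v \<subseteq> accs x" "passed x v \<subseteq> accs v"
  by (auto simp: passed_def passes_def)

lemma finite_passed [simp]: "finite (passed x v)"
  by (auto simp: passed_def)

text \<open>A node accesses at most m blocks, each with a unique next access; the passing of the
  memory adds one edge.\<close>

lemma card_successors: "finite {v. (x, v) \<in> core_edges} \<and> card {v. (x, v) \<in> core_edges} \<le> m + 1"
proof -
  define nxt where "nxt = (\<lambda>a. THE v. a \<in> accs v \<and> passes a x v)"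
  have nxt: "nxt a = v" if "a \<in> accs v" "passes a x v" for a v
    unfolding nxt_def using that passes_unique_right by (intro the_equality) auto
  have sub: "{v. (x, v) \<in> core_edges} \<subseteq> insert (Suc x) (nxt ` accs x)"
    using nxt passed_subset by (fastforce simp: core_edges_def passed_def)
  have "card (insert (Suc x) (nxt ` accs x)) \<le> Suc (card (nxt ` accs x))" by (simp add: card_insert_if)
  also have "\<dots> \<le> m + 1" using card_image_le[of "accs x" nxt] card_accs_le[of x] by simp
  finally show ?thesis using finite_subset[OF sub] card_mono[OF _ sub] by auto
qed

lemma card_predecessors: "finite {x. (x, v) \<in> core_edges} \<and> card {x. (x, v) \<in> core_edges} \<le> m + 1"
proof -
  define prv where "prv = (\<lambda>a. THE x. passes a x v)"
  have prv: "prv a = x" if "passes a x v" for a x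
    unfolding prv_def using that passes_unique_left by (intro the_equality) auto
  have sub: "{x. (x, v) \<in> core_edges} \<subseteq> insert (v - 1) (prv ` accs v)"
    using prv by (fastforce simp: core_edges_def passed_def)
  have "card (insert (v - 1) (prv ` accs v)) \<le> Suc (card (prv ` accs v))" by (simp add: card_insert_if)
  also have "\<dots> \<le> m + 1" using card_image_le[of "accs v" prv] card_accs_le[of v] by simp
  finally show ?thesis using finite_subset[OF sub] card_mono[OF _ sub] by auto
qed

primrec ball_from :: "nat \<Rightarrow> nat \<Rightarrow> nat set" where
  "ball_from j 0 = {j}"
| "ball_from j (Suc d) = ball_from j d \<union>
     (\<Union>x\<in>ball_from j d. {v. (x, v) \<in> core_edges} \<union> {v. (v, x) \<in> core_edges})"

lemma ball_from_mono: "d \<le> d' \<Longrightarrow> ball_from j d \<subseteq> ball_from j d'"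
  by (induction rule: dec_induct) auto

lemma self_in_ball_from: "j \<in> ball_from j d"
  using ball_from_mono[of 0 d j] by auto

lemma card_ball_from: "finite (ball_from j d) \<and> card (ball_from j d) \<le> (2 * m + 3) ^ d"
proof (induction d)
  case (Suc d)
  let ?nb = "\<lambda>x. {v. (x, v) \<in> core_edges} \<union> {v. (v, x) \<in> core_edges}"
  have nb: "finite (?nb x) \<and> card (?nb x) \<le> 2 * m + 2" for x
  proof -
    have "card (?nb x) \<le> card {v. (x, v) \<in> core_edges} + card {v. (v, x) \<in> core_edges}"
      by (rule card_Un_le)
    then show ?thesis using card_successors[of x] card_predecessors[of x] by auto
  qed
  have "card (ball_from j (Suc d)) \<le> card (ball_from j d) + card (\<Union>x\<in>ball_from j d. ?nb x)"
    by (simp add: card_Un_le)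
  also have "card (\<Union>x\<in>ball_from j d. ?nb x) \<le> (\<Sum>x\<in>ball_from j d. card (?nb x))"
    using Suc by (intro card_UN_le) auto
  also have "\<dots> \<le> (\<Sum>x\<in>ball_from j d. 2 * m + 2)" using nb by (intro sum_mono) auto
  also have "card (ball_from j d) + \<dots> = (2 * m + 3) * card (ball_from j d)" by (simp add: algebra_simps)
  also have "\<dots> \<le> (2 * m + 3) ^ Suc d" using Suc by simp
  finally show ?case using Suc nb by auto
qed simp

text \<open>These are positions of the sorted array, not items: those in output blocks last accessed
  by a node of the ball. A position whose block no node accesses is never near.\<close>

definition near :: "nat \<Rightarrow> nat \<Rightarrow> nat \<Rightarrow> nat \<Rightarrow> nat \<Rightarrow> nat set" where
  "near n B b j d = {i. i < n \<and> (\<exists>x\<in>ball_from j d. passes (out_addr N b (i div B)) x num_nodes)}"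

text \<open>A node accesses at most m blocks, each holding at most B of the output positions. For d
  > 0 the factor m is absorbed by doubling the exponent; for d = 0 the ball is an input node, which
  has a single block.\<close>

lemma card_near:
  assumes B: "B > 0" and j: "j < N"
  shows "finite (near n B b j d) \<and> card (near n B b j d) \<le> B * (2 * m + 3) ^ (2 * d)"
proof -
  let ?P = "\<lambda>a. {i. i < n \<and> out_addr N b (i div B) = a}"
  have inj: "k = k'" if "out_addr N b k = out_addr N b k'" for k k'
    using that by (auto simp: out_addr_def split: if_splits)
  have P: "finite (?P a) \<and> card (?P a) \<le> B" for a
  proof (cases "?P a = {}")
    case False
    then obtain i0 where i0: "out_addr N b (i0 div B) = a" by auto
    have "?P a \<subseteq> {i0 div B * B..<i0 div B * B + B}"
    proof
      fix i assume "i \<in> ?P a"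
      then have "i div B = i0 div B" using i0 inj by auto
      then show "i \<in> {i0 div B * B..<i0 div B * B + B}"
        using B div_times_less_eq_dividend[of i B] dividend_less_div_times[of B i] by auto
    qed
    from card_mono[OF _ this] show ?thesis by simp
  next
    case True
    show ?thesis unfolding True by simp
  qed
  have fin: "finite (ball_from j d)" using card_ball_from by auto
  have sub: "near n B b j d \<subseteq> (\<Union>x\<in>ball_from j d. \<Union>a\<in>accs x. ?P a)"
    by (auto simp: near_def passes_def)
  have "card (near n B b j d) \<le> card (\<Union>x\<in>ball_from j d. \<Union>a\<in>accs x. ?P a)"
    using fin P by (intro card_mono[OF _ sub]) auto
  also have "\<dots> \<le> (\<Sum>x\<in>ball_from j d. card (\<Union>a\<in>accs x. ?P a))" by (rule card_UN_le[OF fin])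
  also have "\<dots> \<le> (\<Sum>x\<in>ball_from j d. card (accs x) * B)"
  proof (rule sum_mono)
    fix x
    have "card (\<Union>a\<in>accs x. ?P a) \<le> (\<Sum>a\<in>accs x. card (?P a))" by (rule card_UN_le) simp
    also have "\<dots> \<le> (\<Sum>a\<in>accs x. B)" using P by (intro sum_mono) auto
    finally show "card (\<Union>a\<in>accs x. ?P a) \<le> card (accs x) * B" by simp
  qed
  also have "\<dots> \<le> B * (2 * m + 3) ^ (2 * d)"
  proof (cases d)
    case 0
    then show ?thesis using j by (simp add: accs_def)
  next
    case (Suc d')
    have "(\<Sum>x\<in>ball_from j d. card (accs x) * B) \<le> (\<Sum>x\<in>ball_from j d. m * B)"
      using card_accs_le by (intro sum_mono mult_right_mono) auto
    also have "\<dots> = card (ball_from j d) * (m * B)" by simp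
    also have "\<dots> \<le> (2 * m + 3) ^ d * ((2 * m + 3) ^ d * B)"
    proof (intro mult_mono)
      have "m \<le> (2 * m + 3) ^ 1" by simp
      also have "\<dots> \<le> (2 * m + 3) ^ d" using Suc by (intro power_increasing) auto
      finally show "m \<le> (2 * m + 3) ^ d" .
    qed (use card_ball_from in auto)
    also have "\<dots> = B * (2 * m + 3) ^ (d + d)" by (simp only: power_add mult_ac)
    also have "d + d = 2 * d" by simp
    finally show ?thesis .
  qed
  finally show ?thesis using finite_subset[OF sub] fin P by auto
qed

text \<open>The undirected distance from \<open>j\<close>, truncated at \<open>k\<close>: the number
  of radii below \<open>k\<close> whose ball misses \<open>x\<close>.\<close>

definition pot :: "nat \<Rightarrow> nat \<Rightarrow> nat \<Rightarrow> real" where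
  "pot k j x = real (card {d. d < k \<and> x \<notin> ball_from j d})"

lemma pot_nonneg: "0 \<le> pot k j x"
  by (simp add: pot_def)

lemma pot_le: "pot k j x \<le> real k"
  using card_mono[of "{..<k}" "{d. d < k \<and> x \<notin> ball_from j d}"] by (auto simp: pot_def)

lemma pot_self: "pot k j j = 0"
  by (simp add: pot_def self_in_ball_from)

lemma pot_far:
  assumes "x \<notin> ball_from j (k - 1)"
  shows "pot k j x = real k"
proof -
  have "{d. d < k \<and> x \<notin> ball_from j d} = {..<k}"
  proof (intro equalityI subsetI)
    fix d assume d: "d \<in> {..<k}"
    then have "d \<le> k - 1" by auto
    then show "d \<in> {d. d < k \<and> x \<notin> ball_from j d}"
      using assms ball_from_mono[of d "k - 1" j] d by auto
  qed auto
  then show ?thesis by (simp add: pot_def)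
qed

lemma pot_lipschitz:
  assumes "(x, v) \<in> core_edges"
  shows "\<bar>pot k j x - pot k j v\<bar> \<le> 1"
proof -
  have *: "pot k j y \<le> pot k j z + 1"
    if yz: "\<And>d. z \<in> ball_from j d \<Longrightarrow> y \<in> ball_from j (Suc d)" for y z
  proof -
    let ?Z = "{d. d < k \<and> z \<notin> ball_from j d}"
    have "{d. d < k \<and> y \<notin> ball_from j d} \<subseteq> insert 0 (Suc ` ?Z)"
    proof
      fix d assume d: "d \<in> {d. d < k \<and> y \<notin> ball_from j d}"
      show "d \<in> insert 0 (Suc ` ?Z)"
      proof (cases d)
        case (Suc d')
        then have "d' \<in> ?Z" using d yz[of d'] by auto
        then show ?thesis using Suc by auto
      qed simp
    qed
    then have "card {d. d < k \<and> y \<notin> ball_from j d} \<le> card (insert 0 (Suc ` ?Z))"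
      by (intro card_mono) auto
    also have "\<dots> \<le> Suc (card (Suc ` ?Z))" by (simp add: card_insert_if)
    also have "\<dots> = Suc (card ?Z)" by (simp add: card_image)
    finally show ?thesis by (simp add: pot_def)
  qed
  have "pot k j x \<le> pot k j v + 1" "pot k j v \<le> pot k j x + 1"
    by (rule *, use assms in auto)+
  then show ?thesis by linarith
qed

end

section \<open>The coding network of a sorting algorithm\<close>

lemma sum_Un_le:
  fixes f :: "'a \<Rightarrow> real"
  assumes "finite A" "finite B" "\<And>x. x \<in> A \<union> B \<Longrightarrow> 0 \<le> f x"
  shows "sum f (A \<union> B) \<le> sum f A + sum f B"
proof -
  have "0 \<le> sum f (A \<inter> B)" using assms by (intro sum_nonneg) auto
  then show ?thesis using sum.union_inter[OF assms(1,2), of f] by linarith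
qed

text \<open>For source messages \<open>a\<close>, the letter \<open>Y a i\<close> below
  \<open>q ^ L\<close> stands for item i in all L copies: its l-th digit is the low part of the i-th
  key in copy l. The correction \<open>d a i\<close> is worth \<open>c i\<close> bits. By
  \<open>sorts\<close>, the one pattern \<open>(b, cs)\<close> is valid for all source
  messages.\<close>

locale coded_sort = accesses N m cs for N m :: nat and cs :: "nat list" +
  fixes n w M B b L q :: nat and D :: det_alg and p :: "nat list"
    and V :: "nat \<Rightarrow> nat set" and c :: "nat \<Rightarrow> real" and Y d :: "(nat \<Rightarrow> nat) \<Rightarrow> nat \<Rightarrow> nat"
  assumes B_pos: "B \<ge> 1" and m_def: "m = M div B" and n_le: "n < N * B"
    and w_pos: "w > 0" and q2: "q \<ge> 2" and L_pos: "L > 0"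
    and D_ok: "det_em_algorithm w M B D"
    and perm: "p \<in> permutations_of_set {..<n}"
    and V: "\<And>i. i < n \<Longrightarrow> V i \<subseteq> {..<q ^ L} \<and> 0 < c i \<and> real (card (V i)) \<le> 2 powr c i"
    and code: "\<And>a i. a \<in> {..<n} \<rightarrow>\<^sub>E {..<q ^ L} \<Longrightarrow> i < n \<Longrightarrow> d a i \<in> V i \<and> Y a i = (a i + d a i) mod q ^ L"
    and input: "\<And>a l. a \<in> {..<n} \<rightarrow>\<^sub>E {..<q ^ L} \<Longrightarrow> l < L \<Longrightarrow>
      map (\<lambda>i. p ! i * q + digit q l (Y a i)) [0..<n] \<in> inputs n w"
    and sorts: "\<And>a l. a \<in> {..<n} \<rightarrow>\<^sub>E {..<q ^ L} \<Longrightarrow> l < L \<Longrightarrow>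
      sim_sorts M B D N b cs (map (\<lambda>i. p ! i * q + digit q l (Y a i)) [0..<n])"
begin

definition Q :: nat where "Q = q ^ L"

abbreviation "H \<equiv> num_nodes"
abbreviation "\<Omega> \<equiv> {..<n} \<rightarrow>\<^sub>E {..<Q}"

definition inp :: "(nat \<Rightarrow> nat) \<Rightarrow> nat \<Rightarrow> nat list" where
  "inp a l = map (\<lambda>i. p ! i * q + digit q l (Y a i)) [0..<n]"

abbreviation "run a l \<equiv> sim M B D cs (inp a l)"

definition oaddr :: "nat \<Rightarrow> nat" where
  "oaddr i = out_addr N b (p ! i div B)"

definition core_cap :: "nat \<Rightarrow> nat \<Rightarrow> nat" where
  "core_cap x v = L * w * (B * card (passed x v) + (if N \<le> x \<and> v = Suc x then M else 0))"

text \<open>The contents are taken at the start of \<open>v\<close>; no node strictly between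
  accesses the passed blocks, so these are the contents that \<open>x\<close> left behind.\<close>

definition core_msg :: "(nat \<Rightarrow> nat) \<Rightarrow> nat \<Rightarrow> nat \<Rightarrow> (nat list \<times> nat list list) list" where
  "core_msg a x v = map (\<lambda>l.
     (if N \<le> x \<and> v = Suc x then fst (run a l (start v)) else [],
      map (snd (run a l (start v))) (sorted_list_of_set (passed x v)))) [0..<L]"

text \<open>
  Vertices: the sources \<open>i < n\<close>, the hub \<open>n\<close>, which learns all messages and distributes the
  corrections \<open>d\<close>, the core node \<open>x\<close> as \<open>n + 1 + x\<close>, and the sinks \<open>n + 1 + H + i\<close>.
\<close>

definition core_vertex :: "nat \<Rightarrow> nat" where
  "core_vertex x = n + 1 + x"

definition sink_vertex :: "nat \<Rightarrow> nat" where
  "sink_vertex i = n + 1 + H + i"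

definition hub_in :: "(nat \<times> nat) set" where
  "hub_in = (\<lambda>i. (i, n)) ` {..<n}"

definition feed :: "(nat \<times> nat) set" where
  "feed = (\<lambda>i. (i, core_vertex (i div B))) ` {..<n}"

definition hub_blocks :: "(nat \<times> nat) set" where
  "hub_blocks = (\<lambda>j. (n, core_vertex j)) ` (\<lambda>i. i div B) ` {..<n}"

definition hub_sinks :: "(nat \<times> nat) set" where
  "hub_sinks = (\<lambda>i. (n, sink_vertex i)) ` {..<n}"

definition core :: "(nat \<times> nat) set" where
  "core = (\<lambda>(x, v). (core_vertex x, core_vertex v)) ` core_edges"

definition outs :: "(nat \<times> nat) set" where
  "outs = {(core_vertex x, sink_vertex i) |x i. i < n \<and> passes (oaddr i) x H}"

definition net_edges :: "(nat \<times> nat) set" where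
  "net_edges = hub_in \<union> feed \<union> hub_blocks \<union> hub_sinks \<union> core \<union> outs"

text \<open>The items of one input block share the edge from the hub to that block, hence the sum of
  their correction budgets.\<close>

definition net_cap :: "nat \<times> nat \<Rightarrow> real" where
  "net_cap = (\<lambda>(x, y).
     if x < n then log 2 (real Q)
     else if x = n then
       (if y < n + 1 + H then \<Sum>i | i \<in> {..<n} \<and> i div B = y - (n + 1). c i else c (y - (n + 1 + H)))
     else if y < n + 1 + H then real (core_cap (x - (n + 1)) (y - (n + 1)))
     else log 2 (real Q))"

definition net_msg :: "(nat \<Rightarrow> nat) \<Rightarrow> nat \<times> nat \<Rightarrow> nat" where
  "net_msg a = (\<lambda>(x, y).
     if x < n then a x
     else if x = n then
       (if y < n + 1 + H then to_nat (map (\<lambda>i. if i div B = y - (n + 1) then d a i else 0) [0..<n])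
        else d a (y - (n + 1 + H)))
     else if y < n + 1 + H then to_nat (core_msg a (x - (n + 1)) (y - (n + 1)))
     else Y a (y - (n + 1 + H)))"

definition net :: kpairs where
  "net = \<lparr>verts = {..<2 * n + 1 + H}, edges = net_edges, cap = net_cap, npairs = n,
     src = (\<lambda>i. i), snk = sink_vertex\<rparr>"

lemma net_simps [simp]:
  "verts net = {..<2 * n + 1 + H}" "edges net = net_edges" "cap net = net_cap" "npairs net = n"
  "src net i = i" "snk net i = sink_vertex i"
  by (simp_all add: net_def)

lemma Q2: "Q \<ge> 2"
proof -
  have "q ^ 1 \<le> q ^ L" using q2 L_pos by (intro power_increasing) auto
  then show ?thesis using q2 by (simp add: Q_def)
qed

lemma Q_pos: "Q > 0"
  using Q2 by simp

lemma log_Q_pos: "0 < log 2 (real Q)"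
  using Q2 by simp

lemma V_code:
  "i < n \<Longrightarrow> V i \<subseteq> {..<Q}" "i < n \<Longrightarrow> 0 < c i" "i < n \<Longrightarrow> real (card (V i)) \<le> 2 powr c i"
  "a \<in> \<Omega> \<Longrightarrow> i < n \<Longrightarrow> d a i \<in> V i" "a \<in> \<Omega> \<Longrightarrow> i < n \<Longrightarrow> Y a i = (a i + d a i) mod Q"
  using V[of i] code[of a i] by (simp_all add: Q_def)

lemma N_le_H: "N \<le> H"
  by (simp add: num_nodes_def)

lemma block_less: "i < n \<Longrightarrow> i div B < N"
  using n_le by (auto simp: less_mult_imp_div_less)

lemma perm_less: "i < n \<Longrightarrow> p ! i < n"
  using perm length_finite_permutations_of_set[OF perm] nth_mem[of i p]
  by (auto simp: permutations_of_set_def)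

lemma core_edges_less: "(x, v) \<in> core_edges \<Longrightarrow> x < v \<and> v < H"
  by (simp add: core_edges_def)

lemma passes_less: "passes a x v \<Longrightarrow> x < v"
  by (simp add: passes_def)

lemma finite_core_edges: "finite core_edges"
  by (rule finite_subset[of _ "{..<H} \<times> {..<H}"]) (auto simp: core_edges_def)

lemma vertex_simps [simp]:
  "core_vertex x = core_vertex y \<longleftrightarrow> x = y" "sink_vertex i = sink_vertex j \<longleftrightarrow> i = j"
  "core_vertex x \<noteq> n" "n \<noteq> core_vertex x" "sink_vertex i \<noteq> n" "n \<noteq> sink_vertex i"
  "n < core_vertex x" "n < sink_vertex i" "core_vertex x < core_vertex y \<longleftrightarrow> x < y"
  by (auto simp: core_vertex_def sink_vertex_def)

lemma core_vertex_less_sink: "x < H \<Longrightarrow> core_vertex x < sink_vertex i"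
  by (simp add: core_vertex_def sink_vertex_def)

lemma net_edges_cases [consumes 1, case_names hub_in feed hub_block hub_sink core out]:
  assumes "e \<in> net_edges"
  obtains i where "e = (i, n)" "i < n"
  | i where "e = (i, core_vertex (i div B))" "i < n" "i div B < H"
  | i where "e = (n, core_vertex (i div B))" "i < n" "i div B < H"
  | i where "e = (n, sink_vertex i)" "i < n"
  | x v where "e = (core_vertex x, core_vertex v)" "(x, v) \<in> core_edges" "x < v" "v < H"
  | x i where "e = (core_vertex x, sink_vertex i)" "i < n" "passes (oaddr i) x H" "x < H"
proof -
  have blk: "i div B < H" if "i < n" for i using block_less[OF that] N_le_H by simp
  from assms show thesis
    unfolding net_edges_def
  proof (elim UnE)
    assume "e \<in> hub_in" then show thesis using that(1) by (auto simp: hub_in_def)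
  next
    assume "e \<in> feed" then show thesis using that(2) blk by (auto simp: feed_def)
  next
    assume "e \<in> hub_blocks" then show thesis using that(3) blk by (auto simp: hub_blocks_def)
  next
    assume "e \<in> hub_sinks" then show thesis using that(4) by (auto simp: hub_sinks_def)
  next
    assume "e \<in> core" then show thesis using that(5) core_edges_less by (auto simp: core_def)
  next
    assume "e \<in> outs" then show thesis using that(6) passes_less by (auto simp: outs_def)
  qed
qed

lemma net_edgesI:
  "i < n \<Longrightarrow> (i, n) \<in> net_edges"
  "i < n \<Longrightarrow> (i, core_vertex (i div B)) \<in> net_edges"
  "i < n \<Longrightarrow> (n, core_vertex (i div B)) \<in> net_edges"
  "i < n \<Longrightarrow> (n, sink_vertex i) \<in> net_edges"
  "(x, v) \<in> core_edges \<Longrightarrow> (core_vertex x, core_vertex v) \<in> net_edges"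
  "i < n \<Longrightarrow> passes (oaddr i) x H \<Longrightarrow> (core_vertex x, sink_vertex i) \<in> net_edges"
proof -
  show "i < n \<Longrightarrow> (i, n) \<in> net_edges" by (simp add: net_edges_def hub_in_def)
  show "i < n \<Longrightarrow> (i, core_vertex (i div B)) \<in> net_edges" by (simp add: net_edges_def feed_def)
  show "i < n \<Longrightarrow> (n, core_vertex (i div B)) \<in> net_edges" by (simp add: net_edges_def hub_blocks_def)
  show "i < n \<Longrightarrow> (n, sink_vertex i) \<in> net_edges" by (simp add: net_edges_def hub_sinks_def)
  show "(x, v) \<in> core_edges \<Longrightarrow> (core_vertex x, core_vertex v) \<in> net_edges"
    using image_eqI[of "(core_vertex x, core_vertex v)" "\<lambda>(x, v). (core_vertex x, core_vertex v)" "(x, v)" core_edges]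
    by (simp add: net_edges_def core_def)
  show "i < n \<Longrightarrow> passes (oaddr i) x H \<Longrightarrow> (core_vertex x, sink_vertex i) \<in> net_edges"
    by (auto simp: net_edges_def outs_def)
qed

lemma net_cap_simps:
  "i < n \<Longrightarrow> net_cap (i, y) = log 2 (real Q)"
  "j < H \<Longrightarrow> net_cap (n, core_vertex j) = (\<Sum>i | i \<in> {..<n} \<and> i div B = j. c i)"
  "net_cap (n, sink_vertex i) = c i"
  "v < H \<Longrightarrow> net_cap (core_vertex x, core_vertex v) = real (core_cap x v)"
  "net_cap (core_vertex x, sink_vertex i) = log 2 (real Q)"
  by (simp_all add: net_cap_def core_vertex_def sink_vertex_def)

lemma net_msg_simps:
  "i < n \<Longrightarrow> net_msg a (i, y) = a i"
  "j < H \<Longrightarrow> net_msg a (n, core_vertex j) = to_nat (map (\<lambda>i. if i div B = j then d a i else 0) [0..<n])"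
  "net_msg a (n, sink_vertex i) = d a i"
  "v < H \<Longrightarrow> net_msg a (core_vertex x, core_vertex v) = to_nat (core_msg a x v)"
  "net_msg a (core_vertex x, sink_vertex i) = Y a i"
  by (simp_all add: net_msg_def core_vertex_def sink_vertex_def)

lemma outs_eq: "outs = (\<Union>i<n. (\<lambda>x. (core_vertex x, sink_vertex i)) ` {x. passes (oaddr i) x H})"
  unfolding outs_def by auto

lemma finite_outs: "finite outs"
proof -
  have "finite {x. passes a x H}" for a
    by (rule finite_subset[of _ "{..<H}"]) (auto simp: passes_def)
  then show ?thesis by (simp add: outs_eq)
qed

lemma M_pos: "M > 0"
  using m_pos m_def by (cases M) auto

text \<open>The vertex numbering is a topological order. Each core edge carries a block or the
  memory, so its capacity is positive.\<close>

lemma net_instance: "kpairs_instance net"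
  unfolding kpairs_instance_def net_simps
proof (intro conjI allI impI ballI)
  have less: "x < y" if "(x, y) \<in> net_edges" for x y
    using that by (cases rule: net_edges_cases) (auto intro: less_trans[of _ n] core_vertex_less_sink)
  have "x < y" if "(x, y) \<in> net_edges\<^sup>+" for x y
    using that by (induction rule: trancl_induct) (use less in \<open>auto intro: less_trans\<close>)
  then show "acyclic net_edges" by (auto simp: acyclic_def)
  have "y < 2 * n + 1 + H" if "(x, y) \<in> net_edges" for x y
    using that by (cases rule: net_edges_cases) (auto simp: core_vertex_def sink_vertex_def)
  then show "net_edges \<subseteq> {..<2 * n + 1 + H} \<times> {..<2 * n + 1 + H}"
    using less by (fastforce intro: less_trans)
next
  fix e assume "e \<in> net_edges"
  then show "0 < net_cap e"
  proof (cases rule: net_edges_cases)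
    case (hub_block i)
    have "0 < (\<Sum>j | j \<in> {..<n} \<and> j div B = i div B. c j)"
      using hub_block V_code by (intro sum_pos) auto
    then show ?thesis using hub_block by (simp add: net_cap_simps)
  next
    case (core x v)
    then have "0 < core_cap x v"
      using L_pos w_pos B_pos M_pos by (auto simp: core_cap_def core_edges_def card_gt_0_iff)
    then show ?thesis using core by (simp add: net_cap_simps)
  qed (use log_Q_pos V_code in \<open>auto simp: net_cap_simps\<close>)
qed (auto simp: sink_vertex_def)

subsection \<open>The messages form a coding solution\<close>

lemma Y_less: "a \<in> \<Omega> \<Longrightarrow> i < n \<Longrightarrow> Y a i < Q"
  using V_code(5)[of a i] Q_pos by simp

lemma inp_nth: "i < n \<Longrightarrow> inp a l ! i = p ! i * q + digit q l (Y a i)"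
  by (simp add: inp_def)

lemma length_inp [simp]: "length (inp a l) = n"
  by (simp add: inp_def)

lemma inp_inputs: "a \<in> \<Omega> \<Longrightarrow> l < L \<Longrightarrow> inp a l \<in> inputs n w"
  unfolding inp_def Q_def by (rule input)

lemma Y_eqI:
  assumes "a \<in> \<Omega>" "a' \<in> \<Omega>" "i < n" "\<And>l. l < L \<Longrightarrow> inp a l ! i = inp a' l ! i"
  shows "Y a i = Y a' i"
proof (rule digits_eq_imp_eq)
  show "Y a i < q ^ L" "Y a' i < q ^ L" using Y_less assms by (simp_all flip: Q_def)
  show "digit q l (Y a i) = digit q l (Y a' i)" if "l < L" for l
    using assms(4)[OF that] assms(3) by (simp add: inp_nth)
qed

text \<open>Since a digit is below q, the keys are ordered as the entries of \<open>p\<close>; thus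
  item i has rank \<open>p ! i\<close> in every copy and for all messages.\<close>

lemma output_content:
  assumes "a \<in> \<Omega>" "l < L" "i < n"
  shows "snd (run a l (length cs)) (oaddr i) ! (p ! i mod B) = inp a l ! i"
proof -
  have "sort (inp a l) ! (p ! i) = inp a l ! i"
  proof (rule sort_nth_permutation[OF perm length_inp _ assms(3)])
    fix i j assume ij: "i < n" "j < n" "p ! i < p ! j"
    have "p ! i * q + digit q l (Y a i) < Suc (p ! i) * q"
      using digit_less[of q l "Y a i"] q2 by simp
    also have "\<dots> \<le> p ! j * q" using ij by (intro mult_right_mono) auto
    finally show "inp a l ! i \<le> inp a l ! j" using ij by (simp add: inp_nth)
  qed
  then show ?thesis
    using sorts[OF assms(1)[unfolded Q_def] assms(2)] perm_less[OF assms(3)]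
    unfolding sim_sorts_def inp_def[symmetric] length_inp oaddr_def by auto
qed

lemma start_max: "start (max x N) = start x"
  by (simp add: start_def max_def)

lemma content_kept:
  assumes "passes z x v"
  shows "snd (sim M B D cs xs (start v)) z = snd (sim M B D cs xs (start (Suc x))) z"
proof (rule sim_unaccessed)
  show "start (Suc x) \<le> start v" using assms by (intro start_mono) (simp add: passes_def)
  fix t assume t: "start (Suc x) \<le> t" "t < start v"
  then obtain y where "max (Suc x) N \<le> y" "y < v" "cs ! t \<in> accs y"
    using step_accessed[of "max (Suc x) N" t v] by (auto simp: start_max)
  then show "cs ! t \<noteq> z" using assms by (auto simp: passes_def)
qed

text \<open>Each input block is accessed by its own node below N, so a block not accessed before
  \<open>v\<close> lies outside the input and still holds the zeros of the initial disk,
  independently of the messages.\<close>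

lemma content_fresh:
  assumes "\<And>y. y < v \<Longrightarrow> z \<notin> accs y" "N \<le> v" "length xs = n"
  shows "snd (sim M B D cs xs (start v)) z = replicate B 0"
proof -
  have "N \<le> z"
  proof (rule ccontr)
    assume "\<not> N \<le> z"
    then show False using assms(1)[of z] assms(2) by (auto simp: accs_def)
  qed
  then have "length xs \<le> z * B" using n_le mult_le_mono1[of N z B] assms(3) by linarith
  moreover have "snd (sim M B D cs xs (start v)) z = snd (sim M B D cs xs 0) z"
  proof (rule sim_unaccessed)
    fix t assume t: "t < start v"
    then obtain y where "y < v" "cs ! t \<in> accs y"
      using step_accessed[of N t v] by (auto simp: start_input)
    then show "cs ! t \<noteq> z" using assms(1) by auto
  qed simp
  ultimately show ?thesis by (simp add: init_disk_beyond)
qed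

lemma core_msg_eqD:
  assumes "core_msg a x v = core_msg a' x v" "l < L"
  shows "N \<le> x \<Longrightarrow> v = Suc x \<Longrightarrow> fst (run a l (start v)) = fst (run a' l (start v))"
    and "z \<in> passed x v \<Longrightarrow> snd (run a l (start v)) z = snd (run a' l (start v)) z"
proof -
  from assms(1) have "core_msg a x v ! l = core_msg a' x v ! l" by simp
  then show "N \<le> x \<Longrightarrow> v = Suc x \<Longrightarrow> fst (run a l (start v)) = fst (run a' l (start v))"
    and "z \<in> passed x v \<Longrightarrow> snd (run a l (start v)) z = snd (run a' l (start v)) z"
    using assms(2) by (auto simp: core_msg_def)
qed

lemma in_messagesD:
  assumes "in_messages net u a (net_msg a) = in_messages net u a' (net_msg a')"
  shows "(y, u) \<in> net_edges \<Longrightarrow> net_msg a (y, u) = net_msg a' (y, u)"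
    and "u < n \<Longrightarrow> a u = a' u"
proof -
  have 1: "restrict a {i. i < n \<and> i = u} = restrict a' {i. i < n \<and> i = u}"
    and 2: "restrict (net_msg a) {e \<in> net_edges. snd e = u} = restrict (net_msg a') {e \<in> net_edges. snd e = u}"
    using assms by (auto simp: in_messages_def)
  show "(y, u) \<in> net_edges \<Longrightarrow> net_msg a (y, u) = net_msg a' (y, u)"
    using fun_cong[OF 2, of "(y, u)"] by simp
  show "u < n \<Longrightarrow> a u = a' u"
    using fun_cong[OF 1, of u] by simp
qed

text \<open>An input node forms the letters of its items from messages and corrections. A group
  receives the memory and the contents of the blocks it accesses, except for blocks accessed for the
  first time, which hold zeros; this determines its steps by \<open>sim_cong\<close>.\<close>

lemma node_determined:
  assumes a: "a \<in> \<Omega>" "a' \<in> \<Omega>" and x: "x < H" and l: "l < L"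
    and eq: "in_messages net (core_vertex x) a (net_msg a) = in_messages net (core_vertex x) a' (net_msg a')"
  shows "(\<forall>z\<in>accs x. snd (run a l (start (Suc x))) z = snd (run a' l (start (Suc x))) z) \<and>
    (N \<le> x \<longrightarrow> fst (run a l (start (Suc x))) = fst (run a' l (start (Suc x))))"
proof (cases "x < N")
  case True
  have inp_eq: "inp a l ! i = inp a' l ! i" if i: "i < n" "i div B = x" for i
  proof -
    have "(i, core_vertex x) \<in> net_edges" using net_edgesI(2)[OF i(1)] i(2) by simp
    from in_messagesD(1)[OF eq this] have ai: "a i = a' i" using i by (simp add: net_msg_simps)
    have "(n, core_vertex x) \<in> net_edges" using net_edgesI(3)[OF i(1)] i(2) by simp
    from in_messagesD(1)[OF eq this]
    have "map (\<lambda>i. if i div B = x then d a i else 0) [0..<n] = map (\<lambda>i. if i div B = x then d a' i else 0) [0..<n]"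
      using x by (simp add: net_msg_simps)
    from map_eq_conv[THEN iffD1, OF this, rule_format, of i] have "d a i = d a' i" using i by simp
    then show ?thesis using V_code(5)[OF a(1) i(1)] V_code(5)[OF a(2) i(1)] ai i by (simp add: inp_nth)
  qed
  have "init_disk B (inp a l) x = init_disk B (inp a' l) x"
    unfolding init_disk_def length_inp using inp_eq by (intro map_cong refl) auto
  then show ?thesis using True by (auto simp: accs_def start_input)
next
  case False
  have edge: "core_msg a y x = core_msg a' y x" if "(y, x) \<in> core_edges" for y
  proof -
    have "(core_vertex y, core_vertex x) \<in> net_edges" using that by (rule net_edgesI)
    from in_messagesD(1)[OF eq this] show ?thesis using x by (simp add: net_msg_simps)
  qed
  have "fst (run a l (start x)) = fst (run a' l (start x))"
  proof (cases "x = N")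
    case True
    then show ?thesis by (simp add: start_input)
  next
    case neq: False
    then have "(x - 1, x) \<in> core_edges" using False x by (auto simp: core_edges_def)
    from core_msg_eqD(1)[OF edge[OF this] l] show ?thesis using False neq by auto
  qed
  moreover have "snd (run a l (start x)) z = snd (run a' l (start x)) z" if z: "z \<in> accs x" for z
  proof (cases "\<exists>y<x. z \<in> accs y")
    case True
    then obtain y where y: "passes z y x" using exists_passes by blast
    then have "z \<in> passed y x" "(y, x) \<in> core_edges"
      using z x False by (auto simp: passed_def core_edges_def dest: passes_less)
    then show ?thesis using core_msg_eqD(2)[OF edge l] by auto
  next
    case fresh: False
    then show ?thesis using False by (subst (1 2) content_fresh) auto
  qed
  moreover have "cs ! t \<in> accs x" if "start x \<le> t" "t < start (Suc x)" for t
    using step_accs[OF that] False by simp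
  ultimately show ?thesis
    using sim_cong[of "start x" "start (Suc x)" cs "accs x" M B D "inp a l" "inp a' l"] start_mono[of x "Suc x"]
    by auto
qed

lemma sink_determined:
  assumes a: "a \<in> \<Omega>" "a' \<in> \<Omega>" and i: "i < n"
    and content: "\<And>l. l < L \<Longrightarrow> snd (run a l (length cs)) (oaddr i) = snd (run a' l (length cs)) (oaddr i)"
  shows "Y a i = Y a' i"
proof (rule Y_eqI[OF a i])
  fix l assume l: "l < L"
  show "inp a l ! i = inp a' l ! i"
    using output_content[OF a(1) l i] output_content[OF a(2) l i] content[OF l] by simp
qed

text \<open>The hub sees all messages and may therefore send any function of them. A sink sees
  \<open>Y a i\<close> and \<open>d a i\<close>, which determine \<open>a i\<close> modulo
  Q.\<close>

lemma exists_solution: "\<exists>enc dec. nc_solution net (\<lambda>_. {..<Q}) enc dec net_msg"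
proof (rule exists_nc_solution)
  fix i assume "i < npairs net"
  show "finite {..<Q} \<and> {..<Q} \<noteq> {}" using Q_pos by (auto simp: lessThan_empty_iff)
next
  fix a a' e
  assume "a \<in> {..<npairs net} \<rightarrow>\<^sub>E {..<Q}" "a' \<in> {..<npairs net} \<rightarrow>\<^sub>E {..<Q}" and e: "e \<in> edges net"
    and eq: "in_messages net (fst e) a (net_msg a) = in_messages net (fst e) a' (net_msg a')"
  then have a: "a \<in> \<Omega>" "a' \<in> \<Omega>" by simp_all
  have hub: "a = a'" if "fst e = n"
  proof (rule PiE_ext[OF a])
    fix i assume "i \<in> {..<n}"
    then have "(i, n) \<in> net_edges" "i < n" by (auto intro: net_edgesI)
    then show "a i = a' i" using in_messagesD(1)[OF eq[unfolded that], of i] by (simp add: net_msg_simps)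
  qed
  from e have "e \<in> net_edges" by simp
  then show "net_msg a e = net_msg a' e"
  proof (cases rule: net_edges_cases)
    case (core x v)
    then have x: "x < H" "v < H" "x < v" by auto
    have eq': "in_messages net (core_vertex x) a (net_msg a) = in_messages net (core_vertex x) a' (net_msg a')"
      using eq core by simp
    have "core_msg a x v = core_msg a' x v"
      unfolding core_msg_def
    proof (intro map_cong refl, goal_cases)
      case (1 l)
      then have l: "l < L" by simp
      note nd = node_determined[OF a x(1) l eq']
      have "snd (run a l (start v)) z = snd (run a' l (start v)) z" if "z \<in> passed x v" for z
        using that nd content_kept[of z x v] by (auto simp: passed_def passes_def)
      then show ?case using nd by auto
    qed
    then show ?thesis using x core(1) by (simp add: net_msg_simps)
  next
    case outs: (out x i)
    then have x: "x < H" by simp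
    have eq': "in_messages net (core_vertex x) a (net_msg a) = in_messages net (core_vertex x) a' (net_msg a')"
      using eq outs by simp
    have "Y a i = Y a' i"
    proof (rule sink_determined[OF a outs(2)])
      fix l assume l: "l < L"
      show "snd (run a l (length cs)) (oaddr i) = snd (run a' l (length cs)) (oaddr i)"
        using node_determined[OF a x l eq'] content_kept[OF outs(3)] outs(3)
        by (auto simp: start_num_nodes passes_def)
    qed
    then show ?thesis using outs(1) by (simp add: net_msg_simps)
  qed (use in_messagesD(2)[OF eq] hub in \<open>auto simp: net_msg_simps\<close>)
next
  fix a a' i
  assume "a \<in> {..<npairs net} \<rightarrow>\<^sub>E {..<Q}" "a' \<in> {..<npairs net} \<rightarrow>\<^sub>E {..<Q}" and "i < npairs net"
    and "in_messages net (snk net i) a (net_msg a) = in_messages net (snk net i) a' (net_msg a')"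
  then have a: "a \<in> \<Omega>" "a' \<in> \<Omega>" and i: "i < n"
    and eq: "in_messages net (sink_vertex i) a (net_msg a) = in_messages net (sink_vertex i) a' (net_msg a')"
    by simp_all
  have "(n, sink_vertex i) \<in> net_edges" using i by (rule net_edgesI)
  from in_messagesD(1)[OF eq this] have d: "d a i = d a' i" by (simp add: net_msg_simps)
  have "Y a i = Y a' i"
  proof (cases "\<exists>y<H. oaddr i \<in> accs y")
    case True
    then obtain x where "passes (oaddr i) x H" using exists_passes by blast
    then have "(core_vertex x, sink_vertex i) \<in> net_edges" using i by (auto intro: net_edgesI)
    from in_messagesD(1)[OF eq this] show ?thesis by (simp add: net_msg_simps)
  next
    case False
    \<comment> \<open>An output block that is never accessed ends with zeros whatever the messages
      are. Then \<open>Y a i\<close> is constant, and the sink can do without an edge from the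
      core.\<close>
    have "snd (run a l (length cs)) (oaddr i) = replicate B 0" for a l
      using content_fresh[of H "oaddr i" "inp a l"] False N_le_H by (auto simp: start_num_nodes)
    then show ?thesis by (intro sink_determined[OF a i]) simp
  qed
  then have "(d a' i + a i) mod Q = (d a' i + a' i) mod Q"
    using V_code(5)[OF a(1) i] V_code(5)[OF a(2) i] d by (simp add: add.commute)
  then have "a i mod Q = a' i mod Q" by (rule mod_add_left_cancel_nat)
  then show "a i = a' i" using PiE_mem[OF a(1)] PiE_mem[OF a(2)] i by auto
qed

subsection \<open>Rates\<close>

lemma entropy_le:
  assumes "finite T" "\<And>a. a \<in> \<Omega> \<Longrightarrow> f a \<in> T" "real (card T) \<le> 2 powr x"
  shows "shannon_entropy (source_space net (\<lambda>_. {..<Q})) f \<le> x"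
proof -
  have fin: "finite \<Omega>" by (rule finite_PiE) auto
  have ne: "\<Omega> \<noteq> {}" using Q_pos by (auto simp: PiE_eq_empty_iff)
  have "shannon_entropy (uniform_count_measure \<Omega>) f \<le> log 2 (real (card (f ` \<Omega>)))"
    by (rule shannon_entropy_le_log_card[OF fin ne])
  also have "\<dots> \<le> log 2 (2 powr x)"
  proof -
    have "0 < card (f ` \<Omega>)" using fin ne by (auto simp: card_gt_0_iff)
    moreover have "card (f ` \<Omega>) \<le> card T" using assms(1,2) by (intro card_mono) auto
    ultimately show ?thesis using assms(3) by (subst log_le_cancel_iff) auto
  qed
  finally show ?thesis by (simp add: source_space_def)
qed

lemma hub_block_entropy:
  "shannon_entropy (source_space net (\<lambda>_. {..<Q}))
     (\<lambda>a. to_nat (map (\<lambda>i. if i div B = j then d a i else 0) [0..<n]))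
   \<le> (\<Sum>i | i \<in> {..<n} \<and> i div B = j. c i)"
proof -
  let ?I = "{i. i \<in> {..<n} \<and> i div B = j}"
  let ?T = "(\<lambda>f. to_nat (map (\<lambda>i. if i div B = j then f i else 0) [0..<n])) ` (PiE ?I V)"
  have finV: "finite (V i)" if "i < n" for i using V_code(1)[OF that] finite_subset by blast
  have finP: "finite (PiE ?I V)" using finV by (intro finite_PiE) auto
  show ?thesis
  proof (rule entropy_le[of ?T])
    show "finite ?T" using finP by simp
    fix a assume a: "a \<in> \<Omega>"
    have "restrict (d a) ?I \<in> PiE ?I V" using V_code(4)[OF a] by auto
    moreover have "map (\<lambda>i. if i div B = j then d a i else 0) [0..<n] =
        map (\<lambda>i. if i div B = j then restrict (d a) ?I i else 0) [0..<n]"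
      by (intro map_cong) auto
    ultimately show "to_nat (map (\<lambda>i. if i div B = j then d a i else 0) [0..<n]) \<in> ?T"
      by (intro image_eqI[of _ _ "restrict (d a) ?I"]) (simp_all only:)
  next
    have "real (card ?T) \<le> real (card (PiE ?I V))"
      using card_image_le[OF finP] by simp
    also have "\<dots> = (\<Prod>i\<in>?I. real (card (V i)))" by (simp add: card_PiE)
    also have "\<dots> \<le> (\<Prod>i\<in>?I. 2 powr c i)" using V_code(3) by (intro prod_mono) auto
    also have "\<dots> = 2 powr (\<Sum>i\<in>?I. c i)" by (subst powr_sum) auto
    finally show "real (card ?T) \<le> 2 powr (\<Sum>i\<in>?I. c i)" .
  qed
qed

lemma core_entropy:
  "shannon_entropy (source_space net (\<lambda>_. {..<Q})) (\<lambda>a. to_nat (core_msg a x v)) \<le> real (core_cap x v)"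
proof -
  let ?mem = "N \<le> x \<and> v = Suc x"
  define A1 where "A1 = (if ?mem then memories w M else {[]})"
  define A2 where "A2 = {bs. set bs \<subseteq> memories w B \<and> length bs = card (passed x v)}"
  define A where "A = {xs. set xs \<subseteq> A1 \<times> A2 \<and> length xs = L}"
  have fin: "finite A1" "finite A2"
    unfolding A1_def A2_def by (auto intro: finite_lists_length_eq)
  have finA: "finite A" unfolding A_def using fin by (intro finite_lists_length_eq) auto
  have c1: "card A1 = 2 ^ (w * (if ?mem then M else 0))"
    by (auto simp: A1_def card_memories power_mult)
  have c2: "card A2 = 2 ^ (w * (B * card (passed x v)))"
    unfolding A2_def by (subst card_lists_length_eq) (auto simp: card_memories power_mult)
  have "card A = (card A1 * card A2) ^ L"
    unfolding A_def using fin by (subst card_lists_length_eq) (auto simp: card_cartesian_product)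
  also have "card A1 * card A2 = 2 ^ (w * (B * card (passed x v) + (if ?mem then M else 0)))"
    unfolding c1 c2 by (simp only: power_add[symmetric] distrib_left add.commute)
  also have "\<dots> ^ L = 2 ^ core_cap x v"
    by (simp only: core_cap_def power_mult[symmetric] mult_ac)
  finally have cA: "card A = 2 ^ core_cap x v" .
  show ?thesis
  proof (rule entropy_le[of "to_nat ` A"])
    show "finite (to_nat ` A)" using finA by simp
    have "card (to_nat ` A) \<le> card A" by (rule card_image_le[OF finA])
    then have "real (card (to_nat ` A)) \<le> real (2 ^ core_cap x v)" by (simp only: cA of_nat_le_iff)
    then show "real (card (to_nat ` A)) \<le> 2 powr real (core_cap x v)" by (simp add: powr_realpow)
  next
    fix a assume a: "a \<in> \<Omega>"
    have "(if ?mem then fst (run a l (start v)) else [],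
        map (snd (run a l (start v))) (sorted_list_of_set (passed x v))) \<in> A1 \<times> A2" if "l < L" for l
      using sim_memories[OF D_ok inp_inputs[OF a that]] by (auto simp: A1_def A2_def)
    then have "core_msg a x v \<in> A" by (auto simp: core_msg_def A_def)
    then show "to_nat (core_msg a x v) \<in> to_nat ` A" by simp
  qed
qed

lemma net_achieves: "nc_achieves net (log 2 (real Q))"
proof -
  obtain enc dec where sol: "nc_solution net (\<lambda>_. {..<Q}) enc dec net_msg"
    using exists_solution by auto
  have word: "real (card {..<Q}) \<le> 2 powr log 2 (real Q)" using Q_pos by simp
  have "shannon_entropy (source_space net (\<lambda>_. {..<Q})) (\<lambda>a. net_msg a e) \<le> net_cap e"
    if "e \<in> net_edges" for e
    using that
  proof (cases rule: net_edges_cases)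
    case (hub_in i)
    then show ?thesis using entropy_le[OF _ _ word, of "\<lambda>a. a i"] by (auto simp: net_msg_simps net_cap_simps)
  next
    case (feed i)
    then show ?thesis using entropy_le[OF _ _ word, of "\<lambda>a. a i"] by (auto simp: net_msg_simps net_cap_simps)
  next
    case (hub_block i)
    then show ?thesis using hub_block_entropy by (simp add: net_msg_simps net_cap_simps)
  next
    case (hub_sink i)
    have "finite (V i)" using V_code(1)[OF hub_sink(2)] finite_subset by blast
    from entropy_le[OF this, of "\<lambda>a. d a i" "c i"] show ?thesis using V_code(3,4) hub_sink
      by (simp add: net_msg_simps net_cap_simps)
  next
    case (core x v)
    then show ?thesis using core_entropy by (simp add: net_msg_simps net_cap_simps)
  next
    case (out x i)
    then show ?thesis using entropy_le[OF _ _ word, of "\<lambda>a. Y a i"] Y_less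
      by (auto simp: net_msg_simps net_cap_simps)
  qed
  moreover have "shannon_entropy (source_space net (\<lambda>_. {..<Q})) (\<lambda>a. a i) \<ge> log 2 (real Q)" if "i < n" for i
    using shannon_entropy_component[OF that Q_pos] by (simp add: source_space_def)
  ultimately show ?thesis
    unfolding nc_achieves_def using sol
    by (intro exI[of _ "\<lambda>_. {..<Q}"] exI[of _ enc] exI[of _ dec] exI[of _ net_msg]) auto
qed

subsection \<open>Lengths\<close>

text \<open>
  The two edges of a detour through the hub together are as long as the distance \<open>k\<close> that the far items
  travel otherwise, so the hub does not bring any source nearer to its sink.
\<close>

definition net_len :: "nat \<Rightarrow> nat \<times> nat \<Rightarrow> real" where
  "net_len k = (\<lambda>(x, y). if x = n \<or> y = n then real k / 2 else if n < x \<and> y < n + 1 + H then 1 else 0)"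

text \<open>The edge from the core into a sink has length 0, so the sink inherits the potential of
  its tail. Without such an edge only the hub limits the potential, and it may be as large as
  k.\<close>

definition sink_pot :: "nat \<Rightarrow> nat \<Rightarrow> nat \<Rightarrow> real" where
  "sink_pot k i j = (if \<exists>x. passes (oaddr j) x H then pot k (i div B) (THE x. passes (oaddr j) x H) else real k)"

text \<open>The hub gets the midpoint of the range [0, k], so every potential differs from it by at
  most k / 2, the length of the edges at the hub. A source has the potential of its block, to which
  it is joined by an edge of length 0.\<close>

definition net_pot :: "nat \<Rightarrow> nat \<Rightarrow> nat \<Rightarrow> real" where
  "net_pot k i z = (if z < n then pot k (i div B) (z div B) else if z = n then real k / 2
     else if z < n + 1 + H then pot k (i div B) (z - (n + 1)) else sink_pot k i (z - (n + 1 + H)))"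

lemma net_len_simps:
  "net_len k (x, n) = real k / 2"
  "net_len k (n, y) = real k / 2"
  "i < n \<Longrightarrow> net_len k (i, core_vertex j) = 0"
  "v < H \<Longrightarrow> net_len k (core_vertex x, core_vertex v) = 1"
  "net_len k (core_vertex x, sink_vertex i) = 0"
  by (auto simp: net_len_def core_vertex_def sink_vertex_def)

lemma net_pot_simps:
  "z < n \<Longrightarrow> net_pot k i z = pot k (i div B) (z div B)"
  "net_pot k i n = real k / 2"
  "x < H \<Longrightarrow> net_pot k i (core_vertex x) = pot k (i div B) x"
  "net_pot k i (sink_vertex j) = sink_pot k i j"
  by (auto simp: net_pot_def core_vertex_def sink_vertex_def)

lemma sink_pot_passes: "passes (oaddr j) x H \<Longrightarrow> sink_pot k i j = pot k (i div B) x"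
proof -
  assume x: "passes (oaddr j) x H"
  then have "(THE x. passes (oaddr j) x H) = x" using passes_unique_left by (intro the_equality) auto
  then show ?thesis using x by (auto simp: sink_pot_def)
qed

lemma sink_pot_bounds: "0 \<le> sink_pot k i j" "sink_pot k i j \<le> real k"
  by (auto simp: sink_pot_def pot_nonneg pot_le)

lemma net_pot_lipschitz:
  assumes "(u, v) \<in> net_edges"
  shows "\<bar>net_pot k i u - net_pot k i v\<bar> \<le> net_len k (u, v)"
proof -
  have half: "\<bar>r - real k / 2\<bar> \<le> real k / 2" "\<bar>real k / 2 - r\<bar> \<le> real k / 2" if "0 \<le> r" "r \<le> real k" for r
    using that by (auto simp: abs_le_iff field_simps)
  note pb = half[OF pot_nonneg pot_le] half[OF sink_pot_bounds]
  from assms show ?thesis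
  proof (cases rule: net_edges_cases)
    case (core x v)
    then show ?thesis using pot_lipschitz[OF core(2)] by (simp add: net_pot_simps net_len_simps)
  qed (use pb in \<open>auto simp: net_pot_simps net_len_simps sink_pot_passes\<close>)
qed

lemma net_len_nonneg: "0 \<le> net_len k e"
  by (auto simp: net_len_def split: prod.splits)

lemma sum_card_passed_le: "(\<Sum>(x, v)\<in>core_edges. card (passed x v)) \<le> length cs"
proof -
  have "(\<Sum>(x, v)\<in>core_edges. card (passed x v)) \<le> (\<Sum>(x, v)\<in>{..<H} \<times> {N..<H}. card (passed x v))"
    by (rule sum_mono2) (auto simp: core_edges_def)
  also have "\<dots> = (\<Sum>x<H. \<Sum>v\<in>{N..<H}. card (passed x v))"
    by (simp add: sum.cartesian_product)
  also have "\<dots> = (\<Sum>v\<in>{N..<H}. \<Sum>x<H. card (passed x v))" by (rule sum.swap)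
  also have "\<dots> \<le> (\<Sum>v\<in>{N..<H}. card (accs v))"
  proof (rule sum_mono)
    fix v
    have "(\<Sum>x<H. card (passed x v)) = card (\<Union>x<H. passed x v)"
      by (rule card_UN_disjoint[symmetric]) (auto simp: passed_def dest: passes_unique_left)
    also have "\<dots> \<le> card (accs v)" by (rule card_mono) (auto simp: passed_def)
    finally show "(\<Sum>x<H. card (passed x v)) \<le> card (accs v)" .
  qed
  also have "\<dots> \<le> length cs" by (rule sum_card_accs_le)
  finally show ?thesis .
qed

text \<open>Here the grouping pays: the memory is passed once per m steps and M \<le> 2 * m * B
  because m \<ge> 1, so it costs O(B) words per I/O, as the blocks do. There is one edge fewer than
  there are groups, so an incomplete last group does not matter.\<close>

lemma sum_memory_edges_le:
  "(\<Sum>(x, v)\<in>core_edges. if N \<le> x \<and> v = Suc x then M else 0) \<le> 2 * B * length cs"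
proof -
  have "(\<Sum>(x, v)\<in>core_edges. if N \<le> x \<and> v = Suc x then M else 0) \<le>
      (\<Sum>(x, v)\<in>(\<lambda>x. (x, Suc x)) ` {N..<H - 1}. M)"
  proof -
    have "(\<Sum>e\<in>core_edges. case e of (x, v) \<Rightarrow> if N \<le> x \<and> v = Suc x then M else 0) =
        (\<Sum>e\<in>{e \<in> core_edges. N \<le> fst e \<and> snd e = Suc (fst e)}. M)"
      by (subst sum.inter_filter[OF finite_core_edges]) (auto intro!: sum.cong)
    also have "\<dots> \<le> (\<Sum>e\<in>(\<lambda>x. (x, Suc x)) ` {N..<H - 1}. M)"
      by (rule sum_mono2) (auto simp: core_edges_def)
    finally show ?thesis by (simp add: case_prod_unfold)
  qed
  also have "\<dots> = (H - 1 - N) * M" by (simp add: case_prod_unfold card_image inj_on_def)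
  also have "\<dots> \<le> (H - 1 - N) * (2 * (m * B))"
  proof (rule mult_left_mono)
    have "M < B + M div B * B" using B_pos by (intro dividend_less_div_times) auto
    moreover have "B \<le> M div B * B" using m_pos m_def by simp
    ultimately show "M \<le> 2 * (m * B)" unfolding m_def by linarith
  qed simp
  also have "\<dots> = 2 * B * ((H - 1 - N) * m)" by (simp add: mult_ac)
  also have "\<dots> \<le> 2 * B * length cs"
  proof (rule mult_left_mono)
    have "(length cs + m - 1) div m * m \<le> length cs + m - 1" by (rule div_times_less_eq_dividend)
    moreover have "(H - 1 - N) * m = (length cs + m - 1) div m * m - m"
      by (simp add: num_nodes_def diff_mult_distrib)
    ultimately show "(H - 1 - N) * m \<le> length cs" using m_pos by linarith
  qed simp
  finally show ?thesis .
qed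

lemma sum_core_cap_le: "(\<Sum>(x, v)\<in>core_edges. core_cap x v) \<le> 3 * L * w * B * length cs"
proof -
  have "(\<Sum>(x, v)\<in>core_edges. core_cap x v) = L * w * (B * (\<Sum>(x, v)\<in>core_edges. card (passed x v)) +
      (\<Sum>(x, v)\<in>core_edges. if N \<le> x \<and> v = Suc x then M else 0))"
    by (simp add: core_cap_def case_prod_unfold sum_distrib_left sum.distrib distrib_left)
  also have "\<dots> \<le> L * w * (B * length cs + 2 * B * length cs)"
    by (intro mult_left_mono add_mono sum_card_passed_le sum_memory_edges_le) auto
  finally show ?thesis by (simp add: algebra_simps)
qed

text \<open>The edges into the hub contribute \<open>log 2 (real Q)\<close> for each item, those out
  of it the corrections twice, for input blocks and for sinks. Edges at sources and sinks that avoid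
  the hub have length 0.\<close>

lemma sum_cap_len_le:
  "(\<Sum>e\<in>net_edges. net_cap e * net_len k e) \<le>
     3 * real L * real w * real B * real (length cs) + real k / 2 * (real n * log 2 (real Q) + 2 * (\<Sum>i<n. c i))"
proof -
  let ?f = "\<lambda>e. net_cap e * net_len k e"
  have nn: "0 \<le> ?f e" if "e \<in> net_edges" for e
  proof -
    have "0 < net_cap e" using net_instance that by (simp add: kpairs_instance_def)
    then show ?thesis using net_len_nonneg by simp
  qed
  have fin: "finite hub_in" "finite feed" "finite hub_blocks" "finite hub_sinks" "finite core" "finite outs"
    using finite_core_edges finite_outs by (auto simp: hub_in_def feed_def hub_blocks_def hub_sinks_def core_def)
  have sub: "hub_in \<subseteq> net_edges" "feed \<subseteq> net_edges" "hub_blocks \<subseteq> net_edges" "hub_sinks \<subseteq> net_edges"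
    "core \<subseteq> net_edges" "outs \<subseteq> net_edges"
    by (auto simp: net_edges_def)
  have 1: "sum ?f hub_in \<le> real n * log 2 (real Q) * (real k / 2)"
  proof -
    have "sum ?f hub_in = (\<Sum>i<n. net_cap (i, n) * net_len k (i, n))"
      unfolding hub_in_def by (subst sum.reindex) (auto simp: inj_on_def)
    also have "\<dots> = (\<Sum>i<n. log 2 (real Q) * (real k / 2))"
      by (intro sum.cong) (auto simp: net_cap_simps net_len_simps)
    finally show ?thesis by simp
  qed
  have 2: "sum ?f feed = 0"
    by (rule sum.neutral) (auto simp: feed_def net_len_simps)
  have 3: "sum ?f hub_blocks \<le> (\<Sum>i<n. c i) * (real k / 2)"
  proof -
    let ?J = "(\<lambda>i. i div B) ` {..<n}"
    have J: "j < H" if "j \<in> ?J" for j using that block_less N_le_H by fastforce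
    have "sum ?f hub_blocks = (\<Sum>j\<in>?J. net_cap (n, core_vertex j) * net_len k (n, core_vertex j))"
      unfolding hub_blocks_def by (subst sum.reindex) (auto simp: inj_on_def)
    also have "\<dots> = (\<Sum>j\<in>?J. (\<Sum>i | i \<in> {..<n} \<and> i div B = j. c i) * (real k / 2))"
      using J by (intro sum.cong refl) (simp only: net_cap_simps net_len_simps)
    also have "\<dots> = (\<Sum>j\<in>?J. \<Sum>i | i \<in> {..<n} \<and> i div B = j. c i) * (real k / 2)"
      by (simp only: sum_distrib_right)
    also have "(\<Sum>j\<in>?J. \<Sum>i | i \<in> {..<n} \<and> i div B = j. c i) = (\<Sum>i<n. c i)"
      by (rule sum.group) auto
    finally show ?thesis by simp
  qed
  have 4: "sum ?f hub_sinks \<le> (\<Sum>i<n. c i) * (real k / 2)"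
  proof -
    have "sum ?f hub_sinks = (\<Sum>i<n. net_cap (n, sink_vertex i) * net_len k (n, sink_vertex i))"
      unfolding hub_sinks_def by (subst sum.reindex) (auto simp: inj_on_def)
    then show ?thesis by (simp add: net_cap_simps net_len_simps sum_distrib_right)
  qed
  have 5: "sum ?f core \<le> 3 * real L * real w * real B * real (length cs)"
  proof -
    have "sum ?f core = (\<Sum>(x, v)\<in>core_edges. net_cap (core_vertex x, core_vertex v) * net_len k (core_vertex x, core_vertex v))"
      unfolding core_def by (subst sum.reindex) (auto simp: inj_on_def case_prod_unfold)
    also have "\<dots> = (\<Sum>(x, v)\<in>core_edges. real (core_cap x v))"
      using core_edges_less by (intro sum.cong) (auto simp: net_cap_simps net_len_simps)
    also have "\<dots> = real (\<Sum>(x, v)\<in>core_edges. core_cap x v)" by (simp add: case_prod_unfold)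
    also have "\<dots> \<le> real (3 * L * w * B * length cs)" using sum_core_cap_le by (simp only: of_nat_le_iff)
    finally show ?thesis by simp
  qed
  have 6: "sum ?f outs = 0"
    by (rule sum.neutral) (auto simp: outs_def net_len_simps)
  have "sum ?f net_edges \<le> sum ?f hub_in + sum ?f feed + sum ?f hub_blocks + sum ?f hub_sinks + sum ?f core + sum ?f outs"
    unfolding net_edges_def
    by (intro order.trans[OF sum_Un_le] add_mono order.refl) (use fin nn sub in auto)
  then show ?thesis using 1 2 3 4 5 6 by (simp add: algebra_simps)
qed

text \<open>The source of a far item has potential 0 and its sink has potential k, also if no core
  edge leads there; the other items contribute nonnegative terms.\<close>

theorem far_items_bound:
  assumes conj: "undirected_k_pairs_conjecture" and r: "0 \<le> r" "r < log 2 (real Q)"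
    and far: "F \<subseteq> {i. i < n \<and> p ! i \<notin> near n B b (i div B) (k - 1)}"
  shows "r * (real k * real (card F)) \<le> 3 * real L * real w * real B * real (length cs) +
    real k / 2 * (real n * log 2 (real Q) + 2 * (\<Sum>i<n. c i))"
proof -
  have dist: "\<bar>net_pot k i i - net_pot k i (sink_vertex i)\<bar> = real k" if "i \<in> F" for i
  proof -
    have i: "i < n" "p ! i \<notin> near n B b (i div B) (k - 1)" using that far by auto
    have "sink_pot k i i = real k"
    proof (cases "\<exists>x. passes (oaddr i) x H")
      case True
      then obtain x where x: "passes (oaddr i) x H" by auto
      then have "x \<notin> ball_from (i div B) (k - 1)"
        using i perm_less[OF i(1)] by (auto simp: near_def oaddr_def)
      then show ?thesis using sink_pot_passes[OF x] pot_far by simp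
    qed (simp add: sink_pot_def)
    then show ?thesis using i by (simp add: net_pot_simps pot_self)
  qed
  have finF: "F \<subseteq> {..<n}" using far by auto
  have "real k * real (card F) = (\<Sum>i\<in>F. \<bar>net_pot k i i - net_pot k i (sink_vertex i)\<bar>)"
    by (simp add: dist)
  also have "\<dots> \<le> (\<Sum>i<n. \<bar>net_pot k i i - net_pot k i (sink_vertex i)\<bar>)"
    using finF by (intro sum_mono2) auto
  finally have "r * (real k * real (card F)) \<le> r * (\<Sum>i<n. \<bar>net_pot k i i - net_pot k i (sink_vertex i)\<bar>)"
    using r(1) by (rule mult_left_mono)
  also have "\<dots> \<le> (\<Sum>e\<in>net_edges. net_cap e * net_len k e)"
    using nc_achieves_length_bound[OF conj net_instance net_achieves r, of "net_pot k" "net_len k"]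
      net_pot_lipschitz net_len_nonneg by simp
  also note sum_cap_len_le
  finally show ?thesis .
qed

end

section \<open>Fixing the coins\<close>

lemma prob_space_coins: "prob_space coins"
  unfolding coins_def by (intro prob_space_PiM measure_pmf.prob_space_axioms)

lemma space_coins: "space coins = UNIV"
  by (simp add: coins_def space_PiM)

lemma countable_actions: "countable (UNIV :: action set)"
proof -
  have "(UNIV :: action set) = range (\<lambda>(a, p). Read a p) \<union> range (\<lambda>(a, p). Write a p) \<union> range Halt"
  proof (intro equalityI subsetI)
    fix x :: action
    show "x \<in> range (\<lambda>(a, p). Read a p) \<union> range (\<lambda>(a, p). Write a p) \<union> range Halt"
      by (cases x) (auto simp: image_iff)
  qed simp
  then show ?thesis by (metis countable_Un countableI_type countable_image)
qed

lemma em_algorithmD: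
  assumes "em_algorithm w M B R"
  shows "det_em_algorithm w M B (R \<omega>)"
    and "x \<in> memories w M \<Longrightarrow> (\<lambda>\<omega>. R \<omega> t x) \<in> measurable coins (count_space UNIV)"
  using assms by (auto simp: em_algorithm_def det_em_algorithm_def)

text \<open>Measurability of the algorithm is given for each fixed memory separately, so the
  composition needs countably many states. Disks are functions and thus uncountably many; hence a
  countable set of possible states is carried along.\<close>

lemma state_after_measurable_countable:
  assumes R: "em_algorithm w M B R" and xs: "xs \<in> inputs n w"
  shows "\<exists>K. countable K \<and> K \<subseteq> {s. fst s \<in> memories w M \<and> (\<forall>a. snd s a \<in> memories w B)} \<and>
    (\<lambda>\<omega>. state_after M B (R \<omega>) xs t) \<in> measurable coins (count_space K)"
proof (induction t)
  case 0
  then show ?case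
    using init_disk_memories[OF xs, of B]
    by (intro exI[of _ "{(replicate M 0, init_disk B xs)}"]) (auto simp: memories_def)
next
  case (Suc t)
  let ?W = "{s. fst s \<in> memories w M \<and> (\<forall>a. snd s a \<in> memories w B)}"
  from Suc obtain K where K: "countable K" "K \<subseteq> ?W"
    "(\<lambda>\<omega>. state_after M B (R \<omega>) xs t) \<in> measurable coins (count_space K)" by auto
  define step where "step = (\<lambda>s \<omega>. perform B (R \<omega> t (fst s)) (snd s))"
  have eq: "state_after M B (R \<omega>) xs (Suc t) = step (state_after M B (R \<omega>) xs t) \<omega>" for \<omega>
    by (simp add: step_def case_prod_unfold Let_def)
  have inK: "state_after M B (R \<omega>) xs t \<in> K" for \<omega>
    using measurable_space[OF K(3), of \<omega>] by (simp add: space_coins)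
  have m: "(\<lambda>\<omega>. state_after M B (R \<omega>) xs (Suc t)) \<in> measurable coins (count_space UNIV)"
    unfolding eq
  proof (rule measurable_compose_countable'[OF _ K(3,1)])
    fix s assume s: "s \<in> K"
    have "(\<lambda>\<omega>. R \<omega> t (fst s)) \<in> measurable coins (count_space UNIV)"
      using em_algorithmD(2)[OF R] s K(2) by auto
    from measurable_compose[OF this, of "\<lambda>xa. perform B xa (snd s)" "count_space UNIV"]
    show "step s \<in> measurable coins (count_space UNIV)" by (simp add: step_def)
  qed
  define K' where "K' = (\<lambda>(s, xa). perform B xa (snd s)) ` (K \<times> UNIV) \<inter> ?W"
  have "countable ((\<lambda>(s, xa). perform B xa (snd s)) ` (K \<times> (UNIV :: (nat list \<times> action) set)))"
    using K(1) countable_SIGMA[OF countableI_type[of "UNIV :: nat list set"] countable_actions]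
    by (intro countable_image countable_SIGMA) auto
  then have cK': "countable K'" unfolding K'_def by (rule countable_Int1)
  have in': "state_after M B (R \<omega>) xs (Suc t) \<in> K'" for \<omega>
  proof -
    let ?s = "state_after M B (R \<omega>) xs t"
    obtain x' act where act: "R \<omega> t (fst ?s) = (x', act)" by (cases "R \<omega> t (fst ?s)")
    have s: "fst ?s \<in> memories w M" "\<And>a. snd ?s a \<in> memories w B" using inK[of \<omega>] K(2) by auto
    have "x' \<in> memories w M" "legal_action M B act"
      using em_algorithmD(1)[OF R, of \<omega>] s(1) act unfolding det_em_algorithm_def
      by (metis fst_conv, metis snd_conv)
    then have "perform B (x', act) (snd ?s) \<in> ?W" using perform_memories[of x' w M "snd ?s" B act] s by auto
    moreover have "perform B (x', act) (snd ?s) \<in> (\<lambda>(s, xa). perform B xa (snd s)) ` (K \<times> UNIV)"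
      using inK[of \<omega>] by (intro image_eqI[of _ _ "(?s, (x', act))"]) auto
    ultimately show ?thesis unfolding eq step_def act K'_def by simp
  qed
  have "(\<lambda>\<omega>. state_after M B (R \<omega>) xs (Suc t)) \<in> measurable coins (count_space K')"
    using measurable_restrict_space2[OF _ m, of K'] in' by (simp add: restrict_count_space)
  then show ?case using cK' by (intro exI[of _ K']) (auto simp: K'_def)
qed

lemma state_after_measurable:
  assumes "em_algorithm w M B R" "xs \<in> inputs n w"
  shows "(\<lambda>\<omega>. state_after M B (R \<omega>) xs t) \<in> measurable coins (count_space UNIV)"
proof -
  from state_after_measurable_countable[OF assms, of t] obtain K where
    "(\<lambda>\<omega>. state_after M B (R \<omega>) xs t) \<in> measurable coins (count_space K)" by auto
  from measurable_compose[OF this, of "\<lambda>s. s" "count_space UNIV"] show ?thesis by simp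
qed

lemma action_at_measurable:
  assumes R: "em_algorithm w M B R" and xs: "xs \<in> inputs n w"
  shows "(\<lambda>\<omega>. action_at M B (R \<omega>) xs t) \<in> measurable coins (count_space UNIV)"
proof -
  from state_after_measurable_countable[OF assms, of t] obtain K where K: "countable K"
    "K \<subseteq> {s. fst s \<in> memories w M \<and> (\<forall>a. snd s a \<in> memories w B)}"
    "(\<lambda>\<omega>. state_after M B (R \<omega>) xs t) \<in> measurable coins (count_space K)" by auto
  show ?thesis unfolding action_at_def
  proof (rule measurable_compose_countable'[OF _ K(3,1)])
    fix s assume s: "s \<in> K"
    have "(\<lambda>\<omega>. R \<omega> t (fst s)) \<in> measurable coins (count_space UNIV)"
      using em_algorithmD(2)[OF R] s K(2) by auto
    from measurable_compose[OF this, of snd "count_space UNIV"]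
    show "(\<lambda>\<omega>. snd (R \<omega> t (fst s))) \<in> measurable coins (count_space UNIV)" by simp
  qed
qed

definition halts_with :: "nat \<Rightarrow> nat \<Rightarrow> det_alg \<Rightarrow> nat list \<Rightarrow> nat \<Rightarrow> (nat \<Rightarrow> disk \<Rightarrow> bool) \<Rightarrow> bool" where
  "halts_with M B D xs \<tau> P \<longleftrightarrow>
     (\<exists>t\<le>\<tau>. \<exists>a. halts_after M B D xs t a \<and> P a (snd (state_after M B D xs t)))"

lemma sets_halts_after:
  assumes "em_algorithm w M B R" "xs \<in> inputs n w"
  shows "{\<omega> \<in> space coins. halts_after M B (R \<omega>) xs t a \<and> P (state_after M B (R \<omega>) xs t)} \<in> sets coins"
proof -
  note [measurable] = action_at_measurable[OF assms] state_after_measurable[OF assms]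
  have [measurable]: "Measurable.pred coins (\<lambda>\<omega>. action_at M B (R \<omega>) xs t = A)" for t A
    using measurable_compose[OF action_at_measurable[OF assms], of "\<lambda>x. x = A" "count_space UNIV"] by simp
  have [measurable]: "Measurable.pred coins (\<lambda>\<omega>. P (state_after M B (R \<omega>) xs t))" for t
    using measurable_compose[OF state_after_measurable[OF assms], of P "count_space UNIV"] by simp
  show ?thesis unfolding halts_after_def by measurable
qed

lemma sets_halts_with:
  assumes "em_algorithm w M B R" "xs \<in> inputs n w"
  shows "{\<omega> \<in> space coins. halts_with M B (R \<omega>) xs \<tau> P} \<in> sets coins"
proof -
  have "{\<omega> \<in> space coins. halts_with M B (R \<omega>) xs \<tau> P} = (\<Union>t\<in>{..\<tau>}. \<Union>a.
      {\<omega> \<in> space coins. halts_after M B (R \<omega>) xs t a \<and> P a (snd (state_after M B (R \<omega>) xs t))})"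
    by (auto simp: halts_with_def)
  also have "\<dots> \<in> sets coins"
    using sets_halts_after[OF assms, where P = "\<lambda>s. P _ (snd s)"] by (intro sets.countable_UN'' ) auto
  finally show ?thesis .
qed

definition correct_output :: "nat \<Rightarrow> nat list \<Rightarrow> nat \<Rightarrow> disk \<Rightarrow> bool" where
  "correct_output B xs a d \<longleftrightarrow> (\<forall>i<length xs. d (a + i div B) ! (i mod B) = sort xs ! i)"

abbreviation sorts_within :: "nat \<Rightarrow> nat \<Rightarrow> det_alg \<Rightarrow> nat list \<Rightarrow> nat \<Rightarrow> bool" where
  "sorts_within M B D xs \<tau> \<equiv> halts_with M B D xs \<tau> (correct_output B xs)"

lemma halts_after_unique: "halts_after M B D xs t a \<Longrightarrow> halts_after M B D xs t' a' \<Longrightarrow> t = t' \<and> a = a'"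
  unfolding halts_after_def by (cases t t' rule: linorder_cases) auto

lemma io_count_ge:
  assumes "\<not> halts_with M B D xs \<tau> (\<lambda>_ _. True)"
  shows "ennreal (real \<tau> + 1) \<le> io_count M B D xs"
  unfolding io_count_def
proof (rule INF_greatest)
  fix t assume "t \<in> {t. \<exists>a. halts_after M B D xs t a}"
  then have "\<not> t \<le> \<tau>" using assms unfolding halts_with_def by blast
  then have "\<tau> + 1 \<le> t" by simp
  then have "ennreal (real (\<tau> + 1)) \<le> ennreal (real t)" by (intro ennreal_leI) (simp only: of_nat_le_iff)
  then show "ennreal (real \<tau> + 1) \<le> of_nat t" by (simp add: ennreal_of_nat_eq_real_of_nat add.commute)
qed

text \<open>
  \<open>error_prob\<close> would be \<open>0\<close> if the runs that sort did not form a measurable set, hence the measurability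
  lemmas above. For \<open>io_count\<close> measurability is avoided by a pointwise lower bound.
\<close>

lemma good_coins_prob:
  assumes R: "em_algorithm w M B R" and xs: "xs \<in> inputs n w"
    and err: "error_prob M B R xs \<le> 1 / 3"
    and ios: "expected_ios M B R xs \<le> ennreal T" and T: "0 \<le> T" "6 * T \<le> real \<tau> + 1"
  shows "measure coins {\<omega> \<in> space coins. sorts_within M B (R \<omega>) xs \<tau>} \<ge> 1 / 2"
proof -
  interpret prob_space coins by (rule prob_space_coins)
  let ?G = "{\<omega> \<in> space coins. sorts_within M B (R \<omega>) xs \<tau>}"
  let ?E = "{\<omega> \<in> space coins. halts_with M B (R \<omega>) xs \<tau> (\<lambda>_ _. True)}"
  let ?F = "{\<omega> \<in> space coins. \<not> sorts_input M B (R \<omega>) xs}"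
  have G: "?G \<in> sets coins" and E: "?E \<in> sets coins" by (rule sets_halts_with[OF R xs])+
  have "?F = space coins - (\<Union>t. {\<omega> \<in> space coins. sorts_within M B (R \<omega>) xs t})"
  proof -
    have "sorts_input M B D xs \<longleftrightarrow> (\<exists>t. sorts_within M B D xs t)" for D
      unfolding sorts_input_def halts_with_def correct_output_def by blast
    then show ?thesis by auto
  qed
  also have "\<dots> \<in> sets coins" using sets_halts_with[OF R xs] by auto
  finally have F: "?F \<in> sets coins" .
  \<comment> \<open>Markov's inequality: a run exceeds \<tau> steps with probability at most 1 / 6,
    which together with the error 1 / 3 leaves probability 1 / 2.\<close>
  have "(real \<tau> + 1) * measure coins (space coins - ?E) \<le> T"
  proof -
    have "ennreal ((real \<tau> + 1) * measure coins (space coins - ?E)) =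
        ennreal (real \<tau> + 1) * emeasure coins (space coins - ?E)"
      by (simp add: emeasure_eq_measure ennreal_mult)
    also have "\<dots> = (\<integral>\<^sup>+\<omega>. ennreal (real \<tau> + 1) * indicator (space coins - ?E) \<omega> \<partial>coins)"
      using E by (subst nn_integral_cmult_indicator) auto
    also have "\<dots> \<le> expected_ios M B R xs"
      unfolding expected_ios_def
      by (rule nn_integral_mono) (auto simp: indicator_def simp del: ennreal_plus intro: io_count_ge)
    also have "\<dots> \<le> ennreal T" by (rule ios)
    finally show ?thesis using T(1) by (simp add: ennreal_le_iff)
  qed
  then have "(real \<tau> + 1) * measure coins (space coins - ?E) \<le> (real \<tau> + 1) * (1 / 6)"
    by (rule order.trans) (use T(2) in simp)
  then have E6: "measure coins (space coins - ?E) \<le> 1 / 6" by (subst (asm) mult_le_cancel_left_pos) auto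
  have "space coins - ?G \<subseteq> ?F \<union> (space coins - ?E)"
  proof
    fix \<omega> assume \<omega>: "\<omega> \<in> space coins - ?G"
    show "\<omega> \<in> ?F \<union> (space coins - ?E)"
    proof (rule ccontr)
      assume *: "\<omega> \<notin> ?F \<union> (space coins - ?E)"
      then have "sorts_input M B (R \<omega>) xs" "halts_with M B (R \<omega>) xs \<tau> (\<lambda>_ _. True)" using \<omega> by auto
      then obtain t a t' a' where ta: "halts_after M B (R \<omega>) xs t a"
        "correct_output B xs a (snd (state_after M B (R \<omega>) xs t))" "halts_after M B (R \<omega>) xs t' a'" "t' \<le> \<tau>"
        unfolding sorts_input_def halts_with_def correct_output_def by blast
      then have "sorts_within M B (R \<omega>) xs \<tau>"
        using halts_after_unique[OF ta(1,3)] unfolding halts_with_def by auto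
      then show False using \<omega> by auto
    qed
  qed
  then have "measure coins (space coins - ?G) \<le> measure coins (?F \<union> (space coins - ?E))"
    using E F by (intro finite_measure_mono) auto
  also have "\<dots> \<le> measure coins ?F + measure coins (space coins - ?E)"
    using E F by (intro measure_subadditive) auto
  also have "\<dots> \<le> 1 / 3 + 1 / 6" using err E6 unfolding error_prob_def by linarith
  finally show ?thesis using prob_compl[OF G] by simp
qed

text \<open>Averaging over the inputs in \<open>F\<close>, the easy direction of Yao's
  principle.\<close>

lemma exists_coins:
  assumes R: "em_algorithm w M B R" and F: "finite F" "F \<subseteq> inputs n w"
    and err: "\<And>xs. xs \<in> F \<Longrightarrow> error_prob M B R xs \<le> 1 / 3"
    and ios: "\<And>xs. xs \<in> F \<Longrightarrow> expected_ios M B R xs \<le> ennreal T" and T: "0 \<le> T" "6 * T \<le> real \<tau> + 1"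
  shows "\<exists>\<omega>. card F \<le> 2 * card {xs \<in> F. sorts_within M B (R \<omega>) xs \<tau>}"
proof (rule ccontr)
  interpret prob_space coins by (rule prob_space_coins)
  define G where "G = (\<lambda>xs. {\<omega> \<in> space coins. sorts_within M B (R \<omega>) xs \<tau>})"
  have G: "G xs \<in> sets coins" if "xs \<in> F" for xs
    unfolding G_def using sets_halts_with[OF R] F(2) that by auto
  have int: "integrable coins (indicat_real (G xs))" if "xs \<in> F" for xs
    using G[OF that] by (intro integrable_real_indicator) (auto simp: emeasure_eq_measure)
  assume "\<not> ?thesis"
  \<comment> \<open>Integrality turns the strict inequality into a gap of 1, which survives the
    integration.\<close>
  then have less: "2 * card {xs \<in> F. sorts_within M B (R \<omega>) xs \<tau>} + 1 \<le> card F" for \<omega>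
    by (simp add: not_le Suc_le_eq)
  have "real (card F) * (1 / 2) \<le> (\<Sum>xs\<in>F. measure coins (G xs))"
  proof -
    have "1 / 2 \<le> measure coins (G xs)" if "xs \<in> F" for xs
      unfolding G_def using good_coins_prob[OF R _ err ios T] F(2) that by auto
    from sum_bounded_below[of F "1 / 2", OF this] show ?thesis by simp
  qed
  also have "\<dots> = (\<Sum>xs\<in>F. \<integral>\<omega>. indicator (G xs) \<omega> \<partial>coins)"
    using G by (intro sum.cong) auto
  also have "\<dots> = (\<integral>\<omega>. (\<Sum>xs\<in>F. indicator (G xs) \<omega>) \<partial>coins)"
    using int by (subst Bochner_Integration.integral_sum) auto
  also have "\<dots> \<le> (\<integral>\<omega>. real (card F) * (1 / 2) - 1 / 2 \<partial>coins)"
  proof (rule integral_mono)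
    show "integrable coins (\<lambda>\<omega>. \<Sum>xs\<in>F. indicator (G xs) \<omega> :: real)" using int by auto
    fix \<omega> assume "\<omega> \<in> space coins"
    have "(\<Sum>xs\<in>F. indicator (G xs) \<omega> :: real) = real (card {xs \<in> F. \<omega> \<in> G xs})"
      using F(1) by (simp add: indicator_def sum.If_cases Int_def)
    also have "{xs \<in> F. \<omega> \<in> G xs} = {xs \<in> F. sorts_within M B (R \<omega>) xs \<tau>}"
      by (auto simp: G_def space_coins)
    also have "real (card \<dots>) \<le> real (card F) * (1 / 2) - 1 / 2"
      using less[of \<omega>] by (simp add: field_simps flip: of_nat_mult of_nat_add)
    finally show "(\<Sum>xs\<in>F. indicator (G xs) \<omega>) \<le> real (card F) * (1 / 2) - 1 / 2" .
  qed auto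
  also have "\<dots> = real (card F) * (1 / 2) - 1 / 2" by (simp add: prob_space)
  finally show False by simp
qed

section \<open>Sorting takes at least one I/O\<close>

lemma sort_rev_upt: "sort (rev [0..<n]) = [0..<n]"
  by (rule properties_for_sort) auto

text \<open>On the initial disk the largest item n - 1 occurs at place 0 only, but an output array
  starting at block \<open>a\<close> needs it at place \<open>a * B + (n - 1)\<close>.\<close>

lemma not_sorted_without_ios:
  assumes "n \<ge> 2" "B \<ge> 1"
  shows "\<not> sorts_within M B D (rev [0..<n]) 0"
proof
  let ?xs = "rev [0..<n]"
  assume "sorts_within M B D ?xs 0"
  then obtain a where "correct_output B ?xs a (init_disk B ?xs)" by (auto simp: halts_with_def)
  then have "init_disk B ?xs (a + (n - 1) div B) ! ((n - 1) mod B) = sort ?xs ! (n - 1)"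
    using assms by (auto simp: correct_output_def)
  also have "sort ?xs ! (n - 1) = n - 1" unfolding sort_rev_upt using assms by simp
  finally have *: "init_disk B ?xs (a + (n - 1) div B) ! ((n - 1) mod B) = n - 1" .
  have "(n - 1) mod B < B" using assms by simp
  moreover have "(a + (n - 1) div B) * B + (n - 1) mod B = a * B + (n - 1)"
    by (simp add: distrib_right add.assoc)
  ultimately show False using * assms
    by (auto simp: init_disk_def rev_nth split: if_splits)
qed

section \<open>Counting access patterns\<close>

definition keyed :: "nat \<Rightarrow> nat \<Rightarrow> nat list \<Rightarrow> nat list \<Rightarrow> nat list" where
  "keyed n q p y = map (\<lambda>i. p ! i * q + y ! i) [0..<n]"

lemma keyed_inputs:
  assumes p: "p \<in> permutations_of_set {..<n}" and y: "y \<in> strings n q" and w: "n * q \<le> 2 ^ w"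
  shows "keyed n q p y \<in> inputs n w"
proof -
  have "p ! i * q + y ! i < 2 ^ w" if i: "i < n" for i
  proof -
    have "p ! i < n"
      using p length_finite_permutations_of_set[OF p] nth_mem[of i p] i by (auto simp: permutations_of_set_def)
    then have "Suc (p ! i) * q \<le> n * q" by (intro mult_right_mono) auto
    moreover have "y ! i < q" by (rule strings_nth[OF y i])
    ultimately show ?thesis using w by simp
  qed
  then show ?thesis by (auto simp: inputs_def keyed_def)
qed

lemma inj_on_keyed: "inj_on (\<lambda>(p, y). keyed n q p y) (permutations_of_set {..<n} \<times> strings n q)"
proof (rule inj_onI, clarify)
  fix p y p' y' assume p: "p \<in> permutations_of_set {..<n}" "p' \<in> permutations_of_set {..<n}"
    and y: "y \<in> strings n q" "y' \<in> strings n q" and eq: "keyed n q p y = keyed n q p' y'"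
  have len: "length p = n" "length p' = n" "length y = n" "length y' = n"
    using p y by (auto simp: length_strings dest: length_finite_permutations_of_set)
  have nth: "p ! i = p' ! i \<and> y ! i = y' ! i" if i: "i < n" for i
  proof -
    have e: "p ! i * q + y ! i = p' ! i * q + y' ! i"
      using arg_cong[OF eq, of "\<lambda>xs. xs ! i"] i by (simp add: keyed_def)
    have q: "y ! i < q" "y' ! i < q" using strings_nth y i by auto
    have "(p ! i * q + y ! i) div q = p ! i" "(p' ! i * q + y' ! i) div q = p' ! i" using q by auto
    then have "p ! i = p' ! i" using e by simp
    then show ?thesis using e by simp
  qed
  show "p = p' \<and> y = y'" using nth len by (auto intro: nth_equalityI)
qed

lemma card_lists_le_length:
  "finite {cs. set cs \<subseteq> {..<s} \<and> length cs \<le> \<tau>} \<and>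
    card {cs. set cs \<subseteq> {..<s :: nat} \<and> length cs \<le> \<tau>} \<le> (s + 1) ^ \<tau>"
proof -
  have "(\<Sum>i\<le>\<tau>. s ^ i) \<le> (s + 1) ^ \<tau>"
  proof (induction \<tau>)
    case (Suc \<tau>)
    have "s ^ \<tau> \<le> (s + 1) ^ \<tau>" by (intro power_mono) auto
    then have "s * s ^ \<tau> \<le> s * (s + 1) ^ \<tau>" by (rule mult_left_mono) simp
    then have "(\<Sum>i\<le>\<tau>. s ^ i) + s * s ^ \<tau> \<le> (s + 1) ^ \<tau> + s * (s + 1) ^ \<tau>"
      using Suc by (rule add_mono[rotated])
    then show ?case by simp
  qed simp
  then show ?thesis
    using finite_lists_length_le[of "{..<s}" \<tau>] card_lists_length_le[of "{..<s}" \<tau>] by simp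
qed

lemma exists_popular:
  fixes f :: "'a \<Rightarrow> 'b"
  assumes "finite G" "finite T" "\<And>g. g \<in> G \<Longrightarrow> \<exists>t\<in>T. P t g" "G \<noteq> {}"
  shows "\<exists>t\<in>T. card G \<le> card T * card {g \<in> G. P t g}"
proof (rule ccontr)
  assume *: "\<not> ?thesis"
  have T: "T \<noteq> {}" using assms(3,4) by auto
  have "card G \<le> card (\<Union>t\<in>T. {g \<in> G. P t g})"
    using assms by (intro card_mono) auto
  also have "\<dots> \<le> (\<Sum>t\<in>T. card {g \<in> G. P t g})" by (rule card_UN_le[OF assms(2)])
  finally have "card T * card G \<le> (\<Sum>t\<in>T. card T * card {g \<in> G. P t g})"
    by (simp add: sum_distrib_left[symmetric])
  also have "\<dots> < (\<Sum>t\<in>T. card G)"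
    using * T assms(2) by (intro sum_strict_mono) auto
  finally show False by simp
qed

text \<open>\<open>P\<close> bounds the number of patterns: \<open>n div B + 2\<close> values of
  \<open>b\<close>, and address lists of length at most \<tau>, one additional symbol allowing for
  shorter ones. By \<open>zP\<close> fewer than a fraction 1 / (4 * P) of the permutations leave
  many items near; by \<open>lP\<close> a set of words of density 1 / (4 * P) is dense enough to be
  covered.\<close>

lemma sorting_tradeoff:
  fixes \<tau> :: nat and z :: real
  assumes conj: "undirected_k_pairs_conjecture"
    and B: "1 \<le> B" "B \<le> M" and n: "n \<ge> 1" and l: "l \<ge> 1" and w: "n * 2 ^ l \<le> 2 ^ w"
    and D: "det_em_algorithm w M B D" and k: "k \<ge> 1"
    and good: "fact n * 2 ^ (l * n) \<le> 2 * card {(p, y) \<in> permutations_of_set {..<n} \<times> strings n (2 ^ l).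
      sorts_within M B D (keyed n (2 ^ l) p y) \<tau>}"
    and P: "(n div B + 2) * (2 * (n div B + 1) + \<tau> + 1) ^ \<tau> \<le> P"
    and z: "z \<ge> 1" "z * real (B * (2 * (M div B) + 3) ^ (2 * (k - 1))) \<le> real (n div 20)"
    and zP: "4 * real P * 2 ^ n < z ^ (n div 20)"
    and lP: "4 * real P \<le> 2 powr (real l * real n / 7200)"
  shows "real k * real n * real l \<le> 12 * real w * real B * real \<tau>"
proof -
  define N where "N = n div B + 1"
  define m where "m = M div B"
  define q :: nat where "q = 2 ^ l"
  have q2: "q \<ge> 2" using l power_increasing[of 1 l "2 :: nat"] by (simp add: q_def)
  have w0: "w > 0"
  proof (rule ccontr)
    assume "\<not> w > 0"
    then have "n * 2 ^ l \<le> 1" using w by simp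
    moreover have "1 * 2 \<le> n * 2 ^ l" using n q2 unfolding q_def by (intro mult_mono) auto
    ultimately show False by linarith
  qed
  have m0: "m > 0" using B by (simp add: m_def div_greater_zero_iff)
  have nNB: "n < N * B"
    using dividend_less_div_times[of B n] B by (simp add: N_def algebra_simps)
  have blk: "i div B < N" if "i < n" for i using that nNB by (auto simp: less_mult_imp_div_less)
  let ?perms = "permutations_of_set {..<n}"
  define G where "G = {(p, y) \<in> ?perms \<times> strings n q.
      sorts_within M B D (keyed n q p y) \<tau>}"
  define T where "T = {..N} \<times> {cs. set cs \<subseteq> {..<2 * N + \<tau>} \<and> length cs \<le> \<tau>}"
  have finG: "finite G" unfolding G_def by (rule finite_subset[of _ "?perms \<times> strings n q"]) auto
  have finT: "finite T" using card_lists_le_length unfolding T_def by auto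
  have cT: "card T \<le> P"
  proof -
    have "card T = (N + 1) * card {cs. set cs \<subseteq> {..<2 * N + \<tau>} \<and> length cs \<le> \<tau>}"
      by (simp add: T_def card_cartesian_product)
    also have "\<dots> \<le> (N + 1) * (2 * N + \<tau> + 1) ^ \<tau>"
      using card_lists_le_length by (intro mult_left_mono) auto
    also have "\<dots> \<le> P" using P by (simp add: N_def)
    finally show ?thesis .
  qed
  have cG: "fact n * q ^ n \<le> 2 * card G"
    using good unfolding G_def q_def by (simp add: power_mult)
  have q0: "0 < fact n * q ^ n" using q2 by simp
  have G0: "G \<noteq> {}" using cG q0 by auto
  define W where "W = (\<lambda>t g. sim_sorts M B D N (fst t) (snd t) (keyed n q (fst g) (snd g)))"
  have pat: "\<exists>t\<in>T. W t g" if "g \<in> G" for g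
  proof -
    obtain p y where g: "g = (p, y)" by (cases g)
    let ?xs = "keyed n q p y"
    have len: "length ?xs = n" by (simp add: keyed_def)
    from that g obtain t a where ta: "t \<le> \<tau>" "correct_output B ?xs a (snd (state_after M B D ?xs t))"
      by (auto simp: G_def halts_with_def)
    from exists_sim_sorts[OF B(1), of ?xs N t \<tau> M D a] ta nNB len obtain b cs where
      "b \<le> N" "length cs \<le> \<tau>" "set cs \<subseteq> {..<2 * N + \<tau>}" "sim_sorts M B D N b cs ?xs"
      unfolding correct_output_def by auto
    then show ?thesis by (intro bexI[of _ "(b, cs)"]) (auto simp: T_def W_def g)
  qed
  from exists_popular[where P = W, OF finG finT pat G0] obtain t0 where t0: "t0 \<in> T"
    "card G \<le> card T * card {g \<in> G. W t0 g}" by auto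
  obtain b cs where "t0 = (b, cs)" by (cases t0)
  with t0 have bcs: "(b, cs) \<in> T" and pop: "card G \<le> card T * card {g \<in> G. W (b, cs) g}" by auto
  define G' where "G' = {(p, y) \<in> G. sim_sorts M B D N b cs (keyed n q p y)}"
  have G'eq: "{g \<in> G. W (b, cs) g} = G'"
    by (auto simp: G'_def W_def)
  have finG': "finite G'" using finG by (rule rev_finite_subset) (auto simp: G'_def)
  have cG': "real (fact n * q ^ n) \<le> 2 * real P * real (card G')"
  proof -
    have "fact n * q ^ n \<le> 2 * (card T * card G')" using cG pop unfolding G'eq by linarith
    also have "\<dots> \<le> 2 * (P * card G')" using cT by (intro mult_left_mono mult_right_mono) auto
    finally show ?thesis by (metis mult.assoc of_nat_le_iff of_nat_mult of_nat_numeral)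
  qed
  have P0: "real P > 0"
  proof (rule ccontr)
    assume "\<not> real P > 0"
    then have "real P = 0" by simp
    then have "real (fact n * q ^ n) \<le> 0" using cG' by (simp only: mult_zero_left mult_zero_right)
    then show False using q0 by (simp only: of_nat_le_0_iff)
  qed
  interpret accesses N m cs by standard (rule m0)
  define nr where "nr = (\<lambda>i. near n B b (i div B) (k - 1))"
  \<comment> \<open>Up to n / 20 items are not tested and fewer than n / 20 of the tested ones may
    be near, so at least 9 / 10 of all items are far.\<close>
  define n' where "n' = n - n div 20"
  define bad where "bad = {p \<in> ?perms. n div 20 \<le> card {i. i < n' \<and> p ! i \<in> nr i}}"
  have bad: "real (card bad) * z ^ (n div 20) \<le> fact n * 2 ^ n"
  proof -
    have "real (card bad) * z ^ (n div 20) \<le> fact n * 2 ^ n'"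
      unfolding bad_def
    proof (rule card_permutations_hitting)
      show "n' \<le> n" by (simp add: n'_def)
      show "z * real (B * (2 * m + 3) ^ (2 * (k - 1))) \<le> real (n - n')"
        using z(2) by (simp add: n'_def m_def)
      fix i assume "i < n'"
      then have "i div B < N" using blk by (simp add: n'_def)
      from card_near[OF _ this, of B n b "k - 1"] B
      show "finite (nr i) \<and> real (card (nr i)) \<le> real (B * (2 * m + 3) ^ (2 * (k - 1)))"
        unfolding nr_def of_nat_le_iff by simp
    qed (rule z)
    also have "\<dots> \<le> fact n * 2 ^ n" by (intro mult_left_mono power_increasing) (auto simp: n'_def)
    finally show ?thesis .
  qed
  define S where "S = (\<lambda>p. {y. (p, y) \<in> G'})"
  have Ssub: "S p \<subseteq> strings n q" for p by (auto simp: S_def G'_def G_def)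
  have cS: "card (S p) \<le> q ^ n" for p using card_mono[OF _ Ssub[of p]] by (simp add: card_strings)
  \<comment> \<open>Otherwise permutations outside \<open>bad\<close> supply at most half of the
    \<open>fact n * q ^ n / (2 * P)\<close> pairs that \<open>G'\<close> has at least, and
    \<open>bad\<close> is too small to supply the other half.\<close>
  have "\<exists>p\<in>?perms - bad. real (q ^ n) \<le> 4 * real P * real (card (S p))"
  proof (rule ccontr)
    assume *: "\<not> ?thesis"
    have "G' = (SIGMA p : ?perms. S p)" by (auto simp: S_def G'_def G_def)
    moreover have "finite (S p)" for p using Ssub[of p] by (rule finite_subset) simp
    ultimately have "card G' = (\<Sum>p\<in>?perms. card (S p))" by simp
    then have "real (card G') = (\<Sum>p\<in>?perms. real (card (S p)))" by simp
    also have "\<dots> \<le> (\<Sum>p\<in>?perms. (if p \<in> bad then real (q ^ n) else 0) + real (q ^ n) / (4 * real P))"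
    proof (rule sum_mono)
      fix p assume p: "p \<in> ?perms"
      show "real (card (S p)) \<le> (if p \<in> bad then real (q ^ n) else 0) + real (q ^ n) / (4 * real P)"
      proof (cases "p \<in> bad")
        case True
        have "real (card (S p)) \<le> real (q ^ n)" using cS by (simp only: of_nat_le_iff)
        moreover have "0 \<le> real (q ^ n) / (4 * real P)" using P0 by simp
        ultimately show ?thesis using True by (simp only: if_True)
      next
        case False
        then have "4 * real P * real (card (S p)) < real (q ^ n)" using * p not_le by blast
        then show ?thesis using False P0 by (simp add: field_simps)
      qed
    qed
    also have "\<dots> = real (card bad) * real (q ^ n) + fact n * (real (q ^ n) / (4 * real P))"
    proof -
      have "?perms \<inter> bad = bad" by (auto simp: bad_def)
      then show ?thesis by (simp add: sum.distrib sum.If_cases Int_def)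
    qed
    finally have "2 * real P * real (card G') \<le>
        2 * real P * (real (card bad) * real (q ^ n) + fact n * (real (q ^ n) / (4 * real P)))"
      using P0 by (intro mult_left_mono) auto
    also have "\<dots> = 2 * real P * real (card bad) * real (q ^ n) + fact n * real (q ^ n) / 2"
      using P0 by (simp add: field_simps)
    finally have "fact n * real (q ^ n) \<le> 2 * real P * real (card bad) * real (q ^ n) + fact n * real (q ^ n) / 2"
      using cG' by simp
    then have "fact n * real (q ^ n) \<le> 4 * real P * real (card bad) * real (q ^ n)" by simp
    then have "fact n \<le> 4 * real P * real (card bad)"
      using q2 by (subst (asm) mult_le_cancel_right_pos) auto
    then have "fact n * z ^ (n div 20) \<le> 4 * real P * (real (card bad) * z ^ (n div 20))"
      using z(1) mult_right_mono[of "fact n" "4 * real P * real (card bad)" "z ^ (n div 20)"] by (simp add: mult.assoc)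
    also have "\<dots> \<le> 4 * real P * (fact n * 2 ^ n)" using bad P0 by (intro mult_left_mono) auto
    also have "\<dots> = fact n * (4 * real P * 2 ^ n)" by simp
    also have "\<dots> < fact n * z ^ (n div 20)" using zP by (intro mult_strict_left_mono) auto
    finally show False by simp
  qed
  then obtain p where p: "p \<in> ?perms" "p \<notin> bad" and Sp: "real (q ^ n) \<le> 4 * real P * real (card (S p))" by auto
  \<comment> \<open>The corrections then take 3 * \<epsilon> = 1 / 20 of the bits, and \<epsilon>^2
    / 2 = 1 / 7200 is the constant in \<open>lP\<close>.\<close>
  define \<epsilon> :: real where "\<epsilon> = 1 / 60"
  have dense: "real q powr (real n * (1 - \<epsilon>\<^sup>2 / 2)) \<le> real (card (S p))"
  proof -
    have "real q powr (real n * (1 - \<epsilon>\<^sup>2 / 2)) = 2 powr (real l * real n - real l * real n / 7200)"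
      by (simp add: q_def powr_realpow[symmetric] powr_powr \<epsilon>_def power2_eq_square algebra_simps)
    also have "\<dots> = real (q ^ n) / 2 powr (real l * real n / 7200)"
    proof -
      have "2 powr (real l * real n) = 2 powr real (l * n)" by simp
      also have "\<dots> = 2 ^ (l * n)" by (rule powr_realpow) simp
      also have "\<dots> = real (q ^ n)" by (simp add: q_def power_mult)
      finally show ?thesis by (subst powr_diff) (simp only:)
    qed
    also have "\<dots> \<le> real (q ^ n) / (4 * real P)"
      using lP P0 by (intro divide_left_mono) auto
    also have "\<dots> \<le> real (card (S p))" using Sp P0 by (simp add: field_simps)
    finally show ?thesis .
  qed
  have eps: "0 < \<epsilon>" "\<epsilon> < 1" by (simp_all add: \<epsilon>_def)
  from exists_covering[OF n q2 eps Ssub dense] obtain L V c where L: "L > 0"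
    and V: "\<forall>i<n. V i \<subseteq> {..<q ^ L} \<and> 0 < c i \<and> real (card (V i)) \<le> 2 powr c i"
    and c: "(\<Sum>i<n. c i) \<le> 3 * \<epsilon> * real n * log 2 (real (q ^ L))"
    and cover: "\<forall>as. length as = n \<and> set as \<subseteq> {..<q ^ L} \<longrightarrow>
      (\<exists>y d. y \<in> string_power q L n (S p) \<and> (\<forall>i<n. d i \<in> V i \<and> y ! i = (as ! i + d i) mod q ^ L))"
    by blast
  have "\<exists>y d. y \<in> string_power q L n (S p) \<and> (\<forall>i<n. d i \<in> V i \<and> y ! i = (a i + d i) mod q ^ L)"
    if a: "a \<in> {..<n} \<rightarrow>\<^sub>E {..<q ^ L}" for a
  proof -
    have "length (map a [0..<n]) = n \<and> set (map a [0..<n]) \<subseteq> {..<q ^ L}" using PiE_mem[OF a] by auto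
    from cover[rule_format, OF this] show ?thesis by auto
  qed
  then obtain Y d where Y: "\<And>a. a \<in> {..<n} \<rightarrow>\<^sub>E {..<q ^ L} \<Longrightarrow> Y a \<in> string_power q L n (S p)"
    and Yd: "\<And>a i. a \<in> {..<n} \<rightarrow>\<^sub>E {..<q ^ L} \<Longrightarrow> i < n \<Longrightarrow> d a i \<in> V i \<and> Y a ! i = (a i + d a i) mod q ^ L"
    by metis
  have slice: "keyed n q p (map (digit q l') (Y a)) = map (\<lambda>i. p ! i * q + digit q l' (Y a ! i)) [0..<n]"
    "map (digit q l') (Y a) \<in> S p"
    if "a \<in> {..<n} \<rightarrow>\<^sub>E {..<q ^ L}" "l' < L" for a l'
    using Y[OF that(1)] that(2) by (auto simp: string_power_def keyed_def length_strings)
  interpret coded_sort N m cs n w M B b L q D p V c "\<lambda>a i. Y a ! i" d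
  proof
    fix a l' assume a: "a \<in> {..<n} \<rightarrow>\<^sub>E {..<q ^ L}" and l': "l' < L"
    have *: "(p, map (digit q l') (Y a)) \<in> G'" using slice(2)[OF a l'] by (simp add: S_def)
    have "map (digit q l') (Y a) \<in> strings n q" using slice(2)[OF a l'] Ssub by auto
    from keyed_inputs[OF p(1) this] w slice(1)[OF a l']
    show "map (\<lambda>i. p ! i * q + digit q l' (Y a ! i)) [0..<n] \<in> inputs n w" by (simp add: q_def)
    show "sim_sorts M B D N b cs (map (\<lambda>i. p ! i * q + digit q l' (Y a ! i)) [0..<n])"
      using * slice(1)[OF a l'] by (simp add: G'_def)
  qed (use B m_def n nNB w0 q2 L D p(1) V Yd in auto)
  define F where "F = {i. i < n \<and> p ! i \<notin> near n B b (i div B) (k - 1)}"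
  have lQ: "log 2 (real Q) = real L * real l"
    unfolding Q_def by (simp add: q_def log_nat_power)
  have lQ0: "0 < real L * real l" using L l by simp
  have F: "real (card F) \<ge> 9 / 10 * real n"
  proof -
    have "{..<n} \<subseteq> F \<union> {i. i < n' \<and> p ! i \<in> nr i} \<union> {n'..<n}"
      by (auto simp: F_def nr_def)
    then have "card {..<n} \<le> card (F \<union> {i. i < n' \<and> p ! i \<in> nr i} \<union> {n'..<n})"
      by (intro card_mono) (auto simp: F_def)
    also have "\<dots> \<le> card F + card {i. i < n' \<and> p ! i \<in> nr i} + card {n'..<n}"
      by (intro order.trans[OF card_Un_le] add_mono card_Un_le order.refl)
    also have "card {i. i < n' \<and> p ! i \<in> nr i} \<le> n div 20" using p by (auto simp: bad_def)
    also have "card {n'..<n} = n div 20" by (simp add: n'_def)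
    finally have "real n \<le> real (card F) + 2 * real (n div 20)" by simp
    moreover have "real (n div 20) \<le> real n / 20"
      using div_times_less_eq_dividend[of n 20] by linarith
    ultimately show ?thesis by linarith
  qed
  \<comment> \<open>Rate 19 / 20 for 9 / 10 of the items requires 171 / 200, of which the hub can
    take (1 + 2 / 20) / 2 = 110 / 200. The remaining 61 / 200 have to pass through the core.\<close>
  have "19 / 20 * (real L * real l) * (real k * real (card F)) \<le>
      3 * real L * real w * real B * real (length cs) + real k / 2 * (real n * log 2 (real Q) + 2 * (\<Sum>i<n. c i))"
    by (rule far_items_bound[OF conj]) (use lQ lQ0 in \<open>auto simp: F_def\<close>)
  also have "\<dots> \<le> 3 * real L * real w * real B * real \<tau> + real k / 2 * (real n * (real L * real l) + 2 * (1 / 20 * real n * (real L * real l)))"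
  proof (intro add_mono mult_left_mono)
    show "(\<Sum>i<n. c i) \<le> 1 / 20 * real n * (real L * real l)"
      using c lQ by (simp add: \<epsilon>_def Q_def)
    show "real (length cs) \<le> real \<tau>" using bcs by (auto simp: T_def)
  qed (use lQ in auto)
  finally have 1: "19 / 20 * (real L * real l) * (real k * real (card F)) \<le>
    3 * real L * real w * real B * real \<tau> + 11 / 20 * (real k * real n * (real L * real l))" by (simp add: field_simps)
  have "19 / 20 * (real L * real l) * (real k * (9 / 10 * real n)) \<le> 19 / 20 * (real L * real l) * (real k * real (card F))"
    using F by (intro mult_left_mono) auto
  then have "(171 / 200) * (real k * real n * (real L * real l)) \<le> 19 / 20 * (real L * real l) * (real k * real (card F))"
    by (simp add: field_simps)
  then have "61 / 200 * (real k * real n * (real L * real l)) \<le> 3 * real L * real w * real B * real \<tau>"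
    using 1 by linarith
  then have "real L * (61 / 200 * (real k * real n * real l)) \<le> real L * (3 * real w * real B * real \<tau>)"
    by (simp add: mult_ac)
  then have "61 / 200 * (real k * real n * real l) \<le> 3 * real w * real B * real \<tau>"
    using L by (subst (asm) mult_le_cancel_left_pos) auto
  moreover have "0 \<le> real k * real n * real l" by simp
  ultimately show ?thesis by linarith
qed

section \<open>The lower bound\<close>

lemma log2_le_sqrt:
  assumes "x \<ge> (1 :: real)"
  shows "log 2 x \<le> 3 * sqrt x"
proof -
  have "ln x = 2 * ln (sqrt x)" using assms by (simp add: ln_sqrt)
  also have "\<dots> \<le> 2 * sqrt x" using ln_le_minus_one[of "sqrt x"] assms by simp
  also have "\<dots> \<le> 3 * sqrt x * ln 2"
    using mult_left_mono[OF ln2_ge_two_thirds, of "3 * sqrt x"] assms by simp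
  finally show ?thesis by (simp add: log_def divide_le_eq)
qed

text \<open>The factor 4, the choice of \<open>b\<close> and each of the \<tau> addresses are all
  bounded by n^2, hence \<tau> + 2 factors.\<close>

lemma pattern_count:
  assumes n: "n \<ge> 5" and \<tau>: "\<tau> \<le> n"
  shows "4 * real ((n div B + 2) * (2 * (n div B + 1) + \<tau> + 1) ^ \<tau>)
    \<le> 2 powr (2 * (real \<tau> + 2) * log 2 (real n))"
proof -
  have d: "n div B \<le> n" by simp
  have n5: "5 * n \<le> n\<^sup>2" using n by (simp add: power2_eq_square)
  have "(n div B + 2) * (2 * (n div B + 1) + \<tau> + 1) ^ \<tau> \<le> n\<^sup>2 * (n\<^sup>2) ^ \<tau>"
  proof (intro mult_mono power_mono)
    define e where "e = n div B"
    have "e \<le> n" using d by (simp add: e_def)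
    then have "e + 2 \<le> 5 * n" "2 * (e + 1) + \<tau> + 1 \<le> 5 * n" using n \<tau> by simp_all
    then have "e + 2 \<le> n\<^sup>2" "2 * (e + 1) + \<tau> + 1 \<le> n\<^sup>2" using n5 by (blast intro: order.trans)+
    then show "n div B + 2 \<le> n\<^sup>2" "2 * (n div B + 1) + \<tau> + 1 \<le> n\<^sup>2" by (simp_all only: e_def)
  qed auto
  note P = this
  have "4 \<le> n\<^sup>2" using n5 n by linarith
  then have "4 * ((n div B + 2) * (2 * (n div B + 1) + \<tau> + 1) ^ \<tau>) \<le> n\<^sup>2 * (n\<^sup>2 * (n\<^sup>2) ^ \<tau>)"
    by (rule mult_le_mono[OF _ P])
  also have "\<dots> = n ^ (2 * (\<tau> + 2))" by (simp only: power_mult add_2_eq_Suc' power_Suc)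
  finally have "real (4 * ((n div B + 2) * (2 * (n div B + 1) + \<tau> + 1) ^ \<tau>)) \<le> real (n ^ (2 * (\<tau> + 2)))"
    by (simp only: of_nat_le_iff)
  also have "\<dots> = real n powr real (2 * (\<tau> + 2))"
    by (subst powr_realpow) (use n in simp_all)
  also have "\<dots> = (2 powr log 2 (real n)) powr real (2 * (\<tau> + 2))" using n by simp
  also have "\<dots> = 2 powr (2 * (real \<tau> + 2) * log 2 (real n))"
    unfolding powr_powr by (simp add: algebra_simps)
  finally show ?thesis by simp
qed

text \<open>
  The access patterns are fewer than the permutations that avoid the near positions: for
  \<open>B \<le> sqrt n\<close> because \<open>\<tau>\<close> is small compared to \<open>n\<close> and \<open>log (n / B)\<close> is of order \<open>log n\<close>, otherwise
  because \<open>\<tau>\<close> is small compared to \<open>sqrt n * log (n / B)\<close>.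
\<close>

lemma steps_times_log_le:
  fixes n \<tau> B \<kappa> :: real
  assumes n: "n \<ge> 1" and B: "B \<ge> 1" and x: "log 2 (n / B) \<ge> 1"
    and \<kappa>: "0 < \<kappa>" "\<kappa> \<le> 1 / 23040"
    and \<tau>: "0 \<le> \<tau>" "\<tau> \<le> 6 * \<kappa> * n" "\<tau> \<le> 6 * \<kappa> * (n / B * log 2 (n / B))"
  shows "\<tau> * log 2 n \<le> n * log 2 (n / B) / 1280"
proof -
  define lx where "lx = log 2 (n / B)"
  have ln0: "log 2 n \<ge> 0" using n by simp
  have sq: "sqrt n * sqrt n = n" using n by simp
  have "\<tau> * log 2 n \<le> 18 * \<kappa> * (n * lx)"
  proof (cases "n / B \<ge> sqrt n")
    case True
    have "log 2 (sqrt n) \<le> lx" unfolding lx_def using True n B by (subst log_le_cancel_iff) auto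
    then have "log 2 n \<le> 2 * lx" using n by (simp add: log_def ln_sqrt field_simps)
    then have "\<tau> * log 2 n \<le> (6 * \<kappa> * n) * (2 * lx)" using \<tau> ln0 \<kappa> n by (intro mult_mono) auto
    also have "\<dots> \<le> 18 * \<kappa> * (n * lx)" using \<kappa> n x by (simp add: lx_def)
    finally show ?thesis .
  next
    case False
    have "\<tau> * log 2 n \<le> (6 * \<kappa> * (sqrt n * lx)) * (3 * sqrt n)"
    proof (rule mult_mono)
      have "n / B * lx \<le> sqrt n * lx" using False x by (intro mult_right_mono) (auto simp: lx_def)
      then have "6 * \<kappa> * (n / B * lx) \<le> 6 * \<kappa> * (sqrt n * lx)" using \<kappa> by (intro mult_left_mono) auto
      then show "\<tau> \<le> 6 * \<kappa> * (sqrt n * lx)" using \<tau>(3) by (simp add: lx_def)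
      show "log 2 n \<le> 3 * sqrt n" by (rule log2_le_sqrt[OF n])
      show "0 \<le> 6 * \<kappa> * (sqrt n * lx)" using \<kappa> n x by (simp add: lx_def)
    qed (rule ln0)
    also have "\<dots> = 18 * \<kappa> * ((sqrt n * sqrt n) * lx)" by (simp only: mult_ac)
    finally show ?thesis unfolding sq .
  qed
  also have "\<dots> \<le> 18 * (1 / 23040) * (n * lx)"
    using \<kappa> n x by (intro mult_right_mono) (auto simp: lx_def)
  finally show ?thesis by (simp add: lx_def)
qed

text \<open>The logarithm of the right-hand side is at least \<open>n / 40 * (log 2 x / 4)\<close>.
  That of the left-hand side consists of 2 * \<tau> * log n, of 4 * log n, which is at most n for n
  \<ge> 144, and of n; each is at most \<open>n * log 2 x / 640\<close>, and three of them are fewer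
  than the four on the right.\<close>

lemma far_permutation_count:
  fixes x :: real
  assumes n: "n \<ge> 144" and lx: "log 2 x \<ge> 640" and x: "x > 0"
    and \<tau>: "real \<tau> * log 2 (real n) \<le> real n * log 2 x / 1280"
    and P: "4 * real P \<le> 2 powr (2 * (real \<tau> + 2) * log 2 (real n))"
  shows "4 * real P * 2 ^ n < (sqrt x / 40) ^ (n div 20)"
proof -
  define z where "z = sqrt x / 40"
  have z0: "z > 0" using x by (simp add: z_def)
  have "log 2 40 \<le> log 2 (2 ^ 6 :: real)" by (subst log_le_cancel_iff) auto
  then have l40: "log 2 40 \<le> (6 :: real)" by (subst (asm) log_pow_cancel) simp_all
  have "log 2 z = log 2 (sqrt x) - log 2 40" using x by (simp add: z_def log_divide)
  also have "log 2 (sqrt x) = log 2 x / 2" using x by (simp add: log_def ln_sqrt)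
  finally have "log 2 z = log 2 x / 2 - log 2 40" .
  then have lz: "log 2 z \<ge> log 2 x / 4" using l40 lx by linarith
  have nd: "real (n div 20) \<ge> real n / 40"
  proof -
    have "n < 20 + n div 20 * 20" by (rule dividend_less_div_times) simp
    then have "real n < 20 + 20 * real (n div 20)" by linarith
    then show ?thesis using n by linarith
  qed
  have ln: "4 * log 2 (real n) \<le> real n"
  proof -
    have "12 \<le> sqrt (real n)" using n by (intro real_le_rsqrt) (simp add: power2_eq_square)
    then have "12 * sqrt (real n) \<le> sqrt (real n) * sqrt (real n)" by (intro mult_right_mono) auto
    then show ?thesis using log2_le_sqrt[of "real n"] n by simp
  qed
  have "real n * 640 \<le> real n * log 2 x" using lx by (intro mult_left_mono) auto
  moreover have "real n > 0" using n by simp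
  moreover have "2 * (real \<tau> + 2) * log 2 (real n) = 2 * (real \<tau> * log 2 (real n)) + 4 * log 2 (real n)"
    by (simp add: algebra_simps)
  ultimately have "2 * (real \<tau> + 2) * log 2 (real n) + real n < real n * log 2 x / 160"
    using \<tau> ln by linarith
  also have "\<dots> = real n / 40 * (log 2 x / 4)" by simp
  also have "\<dots> \<le> real (n div 20) * log 2 z"
    using nd lz lx by (intro mult_mono) auto
  finally have less: "2 * (real \<tau> + 2) * log 2 (real n) + real n < real (n div 20) * log 2 z" .
  have "4 * real P * 2 ^ n \<le> 2 powr (2 * (real \<tau> + 2) * log 2 (real n)) * 2 powr real n"
    using P by (simp add: powr_realpow)
  also have "\<dots> = 2 powr (2 * (real \<tau> + 2) * log 2 (real n) + real n)" by (simp add: powr_add)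
  also have "\<dots> < 2 powr (real (n div 20) * log 2 z)" using less by simp
  also have "\<dots> = (2 powr log 2 z) powr real (n div 20)" by (simp add: powr_powr mult.commute)
  also have "\<dots> = z ^ (n div 20)" using z0 by (simp add: powr_realpow)
  finally show ?thesis by (simp add: z_def)
qed

text \<open>The growth rate of the balls is replaced by the base 2 * M / B of the bound. As this
  base is at least 2, even for M = B, its cube dominates the additive constant.\<close>

lemma branching_le:
  assumes "1 \<le> B" "B \<le> M"
  shows "log 2 (real (2 * (M div B) + 3)) \<le> 3 * log 2 (2 * real M / real B)"
proof -
  define y where "y = 2 * real M / real B"
  have y2: "y \<ge> 2" using assms by (simp add: y_def field_simps)
  have "real (M div B) \<le> real M / real B" by (rule of_nat_div_le_of_nat)
  then have "real (2 * (M div B) + 3) \<le> y + 3" by (simp add: y_def)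
  also have "\<dots> \<le> y ^ 3"
  proof -
    have "2 * 2 * y \<le> y * y * y" using y2 by (intro mult_right_mono mult_mono) auto
    then show ?thesis using y2 unfolding power3_eq_cube by linarith
  qed
  finally have "log 2 (real (2 * (M div B) + 3)) \<le> log 2 (y ^ 3)"
    using y2 by (subst log_le_cancel_iff) auto
  also have "\<dots> = 3 * log 2 y" using y2 by (simp add: log_nat_power)
  finally show ?thesis by (simp add: y_def)
qed

text \<open>\<open>k - 1\<close> is \<open>log 2 x / (4 * log 2 \<Delta>)\<close> rounded down.
  Aiming at \<open>sqrt x\<close> instead of \<open>x\<close> leaves a factor of order
  \<open>sqrt x\<close> for the weight z of a hit.\<close>

lemma exists_radius:
  fixes x \<Delta> :: real
  assumes x: "x \<ge> 1" and \<Delta>: "\<Delta> \<ge> 2"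
  shows "\<exists>k\<ge>1. \<Delta> ^ (2 * (k - 1)) \<le> sqrt x \<and> log 2 x \<le> 4 * real k * log 2 \<Delta>"
proof -
  define y where "y = log 2 x / (4 * log 2 \<Delta>)"
  have l\<Delta>: "log 2 \<Delta> > 0" using \<Delta> by simp
  have y0: "y \<ge> 0" using x l\<Delta> by (simp add: y_def)
  define e where "e = nat \<lfloor>y\<rfloor>"
  have e: "real e \<le> y" "y \<le> real (e + 1)" using y0 by (auto simp: e_def) linarith
  have "\<Delta> ^ (2 * e) = (2 powr log 2 \<Delta>) powr real (2 * e)"
    using \<Delta> by (simp add: powr_realpow del: of_nat_mult)
  also have "\<dots> = 2 powr (2 * real e * log 2 \<Delta>)" by (simp only: powr_powr) (simp add: mult_ac)
  also have "\<dots> \<le> 2 powr (log 2 x / 2)"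
  proof -
    have "real e * (4 * log 2 \<Delta>) \<le> log 2 x" using e(1) l\<Delta> by (simp add: y_def pos_le_divide_eq)
    then show ?thesis by simp
  qed
  also have "\<dots> = (2 powr log 2 x) powr (1 / 2)" by (simp only: powr_powr) simp
  also have "\<dots> = sqrt x" using x by (simp add: powr_half_sqrt)
  finally have "\<Delta> ^ (2 * e) \<le> sqrt x" .
  moreover have "log 2 x \<le> 4 * real (e + 1) * log 2 \<Delta>"
    using e(2) l\<Delta> by (simp add: y_def pos_divide_le_eq algebra_simps)
  ultimately show ?thesis by (intro exI[of _ "e + 1"]) auto
qed

lemma log2_two_power_ge: "n \<ge> 1 \<Longrightarrow> real n \<le> 2 ^ nat \<lceil>log 2 (real n)\<rceil>"
proof -
  assume n: "n \<ge> 1"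
  define k where "k = nat \<lceil>log 2 (real n)\<rceil>"
  have "log 2 (real n) \<le> real k" unfolding k_def by (rule real_nat_ceiling_ge)
  then have "2 powr log 2 (real n) \<le> 2 powr real k" by simp
  also have "\<dots> = 2 ^ k" by (rule powr_realpow) simp
  finally show ?thesis using n by (simp add: k_def)
qed

theorem theorem1:
  assumes "undirected_k_pairs_conjecture"
  shows "\<forall>C::real. C > 1 \<longrightarrow> (\<exists>\<kappa>::real. \<kappa> > 0 \<and> (\<exists>n0::nat. \<forall>n\<ge>n0. \<forall>(w::nat) (M::nat) (B::nat) (R::rand_alg).
           real w \<ge> C * log 2 (real n) \<and> 1 \<le> B \<and> B \<le> M \<and>
           em_algorithm w M B R \<and> (\<forall>xs\<in>inputs n w. error_prob M B R xs \<le> 1 / 3) \<longrightarrow>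
           (\<exists>xs\<in>inputs n w. expected_ios M B R xs \<ge>
              ennreal (\<kappa> * min (real n)
                (real n / real B * log (2 * real M / real B) (real n / real B))))))"
proof (intro allI impI)
  fix C :: real assume C: "C > 1"
  \<comment> \<open>w / C = (1 - 2 * \<eta>) * w, so about 2 * \<eta> * w bits remain beside the
    rank; half of them absorb the rounding of log n, whence l \<ge> \<eta> * w.\<close>
  define \<eta> where "\<eta> = (C - 1) / (2 * C)"
  have \<eta>: "\<eta> > 0" "\<eta> * C > 0" using C by (auto simp: \<eta>_def)
  \<comment> \<open>for \<open>n / B < X1\<close> the bound is at most \<open>1 / 6\<close>, and it suffices that no algorithm sorts without I/Os\<close>
  define X1 :: real where "X1 = 2 powr 640"
  have X1: "X1 > 0" "log 2 X1 = 640"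
    unfolding X1_def by (rule powr_gt_zero[THEN iffD2], simp) (rule log_powr_cancel, simp_all)
  \<comment> \<open>In order: 18 / 23040 = 1 / 1280 for counting permutations; 12 / 172800 = 1 /
    14400, half of the density budget 1 / 7200; 864 < 900 for the final contradiction; 6 * 640 /
    3840 = 1 for small n / B.\<close>
  define \<kappa> where "\<kappa> = Min {1 / 23040, \<eta> * C / 172800, \<eta> / 900, 1 / (3840 * X1)}"
  have \<kappa>0: "\<kappa> > 0" using \<eta> X1 by (simp add: \<kappa>_def)
  have \<kappa>: "\<kappa> \<le> 1 / 23040" "\<kappa> \<le> \<eta> * C / 172800" "\<kappa> \<le> \<eta> / 900" "\<kappa> \<le> 1 / (3840 * X1)"
    unfolding \<kappa>_def by (auto intro: Min_le)
  \<comment> \<open>144 is for the permutation count, 57600 = 4 * 14400 for the other half of the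
    density budget, and the last term ensures \<eta> * C * log n \<ge> 1.\<close>
  define n0 where "n0 = 144 + nat \<lceil>57600 / (\<eta> * C)\<rceil> + nat \<lceil>2 powr (1 / (\<eta> * C))\<rceil>"
  show "\<exists>\<kappa>::real. \<kappa> > 0 \<and> (\<exists>n0::nat. \<forall>n\<ge>n0. \<forall>(w::nat) (M::nat) (B::nat) (R::rand_alg).
           real w \<ge> C * log 2 (real n) \<and> 1 \<le> B \<and> B \<le> M \<and>
           em_algorithm w M B R \<and> (\<forall>xs\<in>inputs n w. error_prob M B R xs \<le> 1 / 3) \<longrightarrow>
           (\<exists>xs\<in>inputs n w. expected_ios M B R xs \<ge>
              ennreal (\<kappa> * min (real n)
                (real n / real B * log (2 * real M / real B) (real n / real B)))))"
  proof (intro exI[of _ \<kappa>] exI[of _ n0] conjI allI impI \<kappa>0, elim conjE)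
    fix n w M B :: nat and R :: rand_alg
    assume "n0 \<le> n" and w: "C * log 2 (real n) \<le> real w" and B: "1 \<le> B" "B \<le> M"
      and R: "em_algorithm w M B R" and err: "\<forall>xs\<in>inputs n w. error_prob M B R xs \<le> 1 / 3"
    have n: "n \<ge> 144" and n1: "real n \<ge> 57600 / (\<eta> * C)" and n2: "real n \<ge> 2 powr (1 / (\<eta> * C))"
      using \<open>n0 \<le> n\<close> unfolding n0_def by linarith+
    define x where "x = real n / real B"
    define lb where "lb = log 2 (2 * real M / real B)"
    define T where "T = \<kappa> * min (real n) (x * log (2 * real M / real B) x)"
    show "\<exists>xs\<in>inputs n w. expected_ios M B R xs \<ge>
              ennreal (\<kappa> * min (real n)
                (real n / real B * log (2 * real M / real B) (real n / real B)))"
    proof (rule ccontr)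
      assume "\<not> ?thesis"
      then have ios: "expected_ios M B R xs < ennreal T" if "xs \<in> inputs n w" for xs
        using that unfolding T_def x_def by (auto simp: not_le)
      have err: "error_prob M B R xs \<le> 1 / 3" if "xs \<in> inputs n w" for xs using err that by simp
      have lgn: "log 2 (real n) > 0" using n by simp
      have wn: "log 2 (real n) \<le> real w"
      proof -
        have "1 * log 2 (real n) \<le> C * log 2 (real n)" using C lgn by (intro mult_right_mono) auto
        then show ?thesis using w by simp
      qed
      define k0 where "k0 = nat \<lceil>log 2 (real n)\<rceil>"
      have k0w: "k0 \<le> w" using wn by (simp add: k0_def ceiling_le_iff)
      have nk0: "n \<le> 2 ^ k0"
      proof -
        have "real n \<le> real (2 ^ k0)" using log2_two_power_ge[of n] n by (simp add: k0_def)
        then show ?thesis by (simp only: of_nat_le_iff)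
      qed
      have revin: "rev [0..<n] \<in> inputs n w"
      proof -
        have "n \<le> 2 ^ w" by (rule le_trans[OF nk0 power_increasing[OF k0w]]) simp
        then show ?thesis by (auto simp: inputs_def)
      qed
      \<comment> \<open>\<open>ennreal\<close> sends nonpositive reals to 0, and no expected cost is
        less than 0. So the assumed algorithm already excludes the degenerate case x \<le>
        1.\<close>
      have T0: "T > 0"
      proof (rule ccontr)
        assume "\<not> T > 0"
        then show False using ios[OF revin] by (simp add: ennreal_neg)
      qed
      have x0: "x > 0" using n B by (simp add: x_def)
      have y2: "2 * real M / real B \<ge> 2" using B by (simp add: field_simps)
      have lb1: "lb \<ge> 1"
      proof -
        have "log 2 2 \<le> lb" unfolding lb_def using y2 by (subst log_le_cancel_iff) auto
        then show ?thesis by simp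
      qed
      have lbx: "log (2 * real M / real B) x = log 2 x / lb"
        unfolding lb_def using y2 by (intro log_base_change) auto
      have Tn: "T \<le> \<kappa> * real n" unfolding T_def using \<kappa>0 by (intro mult_left_mono) auto
      have Tx: "T \<le> \<kappa> * (x * (log 2 x / lb))" unfolding T_def lbx using \<kappa>0 by (intro mult_left_mono) auto
      have lx0: "log 2 x > 0"
      proof (rule ccontr)
        assume "\<not> log 2 x > 0"
        then have "x * (log 2 x / lb) \<le> 0" using x0 lb1
          by (intro mult_nonneg_nonpos divide_nonpos_pos) auto
        then have "\<kappa> * (x * (log 2 x / lb)) \<le> 0" by (rule mult_nonneg_nonpos[rotated]) (use \<kappa>0 in simp)
        then show False using Tx T0 by linarith
      qed
      have "log 2 x / lb \<le> log 2 x" using lb1 lx0 by (simp add: divide_le_eq)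
      then have Tx': "T \<le> \<kappa> * (x * log 2 x)"
        using Tx \<kappa>0 x0 by (meson less_imp_le mult_left_mono order_trans)
      show False
      proof (cases "x < X1")
        case True
        have xl: "x * log 2 x \<le> X1 * 640"
        proof (rule mult_mono)
          have "log 2 x \<le> log 2 X1" using True x0 by (subst log_le_cancel_iff) auto
          then show "log 2 x \<le> 640" by (simp add: X1(2))
        qed (use True x0 lx0 X1 in auto)
        have "\<kappa> * (x * log 2 x) \<le> 1 / (3840 * X1) * (X1 * 640)"
          by (rule mult_mono[OF \<kappa>(4) xl]) (use x0 lx0 X1 in auto)
        then have T6: "6 * T \<le> real 0 + 1" using Tx' X1 by (simp add: field_simps)
        have "measure coins {\<omega> \<in> space coins. sorts_within M B (R \<omega>) (rev [0..<n]) 0} \<ge> 1 / 2"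
          by (rule good_coins_prob[OF R revin err[OF revin] _ _ T6]) (use ios[OF revin] T0 in auto)
        then show False using not_sorted_without_ios[of n B M] n B by simp
      next
        case False
        have lx: "log 2 x \<ge> 640"
        proof -
          have "log 2 X1 \<le> log 2 x" using False X1(1) by (subst log_le_cancel_iff) auto
          then show ?thesis by (simp add: X1(2))
        qed
        have x1: "x \<ge> 1600"
        proof -
          have "(1600 :: real) \<le> 2 powr 11" by simp
          also have "\<dots> \<le> X1" unfolding X1_def by (rule powr_mono) auto
          finally show ?thesis using False by simp
        qed
        define \<tau> where "\<tau> = nat \<lfloor>6 * T\<rfloor>"
        have \<tau>: "real \<tau> \<le> 6 * T" "6 * T \<le> real \<tau> + 1" using T0 by (simp_all add: \<tau>_def)
        have \<tau>n: "real \<tau> \<le> 6 * \<kappa> * real n" and \<tau>x: "real \<tau> \<le> 6 * \<kappa> * (x * log 2 x)"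
          and \<tau>lb: "real \<tau> \<le> 6 * \<kappa> * (x * (log 2 x / lb))"
          using \<tau>(1) Tn Tx' Tx by linarith+
        define l where "l = w - k0"
        have nl: "n * 2 ^ l \<le> 2 ^ w"
        proof -
          have "n * 2 ^ l \<le> 2 ^ k0 * 2 ^ l" using nk0 by (rule mult_right_mono) simp
          then show ?thesis using k0w by (simp add: l_def flip: power_add)
        qed
        have \<eta>w: "\<eta> * real w \<ge> \<eta> * C * log 2 (real n)"
          using mult_left_mono[OF w, of \<eta>] \<eta> by (simp add: mult.assoc)
        have \<eta>1: "\<eta> * C * log 2 (real n) \<ge> 1"
        proof -
          have "log 2 (2 powr (1 / (\<eta> * C))) \<le> log 2 (real n)" using n2 n by (subst log_le_cancel_iff) auto
          then have "1 / (\<eta> * C) \<le> log 2 (real n)" by simp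
          then show ?thesis using \<eta>(2) by (simp add: divide_le_eq mult.commute)
        qed
        have l\<eta>: "real l \<ge> \<eta> * real w"
        proof -
          have "real k0 \<le> log 2 (real n) + 1"
            using lgn ceiling_correct[of "log 2 (real n)"] by (simp add: k0_def)
          moreover have "log 2 (real n) \<le> real w / C" using w C by (simp add: le_divide_eq mult.commute)
          moreover have "real w / C = real w - 2 * (\<eta> * real w)" using C by (simp add: \<eta>_def field_simps)
          moreover have "real l = real w - real k0" using k0w by (simp add: l_def)
          ultimately show ?thesis using \<eta>w \<eta>1 by linarith
        qed
        have l1: "l \<ge> 1"
        proof -
          have "real l \<ge> 1" using l\<eta> \<eta>w \<eta>1 by linarith
          then show ?thesis by linarith
        qed
        define F where "F = (\<lambda>(p, y). keyed n (2 ^ l) p y) ` (permutations_of_set {..<n} \<times> strings n (2 ^ l))"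
        have Fin: "F \<subseteq> inputs n w" unfolding F_def using keyed_inputs nl by auto
        have ios': "expected_ios M B R xs \<le> ennreal T" if "xs \<in> inputs n w" for xs
          using ios[OF that] by simp
        obtain \<omega> where \<omega>: "card F \<le> 2 * card {xs \<in> F. sorts_within M B (R \<omega>) xs \<tau>}"
          using exists_coins[of w M B R F n T \<tau>] R Fin err ios' T0 \<tau>(2) by (auto simp: F_def)
        let ?good = "{(p, y) \<in> permutations_of_set {..<n} \<times> strings n (2 ^ l).
            sorts_within M B (R \<omega>) (keyed n (2 ^ l) p y) \<tau>}"
        have good: "fact n * 2 ^ (l * n) \<le> 2 * card ?good"
        proof -
          have "card F = fact n * 2 ^ (l * n)"
            unfolding F_def by (subst card_image[OF inj_on_keyed])
              (simp add: card_cartesian_product card_strings power_mult)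
          moreover have "{xs \<in> F. sorts_within M B (R \<omega>) xs \<tau>} =
              (\<lambda>(p, y). keyed n (2 ^ l) p y) ` ?good"
            by (auto simp: F_def)
          moreover have "card ((\<lambda>(p, y). keyed n (2 ^ l) p y) ` ?good) = card ?good"
            by (rule card_image, rule inj_on_subset[OF inj_on_keyed]) auto
          ultimately show ?thesis using \<omega> by simp
        qed
        define P where "P = (n div B + 2) * (2 * (n div B + 1) + \<tau> + 1) ^ \<tau>"
        have \<tau>n': "\<tau> \<le> n"
        proof -
          have "6 * \<kappa> * real n \<le> 1 * real n" using \<kappa>(1) by (intro mult_right_mono) auto
          then show ?thesis using \<tau>n by simp
        qed
        have P: "4 * real P \<le> 2 powr (2 * (real \<tau> + 2) * log 2 (real n))"
          unfolding P_def by (rule pattern_count) (use n \<tau>n' in auto)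
        obtain k where k: "k \<ge> 1" "real (2 * (M div B) + 3) ^ (2 * (k - 1)) \<le> sqrt x"
          "log 2 x \<le> 4 * real k * log 2 (real (2 * (M div B) + 3))"
          using exists_radius[of x "real (2 * (M div B) + 3)"] x1 by auto
        \<comment> \<open>The divisor 40 makes z times the size of a near set at most n / 40, hence
          at most \<open>n div 20\<close>; z \<ge> 1 is the reason for requiring x \<ge>
          1600.\<close>
        define z where "z = sqrt x / 40"
        have z1: "z \<ge> 1"
        proof -
          have "40 \<le> sqrt x" using x1 by (intro real_le_rsqrt) simp
          then show ?thesis by (simp add: z_def)
        qed
        have "z * real (B * (2 * (M div B) + 3) ^ (2 * (k - 1))) \<le> z * (real B * sqrt x)"
          using k(2) z1 by (intro mult_left_mono) (simp_all add: mult_left_mono)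
        also have "\<dots> = real B * (sqrt x * sqrt x) / 40" by (simp add: z_def)
        also have "\<dots> = real n / 40" using x0 B by (simp add: x_def)
        also have "\<dots> \<le> real (n div 20)"
        proof -
          have "n < 20 + n div 20 * 20" by (rule dividend_less_div_times) simp
          then have "real n < 20 + 20 * real (n div 20)" by linarith
          then show ?thesis using n by linarith
        qed
        finally have zr: "z * real (B * (2 * (M div B) + 3) ^ (2 * (k - 1))) \<le> real (n div 20)" .
        have "real \<tau> * log 2 (real n) \<le> real n * log 2 x / 1280"
          by (rule steps_times_log_le[of "real n" "real B" \<kappa> "real \<tau>", folded x_def])
            (use n B lx \<kappa> \<kappa>0 \<tau>n \<tau>x in linarith)+
        then have zP: "4 * real P * 2 ^ n < z ^ (n div 20)"
          unfolding z_def by (intro far_permutation_count[where \<tau> = \<tau>] n lx x0 P)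
        have lP: "4 * real P \<le> 2 powr (real l * real n / 7200)"
        proof -
          have "2 * (real \<tau> + 2) \<le> \<eta> * C * real n / 7200"
          proof -
            define A where "A = \<kappa> * real n"
            define E where "E = \<eta> * C * real n"
            have "A \<le> E / 172800" using mult_right_mono[OF \<kappa>(2), of "real n"] by (simp add: A_def E_def)
            moreover have "57600 \<le> E" using n1 \<eta>(2) by (simp add: E_def divide_le_eq mult.commute)
            moreover have "real \<tau> \<le> 6 * A" using \<tau>n by (simp add: A_def mult.assoc)
            ultimately have "2 * real \<tau> + 4 \<le> E / 7200" by simp
            then have "2 * (real \<tau> + 2) \<le> E / 7200" by simp
            then show ?thesis by (simp add: E_def)
          qed
          then have "2 * (real \<tau> + 2) * log 2 (real n) \<le> \<eta> * C * real n / 7200 * log 2 (real n)"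
            using lgn by (intro mult_right_mono) auto
          also have "\<dots> = (\<eta> * C * log 2 (real n)) * real n / 7200" by simp
          also have "\<dots> \<le> real l * real n / 7200"
            using \<eta>w l\<eta> by (intro divide_right_mono mult_right_mono) auto
          finally show ?thesis using P by (meson order.trans powr_mono one_le_numeral)
        qed
        have "real k * real n * real l \<le> 12 * real w * real B * real \<tau>"
          by (rule sorting_tradeoff[OF assms B _ l1 nl em_algorithmD(1)[OF R, of \<omega>] k(1) good _ z1 zr zP lP])
            (use n in \<open>auto simp: P_def\<close>)
        also have "\<dots> \<le> 12 * real w * real B * (6 * \<kappa> * (x * (log 2 x / lb)))"
          using \<tau>lb by (intro mult_left_mono) auto
        also have "\<dots> = 72 * \<kappa> * (real w * real n * (log 2 x / lb))"
          using B by (simp add: x_def)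
        finally have up: "real k * real n * real l \<le> 72 * \<kappa> * (real w * real n * (log 2 x / lb))" .
        \<comment> \<open>The factor 4 comes from the choice of the radius and 3 from the change of
          base. Together they give 12, and 12 * 72 = 864 exceeds what \<kappa> allows.\<close>
        have "log 2 x \<le> 4 * real k * (3 * lb)"
          using k(3) mult_left_mono[OF branching_le[OF B], of "4 * real k"] unfolding lb_def by linarith
        then have "log 2 x / lb \<le> 12 * real k" using lb1 by (simp add: divide_le_eq)
        then have "(log 2 x / lb) * real n * (\<eta> * real w) \<le> 12 * real k * real n * real l"
          using l\<eta> \<eta> lx0 lb1 by (intro mult_mono) auto
        then have "\<eta> * (real w * real n * (log 2 x / lb)) \<le> 12 * (real k * real n * real l)"
          by (simp only: mult_ac)
        also have "\<dots> \<le> 12 * (72 * \<kappa> * (real w * real n * (log 2 x / lb)))"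
          using up by (rule mult_left_mono) simp
        finally have "\<eta> * (real w * real n * (log 2 x / lb)) \<le> 864 * \<kappa> * (real w * real n * (log 2 x / lb))"
          by simp
        moreover have "0 < real w * real n * (log 2 x / lb)"
        proof -
          have "0 < real w" using wn lgn by linarith
          then show ?thesis using n lx0 lb1 by simp
        qed
        ultimately have "\<eta> \<le> 864 * \<kappa>" by (subst (asm) mult_le_cancel_right_pos) auto
        then show False using \<kappa>(3) \<eta> \<kappa>0 by linarith
      qed
    qed
  qed
qed

end
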